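(* The monoid $\mathbf{FB}^*_n$ is generated by the elements $\tilde{s}_i$ and $\tilde{\xi}_i$, $i=0,1,\dots,n-1$, subject to the following relations (a presentation of $\mathbf{FB}^*_n$), for all admissible indices in $\{0,1,\dots,n-1\}$: (1) $\tilde{s}_0\tilde{s}_1\tilde{s}_0\tilde{s}_1=\tilde{s}_1\tilde{s}_0\tilde{s}_1\tilde{s}_0$; $\tilde{s}_i\tilde{s}_j\tilde{s}_i=\tilde{s}_j\tilde{s}_i\tilde{s}_j$ for $i,j\ge1$, $|i-j|=1$; $\tilde{s}_i\tilde{s}_j=\tilde{s}_j\tilde{s}_i$ for $|i-j|>1$; (2) $\tilde{\xi}_i\tilde{s}_j\tilde{s}_i=\tilde{s}_j\tilde{s}_i\tilde{\xi}_j$ for $i,j\ge1$, $|i-j|=1$; (3) $\tilde{\xi}_0\tilde{s}_1\tilde{s}_0\tilde{s}_1=\tilde{s}_1\tilde{s}_0\tilde{s}_1\tilde{\xi}_0$; $\tilde{\xi}_1\tilde{s}_0\tilde{s}_1\tilde{s}_0=\tilde{s}_0\tilde{s}_1\tilde{s}_0\tilde{\xi}_1$; $\tilde{\xi}_i\tilde{s}_j=\tilde{s}_j\tilde{\xi}_i$ for $|i-j|>1$; (4) $\tilde{\xi}_i\tilde{\xi}_j=\tilde{\xi}_j\tilde{\xi}_i$ for $|i-j|>1$; (5) $\tilde{\xi}_i\tilde{s}_i=\tilde{s}_i\tilde{\xi}_i$ for all $i$; (6) $\tilde{s}_i^2=e$, $\tilde{\xi}_i^2=\tilde{\xi}_i$,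 $\tilde{\xi}_i\tilde{s}_i=\tilde{\xi}_i$ for all $i$ including $0$, and $\tilde{\xi}_i\tilde{\xi}_{i+1}=\tilde{\xi}_{i+1}\tilde{\xi}_i$ for $i=0,1,\dots,n-2$; (7) $\tilde{s}_1\tilde{\xi}_0\tilde{s}_1\tilde{\xi}_0=\tilde{\xi}_0\tilde{s}_1\tilde{\xi}_0\tilde{s}_1$; (8) $\tilde{s}_0\tilde{\xi}_1\tilde{s}_0\tilde{\xi}_1=\tilde{\xi}_1\tilde{s}_0\tilde{\xi}_1\tilde{s}_0$; (9) $\tilde{\xi}_0\tilde{\xi}_1=\tilde{s}_0\tilde{\xi}_1\tilde{s}_0\tilde{\xi}_1$.
   Context: Write $\overline{x}=-x$, $\underline{n}=\{1,\dots,n\}$, $\underline{\overline{n}}=\{\overline1,\dots,\overline n\}$, $X=\underline{\overline n}\cup\underline n$. $\mathbf{Bin}^{(2)}_n$ is the monoid of all binary relations on $X$ (Boolean matrix multiplication), and $\mathbf{Bin}^B_n$ is the centralizer in it of $\nabla=\{(i,\overline i): i\in X\}$, i.e. the relations invariant under $i\mapsto\overline i$. $\mathbf{Bin}^{B,\mathrm{ess}}_n$ is the submonoid of essential relations in $\mathbf{Bin}^B_n$ (those for which each $x\in X$ occurs as a first coordinate and as a second coordinate of some pair). For a relation $\rho$ on $X$, view $\rho$ as a bipartite graph $\Gamma_\rho$ with both parts equal to $X$ and let $\overline\rho$ be the relation whose graph is obtained by completing each connected component of $\Gamma_\rho$ to a complete bipartite graph. On $\mathbf{Bin}^{B,\mathrm{ess}}_n$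 the equivalence $\overline\rho=\overline{\rho'}$ is a congruence; the quotient monoid is denoted $\mathbf{IB}^*_n$ (type $B$ dual symmetric inverse monoid). Its elements can be identified with the bijections between quotients of $X$ that commute with $i\mapsto\overline i$. Its group of units is the group of signed permutations of $\underline n$, i.e. permutations of $X$ commuting with $i\mapsto\overline i$. Its idempotents correspond to equivalence relations on $X$ invariant under $i\mapsto\overline i$. $\mathbf{FB}^*_n$ is the maximal factorizable submonoid of $\mathbf{IB}^*_n$, i.e. the submonoid of all products $\sigma\xi$ with $\sigma$ a unit and $\xi$ an idempotent. $\tilde s_0$ is the transposition of $1$ and $\overline1$; for $1\le i\le n-1$, $\tilde s_i$ simultaneously transposes $i,i+1$ and $\overline i,\overline{i+1}$. $\tilde\xi_0$ is the idempotent corresponding to the equivalence relation on $X$ whose only non-singleton class is $\{1,\overline1\}$; for $1\le i\le n-1$, $\tilde\xi_i$ is the idempotent corresponding to the equivalence relation whose only non-singleton classes are $\{i,i+1\}$ and $\{\overline i,\overline{i+1}\}$. *)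

theory Defs
  imports "HOL-Algebra.Group" "HOL-Combinatorics.Transposition"
begin

section \<open>Monoid presentations\<close>

text \<open>The congruence on the free monoid \<open>lists A\<close> generated by the set of relations \<open>R\<close>.\<close>

inductive_set gen_cong :: "'g set \<Rightarrow> ('g list \<times> 'g list) set \<Rightarrow> ('g list \<times> 'g list) set"
  for A :: "'g set" and R :: "('g list \<times> 'g list) set"
where
  step: "(u, v) \<in> R \<Longrightarrow> a \<in> lists A \<Longrightarrow> b \<in> lists A \<Longrightarrow> (a @ u @ b, a @ v @ b) \<in> gen_cong A R"
| refl: "u \<in> lists A \<Longrightarrow> (u, u) \<in> gen_cong A R"
| sym: "(u, v) \<in> gen_cong A R \<Longrightarrow> (v, u) \<in> gen_cong A R"
| trans: "(u, v) \<in> gen_cong A R \<Longrightarrow> (v, w) \<in> gen_cong A R \<Longrightarrow> (u, w) \<in> gen_cong A R"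

definition word_eval :: "('m, 'x) monoid_scheme \<Rightarrow> ('g \<Rightarrow> 'm) \<Rightarrow> 'g list \<Rightarrow> 'm" where
  "word_eval M \<phi> w = foldr (\<lambda>g x. \<phi> g \<otimes>\<^bsub>M\<^esub> x) w \<one>\<^bsub>M\<^esub>"

text \<open>\<open>M\<close> is presented by the generators \<open>\<phi> g\<close>, \<open>g \<in> A\<close>, subject to the relations \<open>R\<close>: the
  homomorphism \<open>lists A \<rightarrow> M\<close> extending \<open>\<phi>\<close> is onto, and its kernel is the congruence generated
  by \<open>R\<close>.\<close>

definition has_presentation ::
  "('m, 'x) monoid_scheme \<Rightarrow> 'g set \<Rightarrow> ('g \<Rightarrow> 'm) \<Rightarrow> ('g list \<times> 'g list) set \<Rightarrow> bool" where
  "has_presentation M A \<phi> R \<longleftrightarrow>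
     monoid M \<and> \<phi> \<in> A \<rightarrow> carrier M \<and> R \<subseteq> lists A \<times> lists A \<and>
     word_eval M \<phi> ` lists A = carrier M \<and>
     (\<forall>u\<in>lists A. \<forall>v\<in>lists A. word_eval M \<phi> u = word_eval M \<phi> v \<longleftrightarrow> (u, v) \<in> gen_cong A R)"

section \<open>Binary relations of type B\<close>

text \<open>The barred copy of \<open>i\<close> is the integer \<open>- i\<close>.\<close>

definition signed_set :: "nat \<Rightarrow> int set" where
  "signed_set n = {i. 1 \<le> \<bar>i\<bar> \<and> \<bar>i\<bar> \<le> int n}"

text \<open>Multiplication of Boolean matrices is \<^const>\<open>relcomp\<close> (left factor first).\<close>

definition Bin2 :: "nat \<Rightarrow> (int \<times> int) set monoid" where
  "Bin2 n = \<lparr>carrier = Pow (signed_set n \<times> signed_set n), mult = (O), one = Id_on (signed_set n)\<rparr>"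

definition nabla :: "nat \<Rightarrow> (int \<times> int) set" where
  "nabla n = {(i, - i) | i. i \<in> signed_set n}"

definition BinB :: "nat \<Rightarrow> (int \<times> int) set monoid" where
  "BinB n = (Bin2 n)\<lparr>carrier :=
     {\<rho> \<in> carrier (Bin2 n). \<rho> \<otimes>\<^bsub>Bin2 n\<^esub> nabla n = nabla n \<otimes>\<^bsub>Bin2 n\<^esub> \<rho>}\<rparr>"

definition BinB_ess :: "nat \<Rightarrow> (int \<times> int) set monoid" where
  "BinB_ess n = (BinB n)\<lparr>carrier :=
     {\<rho> \<in> carrier (BinB n). Domain \<rho> = signed_set n \<and> Range \<rho> = signed_set n}\<rparr>"

text \<open>Adjacency relation of the bipartite graph of \<open>\<rho>\<close>; \<open>Inl\<close> and \<open>Inr\<close> are the two parts.\<close>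

definition bip_graph :: "('a \<times> 'a) set \<Rightarrow> (('a + 'a) \<times> ('a + 'a)) set" where
  "bip_graph \<rho> = {(Inl i, Inr j) | i j. (i, j) \<in> \<rho>} \<union> {(Inr j, Inl i) | i j. (i, j) \<in> \<rho>}"

text \<open>All pairs \<open>(i, j)\<close> such that \<open>i\<close> in the left part and \<open>j\<close> in the right part lie in the same
  connected component.\<close>

definition bip_completion :: "('a \<times> 'a) set \<Rightarrow> ('a \<times> 'a) set" where
  "bip_completion \<rho> = {(i, j). (Inl i, Inr j) \<in> (bip_graph \<rho>)\<^sup>*}"

section \<open>The type B dual symmetric inverse monoid and its factorizable part\<close>

definition completion_eq :: "nat \<Rightarrow> ((int \<times> int) set \<times> (int \<times> int) set) set" where
  "completion_eq n = {(\<rho>, \<rho>'). \<rho> \<in> carrier (BinB_ess n) \<and> \<rho>' \<in> carrier (BinB_ess n) \<and>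
     bip_completion \<rho> = bip_completion \<rho>'}"

definition IB_class :: "nat \<Rightarrow> (int \<times> int) set \<Rightarrow> (int \<times> int) set set" where
  "IB_class n \<rho> = completion_eq n `` {\<rho>}"

definition IB :: "nat \<Rightarrow> (int \<times> int) set set monoid" where
  "IB n = \<lparr>carrier = carrier (BinB_ess n) // completion_eq n,
           mult = (\<lambda>P Q. \<Union>\<rho>\<in>P. \<Union>\<tau>\<in>Q. IB_class n (\<rho> \<otimes>\<^bsub>BinB_ess n\<^esub> \<tau>)),
           one = IB_class n \<one>\<^bsub>BinB_ess n\<^esub>\<rparr>"

definition FB :: "nat \<Rightarrow> (int \<times> int) set set monoid" where
  "FB n = (IB n)\<lparr>carrier :=
     {\<sigma> \<otimes>\<^bsub>IB n\<^esub> \<xi> | \<sigma> \<xi>. \<sigma> \<in> Units (IB n) \<and> \<xi> \<in> carrier (IB n) \<and> \<xi> \<otimes>\<^bsub>IB n\<^esub> \<xi> = \<xi>}\<rparr>"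

section \<open>Generators\<close>

definition perm_elt :: "nat \<Rightarrow> (int \<Rightarrow> int) \<Rightarrow> (int \<times> int) set set" where
  "perm_elt n \<pi> = IB_class n {(x, \<pi> x) | x. x \<in> signed_set n}"

text \<open>The idempotent of the equivalence relation on the signed set whose non-singleton classes
  are the members of \<open>\<C>\<close>; an equivalence relation is a relation equal to its own completion.\<close>

definition equiv_elt :: "nat \<Rightarrow> int set set \<Rightarrow> (int \<times> int) set set" where
  "equiv_elt n \<C> = IB_class n (Id_on (signed_set n) \<union> (\<Union>C\<in>\<C>. C \<times> C))"

definition s_elt :: "nat \<Rightarrow> nat \<Rightarrow> (int \<times> int) set set" where
  "s_elt n i = perm_elt n
     (if i = 0 then transpose 1 (- 1)
      else transpose (int i) (int i + 1) \<circ> transpose (- int i) (- (int i + 1)))"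

definition xi_elt :: "nat \<Rightarrow> nat \<Rightarrow> (int \<times> int) set set" where
  "xi_elt n i = equiv_elt n
     (if i = 0 then {{1, - 1}} else {{int i, int i + 1}, {- int i, - (int i + 1)}})"

section \<open>Generating symbols and defining relations\<close>

datatype letter = S nat | Xi nat

fun letter_elt :: "nat \<Rightarrow> letter \<Rightarrow> (int \<times> int) set set" where
  "letter_elt n (S i) = s_elt n i"
| "letter_elt n (Xi i) = xi_elt n i"

definition alphabet :: "nat \<Rightarrow> letter set" where
  "alphabet n = S ` {..<n} \<union> Xi ` {..<n}"

definition rels1 :: "nat \<Rightarrow> (letter list \<times> letter list) set" where
  "rels1 n =
     (if 1 < n then {([S 0, S 1, S 0, S 1], [S 1, S 0, S 1, S 0])} else {}) \<union>
     {([S i, S j, S i], [S j, S i, S j]) | i j.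
        1 \<le> i \<and> i < n \<and> 1 \<le> j \<and> j < n \<and> \<bar>int i - int j\<bar> = 1} \<union>
     {([S i, S j], [S j, S i]) | i j. i < n \<and> j < n \<and> \<bar>int i - int j\<bar> > 1}"

definition rels2 :: "nat \<Rightarrow> (letter list \<times> letter list) set" where
  "rels2 n =
     {([Xi i, S j, S i], [S j, S i, Xi j]) | i j.
        1 \<le> i \<and> i < n \<and> 1 \<le> j \<and> j < n \<and> \<bar>int i - int j\<bar> = 1}"

definition rels3 :: "nat \<Rightarrow> (letter list \<times> letter list) set" where
  "rels3 n =
     (if 1 < n then {([Xi 0, S 1, S 0, S 1], [S 1, S 0, S 1, Xi 0])} else {}) \<union>
     (if 1 < n then {([Xi 1, S 0, S 1, S 0], [S 0, S 1, S 0, Xi 1])} else {}) \<union>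
     {([Xi i, S j], [S j, Xi i]) | i j. i < n \<and> j < n \<and> \<bar>int i - int j\<bar> > 1}"

definition rels4 :: "nat \<Rightarrow> (letter list \<times> letter list) set" where
  "rels4 n = {([Xi i, Xi j], [Xi j, Xi i]) | i j. i < n \<and> j < n \<and> \<bar>int i - int j\<bar> > 1}"

definition rels5 :: "nat \<Rightarrow> (letter list \<times> letter list) set" where
  "rels5 n = {([Xi i, S i], [S i, Xi i]) | i. i < n}"

definition rels6 :: "nat \<Rightarrow> (letter list \<times> letter list) set" where
  "rels6 n =
     {([S i, S i], []) | i. i < n} \<union>
     {([Xi i, Xi i], [Xi i]) | i. i < n} \<union>
     {([Xi i, S i], [Xi i]) | i. i < n} \<union>
     {([Xi i, Xi (i + 1)], [Xi (i + 1), Xi i]) | i. i + 1 < n}"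

definition rels7 :: "nat \<Rightarrow> (letter list \<times> letter list) set" where
  "rels7 n = (if 1 < n then {([S 1, Xi 0, S 1, Xi 0], [Xi 0, S 1, Xi 0, S 1])} else {})"

definition rels8 :: "nat \<Rightarrow> (letter list \<times> letter list) set" where
  "rels8 n = (if 1 < n then {([S 0, Xi 1, S 0, Xi 1], [Xi 1, S 0, Xi 1, S 0])} else {})"

definition rels9 :: "nat \<Rightarrow> (letter list \<times> letter list) set" where
  "rels9 n = (if 1 < n then {([Xi 0, Xi 1], [S 0, Xi 1, S 0, Xi 1])} else {})"

definition FB_rels :: "nat \<Rightarrow> (letter list \<times> letter list) set" where
  "FB_rels n = rels1 n \<union> rels2 n \<union> rels3 n \<union> rels4 n \<union> rels5 n \<union> rels6 n \<union> rels7 n \<union> rels8 n \<union> rels9 n"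

end

theory Submission
  imports Defs "HOL-Combinatorics.Permutations"
begin

text \<open>
  An equivalence relation on the signed set is called invariant here if it is stable under
  \<open>x \<mapsto> - x\<close>. Every element of \<open>FB n\<close> is a product \<open>[E] [g]\<close> of an idempotent, given by an
  invariant equivalence relation \<open>E\<close>, and a unit, given by a signed permutation \<open>g\<close>. Such a
  product determines \<open>E\<close>, and it determines \<open>g\<close> up to signed permutations that map every class of
  \<open>E\<close> to itself (\<open>normal_form_eq_iff\<close>). The relations are easily seen to hold, and the letters
  generate; the content of the theorem is that the relations suffice to bring two words with the
  same value to the same form.

  For this, let the relations hold for elements \<open>s i\<close>, \<open>xi i\<close> of an arbitrary monoid (locale
  \<open>FB_model\<close>). The relations between the \<open>s i\<close> are the Coxeter relations of type B, which present
  the group of signed permutations (\<open>ev_eqI\<close>); hence every signed permutation \<open>g\<close> has a well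
  defined value \<open>T g\<close> in the monoid. The stabilizer of the pair merged by \<open>xi i\<close> commutes with
  \<open>xi i\<close> (\<open>xi_transport\<close>). Therefore every pair of distinct points \<open>x\<close>, \<open>y\<close> has an idempotent
  \<open>atom x y\<close>, a conjugate of some \<open>xi i\<close>, which stands for the least invariant equivalence
  relation joining \<open>x\<close> and \<open>y\<close>, and these atoms are permuted by conjugation in the same way as the
  pairs (\<open>atom_conj\<close>). Since signed permutations act transitively on tuples of points with
  distinct absolute values, an identity between atoms has to be checked only for the points \<open>1\<close>,
  \<open>2\<close>, \<open>3\<close>, \<open>4\<close> and their negatives, where it is one of the given relations. In this way the atoms
  commute (\<open>atom_commute\<close>). An atom \<open>atom x y\<close> also absorbs the reflection exchanging \<open>x\<close> and \<open>y\<close>.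
  Using this, \<open>atom x y * atom y z\<close> is seen to absorb \<open>atom x z\<close> (\<open>atom_trans\<close>).

  It follows that the pairs whose atom is absorbed by a product of atoms form an invariant
  equivalence relation, so that the product depends only on the relation generated by its pairs
  (\<open>atoms_cong\<close>). A signed permutation that preserves every class of \<open>E\<close> is a product of
  reflections exchanging points equivalent under \<open>E\<close>. Hence the product of atoms belonging to \<open>E\<close>
  absorbs all of them (\<open>atoms_absorb_T\<close>), which is the ambiguity of \<open>g\<close> in \<open>[E] [g]\<close>.

  The result on arbitrary monoids is applied to the monoid of words modulo the congruence
  generated by the relations, realised by its right regular representation
  (\<open>right_mult_faithful\<close>).

  Products are read from left to right, in accordance with the composition of relations: the
  product of the elements of \<open>g\<close> and \<open>h\<close> is the element of \<open>h \<circ> g\<close>.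
\<close>

unbundle no m_inv_syntax

section \<open>Signed permutations\<close>

definition signed_perms :: "nat \<Rightarrow> (int \<Rightarrow> int) set" where
  "signed_perms n = {g. g permutes signed_set n \<and> (\<forall>x. g (- x) = - g x)}"

text \<open>The reflection that exchanges \<open>x\<close> with \<open>y\<close> and \<open>- x\<close> with \<open>- y\<close>. For \<open>y = - x\<close> the same
  formula gives the change of sign of \<open>x\<close>, so that both kinds of reflections are treated at once.\<close>

definition sreflect :: "int \<Rightarrow> int \<Rightarrow> int \<Rightarrow> int" where
  "sreflect x y z =
     (if z = x then y else if z = y then x else if z = - x then - y else if z = - y then - x else
         z)"

text \<open>The points exchanged by \<open>s i\<close> and merged by \<open>xi i\<close> are \<open>lo i\<close> and \<open>hi i\<close>. Writing the pair
  of index \<open>0\<close> as \<open>- 1\<close>, \<open>1\<close> gives \<open>hi i = i + 1\<close> throughout.\<close>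

definition lo :: "nat \<Rightarrow> int" where
  "lo i = (if i = 0 then - 1 else int i)"

abbreviation hi :: "nat \<Rightarrow> int" where
  "hi i \<equiv> int i + 1"

definition sgen :: "nat \<Rightarrow> int \<Rightarrow> int" where
  "sgen i = sreflect (lo i) (hi i)"

lemma finite_signed_set [simp]: "finite (signed_set n)"
  by (rule finite_subset[of _ "{- int n..int n}"]) (auto simp: signed_set_def)

lemma uminus_signed_set [simp]: "- x \<in> signed_set n \<longleftrightarrow> x \<in> signed_set n"
  by (simp add: signed_set_def)

lemma signed_set_nonzero: "x \<in> signed_set n \<Longrightarrow> x \<noteq> 0"
  by (auto simp: signed_set_def)

lemma lo_in: "i < n \<Longrightarrow> lo i \<in> signed_set n" and hi_in: "i < n \<Longrightarrow> hi i \<in> signed_set n"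
  by (auto simp: signed_set_def lo_def)

lemma signed_permsD:
  assumes "g \<in> signed_perms n"
  shows "g permutes signed_set n" "g (- x) = - g x" "g x \<in> signed_set n \<longleftrightarrow> x \<in> signed_set n"
    "inj g" "g x = g y \<longleftrightarrow> x = y" "g (inv g x) = x" "inv g (g x) = x"
  using assms permutes_in_image[of g "signed_set n"] permutes_inj[of g "signed_set n"]
  by (auto simp: signed_perms_def permutes_inverses dest: injD)

lemma signed_perms_id [simp]: "id \<in> signed_perms n"
  by (simp add: signed_perms_def permutes_id)

lemma signed_perms_comp: "g \<in> signed_perms n \<Longrightarrow> h \<in> signed_perms n \<Longrightarrow> h \<circ> g \<in> signed_perms n"
  by (auto simp: signed_perms_def permutes_compose)

lemma signed_perms_inv: "g \<in> signed_perms n \<Longrightarrow> inv g \<in> signed_perms n"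
proof -
  assume g: "g \<in> signed_perms n"
  have "inv g (- x) = - inv g x" for x
    using signed_permsD(2,6,7)[OF g] by metis
  with g show ?thesis by (auto simp: signed_perms_def permutes_inv)
qed

lemma signed_perms_inv_comp: "g \<in> signed_perms n \<Longrightarrow> inv g \<circ> g = id"
    "g \<in> signed_perms n \<Longrightarrow> g \<circ> inv g = id"
  using signed_permsD(6,7) by fastforce+

lemma signed_perms_outside: "g \<in> signed_perms n \<Longrightarrow> x \<notin> signed_set n \<Longrightarrow> g x = x"
  by (auto simp: signed_perms_def permutes_def)

lemma signed_permsI_involution:
  assumes "\<And>x. g (g x) = x" "\<And>x. g (- x) = - g x" "\<And>x. x \<notin> signed_set n \<Longrightarrow> g x = x"
  shows "g \<in> signed_perms n"
  using assms unfolding signed_perms_def permutes_def by (auto) metis+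

lemma sreflect_sreflect [simp]: "x \<noteq> 0 \<Longrightarrow> y \<noteq> 0 \<Longrightarrow> sreflect x y (sreflect x y z) = z"
  by (auto simp: sreflect_def)

lemma sreflect_comp [simp]: "x \<noteq> 0 \<Longrightarrow> y \<noteq> 0 \<Longrightarrow> sreflect x y \<circ> sreflect x y = id"
  by auto

lemma sreflect_signed_perms: "x \<in> signed_set n \<Longrightarrow> y \<in> signed_set n \<Longrightarrow> sreflect x y \<in> signed_perms n"
  by (rule signed_permsI_involution)
     (use signed_set_nonzero in \<open>auto simp: sreflect_def\<close>)

lemma sreflect_conj:
  assumes "g \<in> signed_perms n"
  shows "g \<circ> sreflect x y = sreflect (g x) (g y) \<circ> g"
  by (rule ext) (simp add: sreflect_def signed_permsD[OF assms] flip: signed_permsD(2)[OF assms])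

lemma sgen_signed_perms: "i < n \<Longrightarrow> sgen i \<in> signed_perms n"
  by (simp add: sgen_def sreflect_signed_perms lo_in hi_in)

lemma lo_nonzero [simp]: "lo i \<noteq> 0" and hi_nonzero [simp]: "hi i \<noteq> 0"
  by (auto simp: lo_def)

lemma sgen_sgen [simp]: "sgen i (sgen i x) = x"
  by (simp add: sgen_def)

lemma sgen_comp [simp]: "sgen i \<circ> sgen i = id"
  by auto

lemma perm_sgen:
  "g \<in> signed_perms n \<Longrightarrow> g \<circ> sgen i = sreflect (g (lo i)) (g (hi i)) \<circ> g"
  unfolding sgen_def by (rule sreflect_conj)

lemma sgen_sreflect: "sgen i \<circ> sreflect x y = sreflect (sgen i x) (sgen i y) \<circ> sgen i"
  by (rule sreflect_conj[OF sgen_signed_perms[OF lessI]])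

lemma sgen_conj: "sgen i \<circ> sgen j \<circ> sgen i = sreflect (sgen i (lo j)) (sgen i (hi j))"
  unfolding perm_sgen[OF sgen_signed_perms[OF lessI]] by (simp add: comp_assoc)

lemma inv_sgen: "inv (sgen i) = sgen i"
  by (rule inv_unique_comp) auto

lemma signed_perms_inv_distrib:
  "h \<in> signed_perms n \<Longrightarrow> g \<in> signed_perms n \<Longrightarrow> inv (g \<circ> h) = inv h \<circ> inv g"
  by (intro o_inv_distrib) (auto dest: signed_permsD(1) permutes_bij)

text \<open>One more prescribed value is obtained by composing with the reflection that exchanges the
  actual value with the desired one; it does not move the values fixed before, because their
  absolute values are different from those of both.\<close>

lemma signed_perm_extend:
  assumes "set xs \<subseteq> signed_set n" "distinct (map abs xs)"
  shows "\<exists>g\<in>signed_perms n. \<forall>k<length xs. g (int k + 1) = xs ! k"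
  using assms
proof (induction xs rule: rev_induct)
  case Nil
  then show ?case by (intro bexI[of _ id]) simp_all
next
  case (snoc x xs)
  then obtain g where g: "g \<in> signed_perms n" and gx: "\<And>k. k < length xs \<Longrightarrow> g (int k + 1) = xs ! k"
    by auto
  let ?l = "length xs"
  have "abs ` set (xs @ [x]) \<subseteq> {1..int n}" using snoc.prems(1) by (auto simp: signed_set_def)
  then have "card (abs ` set (xs @ [x])) \<le> n" using card_mono[of "{1..int n}"] by fastforce
  moreover have "card (abs ` set (xs @ [x])) = Suc ?l"
    using distinct_card[OF snoc.prems(2)] by simp
  ultimately have l: "Suc ?l \<le> n" by simp
  define y where "y = g (int ?l + 1)"
  have y: "y \<in> signed_set n" unfolding y_def signed_permsD(3)[OF g] using l by (simp add:
      signed_set_def)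
  have x: "x \<in> signed_set n" using snoc.prems by simp
  let ?h = "sreflect y x \<circ> g"
  have "?h \<in> signed_perms n" using g x y by (intro signed_perms_comp sreflect_signed_perms)
  moreover have "?h (int k + 1) = (xs @ [x]) ! k" if k: "k < length (xs @ [x])" for k
  proof (cases "k = ?l")
    case True
    then show ?thesis by (simp add: y_def[symmetric]) (simp add: sreflect_def)
  next
    case False
    then have k': "k < ?l" using k by simp
    have "\<bar>x\<bar> \<notin> abs ` set xs" using snoc.prems(2) by auto
    then have "\<bar>xs ! k\<bar> \<noteq> \<bar>x\<bar>" using nth_mem[OF k'] by (metis image_eqI)
    moreover have "xs ! k \<noteq> y" "xs ! k \<noteq> - y"
      using k' gx[OF k', symmetric] unfolding y_def
      by (auto simp flip: signed_permsD(2)[OF g] simp: signed_permsD(5)[OF g])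
    moreover have "- (xs ! k) \<noteq> x" "- (xs ! k) \<noteq> y" using calculation by auto
    ultimately have "sreflect y x (xs ! k) = xs ! k" unfolding sreflect_def by auto
    then show ?thesis using k' gx[OF k'] by (simp add: nth_append)
  qed
  ultimately show ?case by blast
qed

lemma length_le_of_distinct_abs:
  assumes "set xs \<subseteq> signed_set n" "distinct (map abs xs)"
  shows "length xs \<le> n"
proof -
  have "abs ` set xs \<subseteq> {1..int n}" using assms(1) by (auto simp: signed_set_def)
  then have "card (abs ` set xs) \<le> n" using card_mono[of "{1..int n}"] by fastforce
  then show ?thesis using distinct_card[OF assms(2)] by simp
qed

lemma perm_pair:
  assumes "x \<in> signed_set n" "y \<in> signed_set n" "x \<noteq> y"
  shows "\<exists>i<n. \<exists>g\<in>signed_perms n. g (lo i) = x \<and> g (hi i) = y"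
proof (cases "y = - x")
  case True
  then obtain g where g: "g \<in> signed_perms n" "g 1 = y"
    using signed_perm_extend[of "[y]" n] assms by auto
  then have "g (- 1) = x" using True signed_permsD(2)[OF g(1), of 1] by simp
  moreover have "0 < n" using assms(1) by (auto simp: signed_set_def)
  ultimately show ?thesis using g by (intro exI[of _ 0]) (auto simp: lo_def)
next
  case False
  then have xy: "\<bar>x\<bar> \<noteq> \<bar>y\<bar>" using assms by linarith
  then obtain g where g: "g \<in> signed_perms n" "\<forall>k<2. g (int k + 1) = [x, y] ! k"
    using signed_perm_extend[of "[x, y]" n] assms by (auto simp: numeral_2_eq_2)
  have "1 < n" using assms xy by (auto simp: signed_set_def)
  moreover have "g 1 = x" "g 2 = y" using g(2)[rule_format, of 0] g(2)[rule_format, of 1] by auto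
  ultimately show ?thesis using g(1) by (intro exI[of _ 1]) (auto simp: lo_def)
qed

section \<open>Words in the reflections\<close>

text \<open>The leftmost letter acts first, as in a composition of relations.\<close>

fun sword :: "nat list \<Rightarrow> int \<Rightarrow> int" where
  "sword [] = id"
| "sword (i # w) = sword w \<circ> sgen i"

lemma sword_append [simp]: "sword (u @ v) = sword v \<circ> sword u"
  by (induction u) auto

lemma sword_signed_perms: "w \<in> lists {..<n} \<Longrightarrow> sword w \<in> signed_perms n"
  by (induction w) (auto simp: sgen_signed_perms signed_perms_comp)

lemma sword_rev: "sword w \<circ> sword (rev w) = id" "sword (rev w) \<circ> sword w = id"
proof -
  show "sword w \<circ> sword (rev w) = id" for w
  proof (induction w)
    case (Cons i w)
    then show ?case by (simp add: fun_eq_iff)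
  qed simp
  from this[of "rev w"] show "sword (rev w) \<circ> sword w = id" by simp
qed

text \<open>Representatives of the right cosets of the subgroup generated by the first \<open>k - 1\<close>
  reflections in the group generated by the first \<open>k\<close>: the subgroup fixes the point \<open>k\<close>, and
  \<open>coset_word k x\<close> moves \<open>k\<close> step by step down to \<open>x\<close> or, for negative \<open>x\<close>, down to \<open>1\<close>, through
  the change of sign and on to \<open>x\<close>.\<close>

definition coset_word :: "nat \<Rightarrow> int \<Rightarrow> nat list" where
  "coset_word k x = (if x > 0 then rev [nat x..<k] else rev [0..<k] @ [1..<nat (- x)])"

lemma coset_word_in: "x \<in> signed_set k \<Longrightarrow> coset_word k x \<in> lists {..<k}"
  by (auto simp: coset_word_def signed_set_def)

lemma sword_down: "a \<le> k \<Longrightarrow> a \<ge> 1 \<Longrightarrow> sword (rev [a..<k]) (int k) = int a"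
proof (induction k)
  case (Suc k)
  then show ?case
    by (cases "a = Suc k") (auto simp: sgen_def sreflect_def lo_def)
qed simp

lemma sword_up: "b \<ge> 1 \<Longrightarrow> sword [1..<b] (- 1) = - int b"
proof (induction b)
  case (Suc b)
  then show ?case
    by (cases "b = 0") (auto simp: sgen_def sreflect_def lo_def)
qed simp

lemma sword_coset_word: "x \<in> signed_set k \<Longrightarrow> sword (coset_word k x) (int k) = x"
proof (cases "x > 0")
  case True
  assume "x \<in> signed_set k"
  with True sword_down[of "nat x" k] show ?thesis by (auto simp: coset_word_def signed_set_def)
next
  case False
  assume x: "x \<in> signed_set k"
  then have k: "1 \<le> k" by (auto simp: signed_set_def)
  have "rev [0..<k] = rev [1..<k] @ [0]" using k by (simp add: upt_conv_Cons)
  then show ?thesis using False x sword_down[of 1 k] sword_up[of "nat (- x)"] k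
    by (auto simp: coset_word_def signed_set_def sgen_def sreflect_def lo_def)
qed

lemma sword_fix: "w \<in> lists {..<k} \<Longrightarrow> \<bar>x\<bar> > int k \<Longrightarrow> sword w x = x"
  using signed_perms_outside[OF sword_signed_perms[of w k], of x] by (auto simp: signed_set_def)

lemma signed_perms_Suc:
  assumes g: "g \<in> signed_perms (Suc k)" and top: "g (int (Suc k)) = int (Suc k)"
  shows "g \<in> signed_perms k"
proof -
  have "g x = x" if "x \<notin> signed_set k" for x
  proof -
    have "x \<notin> signed_set (Suc k) \<or> x = int (Suc k) \<or> x = - int (Suc k)"
      using that by (auto simp: signed_set_def)
    then consider "x \<notin> signed_set (Suc k)" | "x = int (Suc k)" | "x = - int (Suc k)"
      by blast
    then show ?thesis
      using top signed_perms_outside[OF g] signed_permsD(2)[OF g] by cases metis+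
  qed
  then show ?thesis using g unfolding signed_perms_def permutes_def by auto
qed

text \<open>The coset word of the image of the largest point can be split off; the remaining factor
  fixes that point.\<close>

lemma signed_perm_word:
  assumes "g \<in> signed_perms k"
  shows "\<exists>w\<in>lists {..<k}. sword w = g"
  using assms
proof (induction k arbitrary: g)
  case 0
  then have "g = id" by (auto simp: signed_perms_def signed_set_def permutes_def)
  then show ?case by (intro bexI[of _ "[]"]) auto
next
  case (Suc k)
  let ?x = "g (int (Suc k))"
  have x: "?x \<in> signed_set (Suc k)"
    using signed_permsD(3)[OF Suc.prems] by (auto simp: signed_set_def)
  let ?r = "coset_word (Suc k) ?x"
  have r: "?r \<in> lists {..<Suc k}" using coset_word_in[OF x] .
  let ?h = "sword (rev ?r) \<circ> g"
  have "sword (rev ?r) \<in> signed_perms (Suc k)"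
    using r by (intro sword_signed_perms) auto
  then have "?h \<in> signed_perms (Suc k)" using Suc.prems by (intro signed_perms_comp)
  moreover have "?h (int (Suc k)) = int (Suc k)"
    using fun_cong[OF sword_rev(2)[of ?r], of "int (Suc k)"] sword_coset_word[OF x] by simp
  ultimately have "?h \<in> signed_perms k" by (rule signed_perms_Suc)
  from Suc.IH[OF this] obtain w where w: "w \<in> lists {..<k}" "sword w = ?h" by blast
  have "sword (w @ ?r) = (sword ?r \<circ> sword (rev ?r)) \<circ> g" using w by (simp add: comp_assoc)
  then have "sword (w @ ?r) = g" by (simp add: sword_rev)
  moreover have "w @ ?r \<in> lists {..<Suc k}" using w r by (auto simp: less_Suc_eq in_lists_conv_set)
  ultimately show ?case by blast
qed

text \<open>The action of the group on the cosets: the word for \<open>x\<close> followed by the letter \<open>i\<close> equals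
  the word for \<open>sgen i x\<close> preceded by \<open>coset_carry x i\<close>, a word in the smaller subgroup. A letter
  that moves \<open>x\<close> only changes the representative, and then the carry is empty.\<close>

definition coset_carry :: "int \<Rightarrow> nat \<Rightarrow> nat list" where
  "coset_carry x i =
     (if i = nat \<bar>x\<bar> \<or> Suc i = nat \<bar>x\<bar> then [] else if i < nat \<bar>x\<bar> then [i] else [i - 1])"

section \<open>Transformation monoids\<close>

text \<open>Transformations of a type, composed from left to right, with the class structure of a
  monoid. This makes statements about arbitrary models applicable to signed permutations and to
  the regular representation of a monoid of words.\<close>

typedef 'a endo = "UNIV :: ('a \<Rightarrow> 'a) set" morphisms act Endo
  by simp

setup_lifting type_definition_endo

instantiation endo :: (type) monoid_mult
begin

lift_definition one_endo :: "'a endo" is id .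

lift_definition times_endo :: "'a endo \<Rightarrow> 'a endo \<Rightarrow> 'a endo" is "\<lambda>f g. g \<circ> f" .

instance by standard (transfer; simp add: comp_assoc)+

end

section \<open>The Coxeter presentation of the signed permutations\<close>

locale coxeter_B =
  fixes n :: nat and s :: "nat \<Rightarrow> 'm::monoid_mult"
  assumes s_sq: "i < n \<Longrightarrow> s i * s i = 1"
    and braid: "1 \<le> i \<Longrightarrow> Suc i < n \<Longrightarrow> s i * s (Suc i) * s i = s (Suc i) * s i * s (Suc i)"
    and braid0: "1 < n \<Longrightarrow> s 0 * s 1 * s 0 * s 1 = s 1 * s 0 * s 1 * s 0"
    and far: "Suc i < j \<Longrightarrow> j < n \<Longrightarrow> s i * s j = s j * s i"
begin

definition ev :: "nat list \<Rightarrow> 'm" where "ev w = prod_list (map s w)"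

lemma ev_simps [simp]: "ev [] = 1" "ev (i # w) = s i * ev w" "ev (u @ v) = ev u * ev v"
  by (auto simp: ev_def)

lemma ev_comm_far:
  assumes "\<And>j. j \<in> set w \<Longrightarrow> j < n \<and> (Suc i < j \<or> Suc j < i)" "i < n"
  shows "s i * ev w = ev w * s i"
  using assms(1)
proof (induction w)
  case (Cons j w)
  then have j: "s i * s j = s j * s i" using far[of i j] far[of j i] assms(2) by fastforce
  have "s i * ev (j # w) = (s i * s j) * ev w" by (simp add: mult.assoc)
  also have "\<dots> = s j * (s i * ev w)" by (simp only: j mult.assoc)
  also have "\<dots> = ev (j # w) * s i" using Cons by (simp add: mult.assoc)
  finally show ?case .
qed simp

text \<open>A letter passes through a descending run by one braid move, at the place where the run
  contains this letter and its predecessor; it commutes with the rest of the run.\<close>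

lemma ev_down_shift:
  assumes "a < i" "2 \<le> i" "i < k" "k \<le> n"
  shows "ev (rev [a..<k]) * s i = s (i - 1) * ev (rev [a..<k])"
proof -
  obtain j where i: "i = Suc j" "1 \<le> j" using assms by (cases i) auto
  have "[a..<k] = [a..<j] @ j # Suc j # [Suc (Suc j)..<k]"
    using assms i upt_add_eq_append[of a j "k - j"] by (simp add: upt_conv_Cons)
  then have split: "ev (rev [a..<k]) = ev (rev [Suc (Suc j)..<k]) * s i * s j * ev (rev [a..<j])"
    using i by (simp add: mult.assoc)
  let ?D = "ev (rev [Suc (Suc j)..<k])" and ?E = "ev (rev [a..<j])"
  have 1: "s i * ?E = ?E * s i" using assms i by (intro ev_comm_far) auto
  have 2: "s j * ?D = ?D * s j" using assms i by (intro ev_comm_far) auto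
  have 3: "s i * s j * s i = s j * s i * s j" using braid[of j] i assms by simp
  have "ev (rev [a..<k]) * s i = ?D * (s i * s j * s i) * ?E"
    using 1 by (simp add: split mult.assoc)
  also have "\<dots> = s j * (?D * s i * s j * ?E)"
    unfolding 3 mult.assoc[symmetric] 2 ..
  finally show ?thesis using i split by simp
qed

lemma ev_up_shift:
  assumes "1 \<le> i" "a \<le> i" "Suc i < b" "b \<le> n"
  shows "ev [a..<b] * s i = s (Suc i) * ev [a..<b]"
proof -
  have "[a..<b] = [a..<i] @ i # Suc i # [Suc (Suc i)..<b]"
    using assms upt_add_eq_append[of a i "b - i"] by (simp add: upt_conv_Cons)
  then have split: "ev [a..<b] = ev [a..<i] * s i * s (Suc i) * ev [Suc (Suc i)..<b]"
    by (simp add: mult.assoc)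
  let ?D = "ev [Suc (Suc i)..<b]" and ?E = "ev [a..<i]"
  have 1: "s i * ?D = ?D * s i" using assms by (intro ev_comm_far) auto
  have 2: "s (Suc i) * ?E = ?E * s (Suc i)" using assms by (intro ev_comm_far) auto
  have "ev [a..<b] * s i = ?E * (s i * s (Suc i) * s i) * ?D"
    using 1 by (simp add: split mult.assoc)
  also have "\<dots> = s (Suc i) * (?E * s i * s (Suc i) * ?D)"
    unfolding braid[OF assms(1) order.strict_trans2[OF assms(3,4)]] mult.assoc[symmetric] 2 ..
  finally show ?thesis using split by simp
qed

text \<open>The cases are those of a letter extending or cancelling the end of the coset word, or else
  passing through it: by commutation, by one braid move in a run that contains both the letter and
  a neighbour of it, or by the relation of length four when the letter \<open>0\<close> meets the turning point
  of a word for negative \<open>x\<close>.\<close>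

lemma ev_coset_word_step:
  assumes x: "x \<in> signed_set k" and i: "i < k" and k: "k \<le> n"
  shows "ev (coset_word k x @ [i]) = ev (coset_carry x i @ coset_word k (sgen i x))"
proof (cases "x > 0")
  case True
  define a where "a = nat x"
  have a: "x = int a" "1 \<le> a" "a \<le> k" using True x by (auto simp: a_def signed_set_def)
  have cw: "coset_word k (int a) = rev [a..<k]" using a by (simp add: coset_word_def)
  consider "i = a" | "Suc i = a" "i > 0" | "Suc i = a" "i = 0" | "Suc i < a" | "a < i" by linarith
  then show ?thesis
  proof cases
    case 1
    then have "rev [a..<k] = rev [Suc a..<k] @ [i]" using i by (simp add: upt_conv_Cons)
    moreover have "sgen i x = int (Suc a)" using 1 a by (auto simp: sgen_def sreflect_def lo_def)
    moreover have "s i * s i = 1" using i k by (simp add: s_sq)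
    ultimately show ?thesis using 1 a
      by (simp add: cw coset_carry_def coset_word_def mult.assoc nat_add_distrib)
  next
    case 2
    then have "rev [i..<k] = rev [a..<k] @ [i]" using i by (simp add: upt_conv_Cons)
    moreover have "sgen i x = int i" using 2 a by (auto simp: sgen_def sreflect_def lo_def)
    ultimately show ?thesis using 2 a
      by (simp add: cw coset_carry_def coset_word_def)
  next
    case 3
    then have "rev [0..<k] = rev [a..<k] @ [i]" using i by (simp add: upt_conv_Cons)
    moreover have "sgen i x = - 1" using 3 a by (auto simp: sgen_def sreflect_def lo_def)
    ultimately show ?thesis using 3 a
      by (simp add: cw coset_carry_def coset_word_def)
  next
    case 4
    then have "s i * ev (rev [a..<k]) = ev (rev [a..<k]) * s i"
      using a k by (intro ev_comm_far) auto
    moreover have "sgen i x = x" using 4 a by (auto simp: sgen_def sreflect_def lo_def)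
    ultimately show ?thesis using 4 a
      by (simp add: cw coset_carry_def)
  next
    case 5
    then have "ev (rev [a..<k]) * s i = s (i - 1) * ev (rev [a..<k])"
      using a k i by (intro ev_down_shift) auto
    moreover have "sgen i x = x" using 5 a by (auto simp: sgen_def sreflect_def lo_def)
    ultimately show ?thesis using 5 a
      by (simp add: cw coset_carry_def)
  qed
next
  case False
  define a where "a = nat (- x)"
  have a: "x = - int a" "1 \<le> a" "a \<le> k" using False x by (auto simp: a_def signed_set_def)
  have cw: "coset_word k (- int a) = rev [0..<k] @ [1..<a]" using a by (simp add: coset_word_def)
  let ?D = "ev (rev [0..<k])" and ?U = "ev [1..<a]"
  consider "i = a" | "Suc i = a" "i > 0" | "Suc i = a" "i = 0" | "Suc i < a" "i = 0"
    | "Suc i < a" "i > 0" | "a < i" by linarith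
  then show ?thesis
  proof cases
    case 1
    moreover have "sgen i x = - int (Suc a)" using 1 a by (auto simp: sgen_def sreflect_def lo_def)
    moreover have "coset_word k (- int (Suc a)) = rev [0..<k] @ [1..<a] @ [i]"
      using 1 a by (simp add: coset_word_def nat_add_distrib)
    ultimately show ?thesis using a by (simp add: cw coset_carry_def)
  next
    case 2
    then have "[1..<a] = [1..<i] @ [i]" by auto
    moreover have "sgen i x = - int i" using 2 a by (auto simp: sgen_def sreflect_def lo_def)
    moreover have "s i * s i = 1" using i k by (simp add: s_sq)
    ultimately show ?thesis using 2 a
      by (simp add: cw coset_carry_def coset_word_def mult.assoc)
  next
    case 3
    then have "rev [0..<k] = rev [1..<k] @ [0]" using i by (simp add: upt_conv_Cons)
    moreover have "sgen i x = 1" using 3 a by (auto simp: sgen_def sreflect_def lo_def)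
    moreover have "s 0 * s 0 = 1" using i k by (simp add: s_sq)
    ultimately show ?thesis using 3 a
      by (simp add: cw coset_carry_def coset_word_def mult.assoc)
  next
    case 4
    have "rev [0..<k] = rev [2..<k] @ [1, 0]"
      using 4 a by (simp add: upt_conv_Cons numeral_2_eq_2)
    then have D: "?D = ev (rev [2..<k]) * s 1 * s 0" by (simp add: mult.assoc)
    have "[1..<a] = 1 # [2..<a]" using 4 by (simp add: upt_conv_Cons numeral_2_eq_2)
    then have U: "?U = s 1 * ev [2..<a]" by simp
    have c1: "s 0 * ev (rev [2..<k]) = ev (rev [2..<k]) * s 0" using a k 4 by (intro ev_comm_far)
        auto
    have c2: "s 0 * ev [2..<a] = ev [2..<a] * s 0" using a k 4 by (intro ev_comm_far) auto
    have b: "s 1 * s 0 * s 1 * s 0 = s 0 * s 1 * s 0 * s 1" using 4 a k braid0 by simp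
    have "?D * ?U * s 0 = ev (rev [2..<k]) * (s 1 * s 0 * s 1 * s 0) * ev [2..<a]"
      unfolding D U by (simp only: mult.assoc c2)
    also have "\<dots> = s 0 * (?D * ?U)"
      unfolding b D U mult.assoc[symmetric] c1 ..
    finally have "?D * ?U * s 0 = s 0 * (?D * ?U)" .
    moreover have "sgen i x = x" using 4 a by (auto simp: sgen_def sreflect_def lo_def)
    ultimately show ?thesis using 4 a by (simp add: cw coset_carry_def mult.assoc)
  next
    case 5
    have 1: "?U * s i = s (Suc i) * ?U" using 5 a k by (intro ev_up_shift) auto
    have 2: "?D * s (Suc i) = s i * ?D" using ev_down_shift[of 0 "Suc i" k] 5 a k by simp
    have "?D * ?U * s i = s i * (?D * ?U)"
      unfolding mult.assoc 1 unfolding mult.assoc[symmetric] 2 ..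
    moreover have "sgen i x = x" using 5 a by (auto simp: sgen_def sreflect_def lo_def)
    ultimately show ?thesis using 5 a by (simp add: cw coset_carry_def mult.assoc)
  next
    case 6
    have 1: "s i * ?U = ?U * s i" using 6 a k i by (intro ev_comm_far) auto
    have 2: "?D * s i = s (i - 1) * ?D" using 6 a k i by (intro ev_down_shift) auto
    have "?D * ?U * s i = s (i - 1) * (?D * ?U)"
      unfolding mult.assoc 1[symmetric] unfolding mult.assoc[symmetric] 2 ..
    moreover have "sgen i x = x" using 6 a by (auto simp: sgen_def sreflect_def lo_def)
    ultimately show ?thesis using 6 a by (simp add: cw coset_carry_def mult.assoc)
  qed
qed

end

lemma coset_carry_in:
  "x \<in> signed_set (Suc k) \<Longrightarrow> i < Suc k \<Longrightarrow> coset_carry x i \<in> lists {..<k}"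
  by (auto simp: coset_carry_def signed_set_def)

lemma coxeter_B_sgen: "coxeter_B n (\<lambda>i. Endo (sgen i))"
proof
  fix i
  show "Endo (sgen i) * Endo (sgen i) = 1"
    by (simp add: times_endo.abs_eq one_endo.abs_eq)
next
  fix i :: nat
  assume "1 \<le> i"
  then have "sgen i \<circ> sgen (Suc i) \<circ> sgen i = sgen (Suc i) \<circ> sgen i \<circ> sgen (Suc i)"
    unfolding sgen_conj by (simp add: sgen_def sreflect_def lo_def)
  then show "Endo (sgen i) * Endo (sgen (Suc i)) * Endo (sgen i) =
     Endo (sgen (Suc i)) * Endo (sgen i) * Endo (sgen (Suc i))"
    by (simp add: times_endo.abs_eq comp_assoc)
next
  let ?r = "sreflect (- 2) 2"
  have r: "sgen 1 \<circ> sgen 0 \<circ> sgen 1 = ?r"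
    by (subst sgen_conj) (simp add: sgen_def sreflect_def lo_def)
  have "sgen 1 \<circ> sgen 0 \<circ> sgen 1 \<circ> sgen 0 = ?r \<circ> sgen 0"
    by (simp only: r)
  also have "\<dots> = sgen 0 \<circ> ?r"
    by (subst sgen_sreflect) (simp add: sgen_def sreflect_def lo_def)
  also have "\<dots> = sgen 0 \<circ> sgen 1 \<circ> sgen 0 \<circ> sgen 1"
    by (simp only: r[symmetric] comp_assoc)
  finally have "sgen 1 \<circ> sgen 0 \<circ> sgen 1 \<circ> sgen 0 = sgen 0 \<circ> sgen 1 \<circ> sgen 0 \<circ> sgen 1" .
  then show "Endo (sgen 0) * Endo (sgen 1) * Endo (sgen 0) * Endo (sgen 1) =
      Endo (sgen 1) * Endo (sgen 0) * Endo (sgen 1) * Endo (sgen 0)"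
    by (simp add: times_endo.abs_eq comp_assoc)
next
  fix i j :: nat
  assume "Suc i < j"
  then have "sgen i \<circ> sgen j = sgen j \<circ> sgen i"
    by (subst perm_sgen[OF sgen_signed_perms[OF lessI]]) (simp add: sgen_def sreflect_def lo_def)
  then show "Endo (sgen i) * Endo (sgen j) = Endo (sgen j) * Endo (sgen i)"
    by (simp add: times_endo.abs_eq)
qed

text \<open>The signed permutations themselves satisfy the Coxeter relations, so this is another
  instance of \<open>ev_coset_word_step\<close>.\<close>

lemma sword_coset_word_step:
  assumes "x \<in> signed_set k" "i < k"
  shows "sword (coset_word k x @ [i]) = sword (coset_carry x i @ coset_word k (sgen i x))"
proof -
  interpret coxeter_B k "\<lambda>i. Endo (sgen i)" by (rule coxeter_B_sgen)
  have "ev w = Endo (sword w)" for w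
    by (induction w) (simp_all add: times_endo.abs_eq one_endo.abs_eq id_def comp_def)
  with ev_coset_word_step[OF assms] show ?thesis by (simp add: Endo_inject del: sword_append)
qed

context coxeter_B
begin

lemma coset_normal_form:
  assumes "w \<in> lists {..<Suc k}" "Suc k \<le> n"
  shows "\<exists>h\<in>lists {..<k}. \<exists>x\<in>signed_set (Suc k).
    ev w = ev (h @ coset_word (Suc k) x) \<and> sword w = sword (h @ coset_word (Suc k) x)"
  using assms(1)
proof (induction w rule: rev_induct)
  case Nil
  have "coset_word (Suc k) (int (Suc k)) = []" by (simp add: coset_word_def nat_add_distrib)
  moreover have "int (Suc k) \<in> signed_set (Suc k)" by (simp add: signed_set_def)
  ultimately show ?case by (intro bexI[of _ "[]"] bexI[of _ "int (Suc k)"]) auto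
next
  case (snoc i w)
  then have i: "i < Suc k" by simp
  from snoc.prems have "w \<in> lists {..<Suc k}" by simp
  from snoc.IH[OF this] obtain h x where h: "h \<in> lists {..<k}" and x: "x \<in> signed_set (Suc k)"
    and w: "ev w = ev (h @ coset_word (Suc k) x)" "sword w = sword (h @ coset_word (Suc k) x)"
    by blast
  let ?c = "coset_carry x i" and ?x = "sgen i x"
  have "?x \<in> signed_set (Suc k)"
    using signed_permsD(3)[OF sgen_signed_perms[OF i]] x by simp
  moreover have "h @ ?c \<in> lists {..<k}" using h coset_carry_in[OF x i] by simp
  moreover have "ev (w @ [i]) = ev ((h @ ?c) @ coset_word (Suc k) ?x)"
    using ev_coset_word_step[OF x i assms(2)] w(1) by (simp add: mult.assoc)
  moreover have "sword (w @ [i]) = sword ((h @ ?c) @ coset_word (Suc k) ?x)"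
  proof -
    have "sword (w @ [i]) = sword (coset_word (Suc k) x @ [i]) \<circ> sword h"
      using w(2) by (simp add: comp_assoc)
    also have "\<dots> = sword ((h @ ?c) @ coset_word (Suc k) ?x)"
      unfolding sword_coset_word_step[OF x i] by (simp add: comp_assoc)
    finally show ?thesis .
  qed
  ultimately show ?case by blast
qed

text \<open>The Coxeter relations present the group of signed permutations. In the coset normal form of
  a word, the coset is determined by the image of the largest point under the signed permutation;
  the other factor is a word in fewer generators, to which induction applies.\<close>

theorem ev_eqI:
  assumes "u \<in> lists {..<k}" "v \<in> lists {..<k}" "k \<le> n" "sword u = sword v"
  shows "ev u = ev v"
  using assms
proof (induction k arbitrary: u v)
  case 0
  then show ?case by simp
next
  case (Suc k)
  let ?N = "int (Suc k)"
  obtain g x where g: "g \<in> lists {..<k}" and x: "x \<in> signed_set (Suc k)"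
    and u: "ev u = ev (g @ coset_word (Suc k) x)" "sword u = sword (g @ coset_word (Suc k) x)"
    using coset_normal_form[OF Suc.prems(1,3)] by blast
  obtain h y where h: "h \<in> lists {..<k}" and y: "y \<in> signed_set (Suc k)"
    and v: "ev v = ev (h @ coset_word (Suc k) y)" "sword v = sword (h @ coset_word (Suc k) y)"
    using coset_normal_form[OF Suc.prems(2,3)] by blast
  have "sword u ?N = sword (coset_word (Suc k) x) (sword g ?N)" by (simp only: u(2) sword_append
      comp_apply)
  also have "\<dots> = x" using sword_coset_word[OF x] by (subst sword_fix[OF g]) auto
  finally have ux: "sword u ?N = x" .
  have "sword v ?N = sword (coset_word (Suc k) y) (sword h ?N)" by (simp only: v(2) sword_append
      comp_apply)
  also have "\<dots> = y" using sword_coset_word[OF y] by (subst sword_fix[OF h]) auto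
  finally have xy: "y = x" using ux Suc.prems(4) by simp
  let ?c = "sword (coset_word (Suc k) x)" and ?d = "sword (rev (coset_word (Suc k) x))"
  have "?c \<circ> sword g = sword u" by (simp only: u(2) sword_append)
  also have "\<dots> = ?c \<circ> sword h" by (simp only: Suc.prems(4) v(2) sword_append xy)
  finally have "?c \<circ> sword g = ?c \<circ> sword h" .
  then have "?d \<circ> (?c \<circ> sword g) = ?d \<circ> (?c \<circ> sword h)" by (rule arg_cong)
  then have "sword g = sword h" by (simp only: sword_rev comp_assoc[symmetric] id_comp)
  then have "ev g = ev h" using Suc.prems(3) by (intro Suc.IH g h) auto
  then show ?case by (simp only: u(1) v(1) xy ev_simps)
qed

text \<open>The value of a signed permutation; by \<open>ev_eqI\<close> it does not depend on the chosen word.\<close>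

definition T :: "(int \<Rightarrow> int) \<Rightarrow> 'm" where
  "T g = ev (SOME w. w \<in> lists {..<n} \<and> sword w = g)"

lemma T_sword: "w \<in> lists {..<n} \<Longrightarrow> T (sword w) = ev w"
  unfolding T_def by (rule someI2[of _ w]) (auto intro: ev_eqI)

lemma T_id [simp]: "T id = 1"
  using T_sword[of "[]"] by simp

lemma T_sgen: "i < n \<Longrightarrow> T (sgen i) = s i"
  using T_sword[of "[i]"] by simp

lemma T_comp:
  assumes "g \<in> signed_perms n" "h \<in> signed_perms n"
  shows "T (h \<circ> g) = T g * T h"
proof -
  obtain u v where "u \<in> lists {..<n}" "sword u = g" "v \<in> lists {..<n}" "sword v = h"
    using assms signed_perm_word by metis
  then show ?thesis using T_sword[of u] T_sword[of v] T_sword[of "u @ v"] by simp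
qed

lemma T_inv: "g \<in> signed_perms n \<Longrightarrow> T g * T (inv g) = 1" "g \<in> signed_perms n \<Longrightarrow> T (inv g) * T g = 1"
  using T_comp[of g "inv g"] T_comp[of "inv g" g] by (simp_all add: signed_perms_inv
      signed_perms_inv_comp)

lemma T_commute:
  assumes "k \<le> n" "\<And>i. i < k \<Longrightarrow> m * s i = s i * m" "g \<in> signed_perms k"
  shows "m * T g = T g * m"
proof -
  obtain w where w: "w \<in> lists {..<k}" "sword w = g" using signed_perm_word[OF assms(3)] by blast
  have "m * ev w = ev w * m" using w(1)
    by (induction w) (auto simp: mult.assoc, metis assms(2) mult.assoc)
  moreover have "w \<in> lists {..<n}" using w(1) assms(1) by (auto simp: in_lists_conv_set)
  ultimately show ?thesis using T_sword w(2) by metis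
qed

end

section \<open>Invariant equivalence relations\<close>

text \<open>The least equivalence relation on the signed set that is invariant under \<open>x \<mapsto> - x\<close> and
  contains all pairs of points in \<open>P\<close>.\<close>

inductive_set inv_equiv :: "nat \<Rightarrow> (int \<times> int) set \<Rightarrow> (int \<times> int) set" for n P where
  base: "(x, y) \<in> P \<Longrightarrow> x \<in> signed_set n \<Longrightarrow> y \<in> signed_set n \<Longrightarrow> (x, y) \<in> inv_equiv n P"
| neg: "(x, y) \<in> inv_equiv n P \<Longrightarrow> (- x, - y) \<in> inv_equiv n P"
| refl: "x \<in> signed_set n \<Longrightarrow> (x, x) \<in> inv_equiv n P"
| sym: "(x, y) \<in> inv_equiv n P \<Longrightarrow> (y, x) \<in> inv_equiv n P"
| trans: "(x, y) \<in> inv_equiv n P \<Longrightarrow> (y, z) \<in> inv_equiv n P \<Longrightarrow> (x, z) \<in> inv_equiv n P"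

lemma inv_equiv_in: "(x, y) \<in> inv_equiv n P \<Longrightarrow> x \<in> signed_set n \<and> y \<in> signed_set n"
  by (induction rule: inv_equiv.induct) auto

lemma inv_equiv_least:
  assumes "\<And>x y. (x, y) \<in> P \<Longrightarrow> x \<in> signed_set n \<Longrightarrow> y \<in> signed_set n \<Longrightarrow> (x, y) \<in> inv_equiv n Q"
  shows "inv_equiv n P \<subseteq> inv_equiv n Q"
proof (rule subrelI)
  fix x y assume "(x, y) \<in> inv_equiv n P"
  then show "(x, y) \<in> inv_equiv n Q"
    by induction (use assms in \<open>blast intro: inv_equiv.neg inv_equiv.refl inv_equiv.sym
        inv_equiv.trans\<close>)+
qed

lemma inv_equiv_subsetI: "P \<subseteq> inv_equiv n Q \<Longrightarrow> inv_equiv n P \<subseteq> inv_equiv n Q"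
  by (rule inv_equiv_least) blast

lemma inv_equiv_mono: "P \<subseteq> Q \<Longrightarrow> inv_equiv n P \<subseteq> inv_equiv n Q"
  by (rule inv_equiv_least) (blast intro: inv_equiv.base)

lemma inv_equiv_empty: "inv_equiv n {} = Id_on (signed_set n)"
proof
  show "inv_equiv n {} \<subseteq> Id_on (signed_set n)"
  proof (rule subrelI)
    fix x y assume "(x, y) \<in> inv_equiv n {}"
    then show "(x, y) \<in> Id_on (signed_set n)" by induction auto
  qed
qed (auto intro: inv_equiv.refl)

lemma inv_equiv_image:
  assumes h: "h \<in> signed_perms n" and "(x, y) \<in> inv_equiv n P"
  shows "(h x, h y) \<in> inv_equiv n (map_prod h h ` P)"
  using assms(2)
proof induction
  case (base x y)
  then show ?case using signed_permsD(3)[OF h] by (intro inv_equiv.base) auto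
next
  case (neg x y)
  then show ?case using signed_permsD(2)[OF h] by (simp add: inv_equiv.neg)
next
  case (refl x)
  then show ?case using signed_permsD(3)[OF h] by (simp add: inv_equiv.refl)
qed (blast intro: inv_equiv.sym inv_equiv.trans)+

lemma inv_equiv_image_iff:
  assumes h: "h \<in> signed_perms n"
  shows "(x, y) \<in> inv_equiv n (map_prod h h ` P) \<longleftrightarrow> (inv h x, inv h y) \<in> inv_equiv n P"
proof
  assume "(x, y) \<in> inv_equiv n (map_prod h h ` P)"
  from inv_equiv_image[OF signed_perms_inv[OF h] this]
  show "(inv h x, inv h y) \<in> inv_equiv n P"
    by (simp add: image_image map_prod_def case_prod_unfold signed_permsD(7)[OF h])
next
  assume "(inv h x, inv h y) \<in> inv_equiv n P"
  from inv_equiv_image[OF h this] show "(x, y) \<in> inv_equiv n (map_prod h h ` P)"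
    by (simp add: signed_permsD(6)[OF h])
qed

text \<open>The ordered pairs that generate the same invariant equivalence relation as the pair \<open>p\<close> for
  trivial reasons.\<close>

definition same_pair :: "int \<times> int \<Rightarrow> int \<times> int \<Rightarrow> bool" where
  "same_pair p q \<longleftrightarrow> q \<in> {(fst p, snd p), (snd p, fst p), (- fst p, - snd p), (- snd p, - fst p)}"

lemma inv_equiv_same_pair:
  assumes "same_pair p q"
  shows "inv_equiv n {p} = inv_equiv n {q}"
proof -
  have sub: "inv_equiv n {p} \<subseteq> inv_equiv n {q}" if "same_pair p q" for p q
  proof (rule inv_equiv_least)
    fix x y assume "(x, y) \<in> {p}" and xy: "x \<in> signed_set n" "y \<in> signed_set n"
    then have p: "p = (x, y)" by simp
    have "q = (x, y) \<or> q = (y, x) \<or> q = (- x, - y) \<or> q = (- y, - x)"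
      using that by (simp add: p same_pair_def)
    then consider "q = (x, y)" | "q = (y, x)" | "q = (- x, - y)" | "q = (- y, - x)" by blast
    then show "(x, y) \<in> inv_equiv n {q}"
    proof cases
      case 1 then show ?thesis using xy by (auto intro: inv_equiv.base)
    next
      case 2 then show ?thesis using xy by (auto intro: inv_equiv.sym inv_equiv.base)
    next
      case 3 
      then have "(- x, - y) \<in> inv_equiv n {q}" using xy by (auto intro: inv_equiv.base)
      then show ?thesis using inv_equiv.neg by fastforce
    next
      case 4
      then have "(- y, - x) \<in> inv_equiv n {q}" using xy by (auto intro: inv_equiv.base)
      then show ?thesis using inv_equiv.neg inv_equiv.sym by fastforce
    qed
  qed
  have "same_pair q p" using assms unfolding same_pair_def by (cases p; cases q) auto
  then show ?thesis using sub assms by blast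
qed

text \<open>The cycle that takes \<open>1\<close> to \<open>k\<close>. It conjugates the stabilizer of \<open>1\<close> to the stabilizer of
  the largest point, for which generators are known.\<close>

lemma sword_up_cycle:
  assumes "1 \<le> x" "x \<le> int k" "1 \<le> k"
  shows "sword [1..<k] x = (if x = 1 then int k else x - 1)"
  using assms(3,1,2)
proof (induction k rule: dec_induct)
  case base
  then show ?case by simp
next
  case (step k)
  show ?case
  proof (cases "x = int k + 1")
    case True
    then have "sword [1..<k] x = x" using step by (intro sword_fix[of _ k]) auto
    then show ?thesis using True step by (auto simp: sgen_def sreflect_def lo_def)
  next
    case False
    then show ?thesis using step by (auto simp: sgen_def sreflect_def lo_def)
  qed
qed

section \<open>Models of the relations\<close>

text \<open>The letters of index \<open>1\<close> occur in the relations, so the numeral must survive simplification.\<close>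

declare One_nat_def [simp del]

locale FB_model =
  fixes n :: nat and f :: "letter \<Rightarrow> 'm::monoid_mult"
  assumes rel: "(u, v) \<in> FB_rels n \<Longrightarrow> prod_list (map f u) = prod_list (map f v)"
begin

abbreviation s :: "nat \<Rightarrow> 'm" where "s i \<equiv> f (S i)"
abbreviation xi :: "nat \<Rightarrow> 'm" where "xi i \<equiv> f (Xi i)"

lemma rel_xi_shift: "1 \<le> i \<Longrightarrow> Suc i < n \<Longrightarrow> xi i * s (Suc i) * s i = s (Suc i) * s i * xi (Suc i)"
  using rel[of "[Xi i, S (Suc i), S i]" "[S (Suc i), S i, Xi (Suc i)]"]
  by (simp add: FB_rels_def rels2_def mult.assoc)

lemma rel_xi0_s1: "1 < n \<Longrightarrow> xi 0 * (s 1 * s 0 * s 1) = s 1 * s 0 * s 1 * xi 0"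
  using rel[of "[Xi 0, S 1, S 0, S 1]" "[S 1, S 0, S 1, Xi 0]"]
  by (simp add: FB_rels_def rels3_def mult.assoc)

lemma rel_xi1_s0: "1 < n \<Longrightarrow> xi 1 * (s 0 * s 1 * s 0) = s 0 * s 1 * s 0 * xi 1"
  using rel[of "[Xi 1, S 0, S 1, S 0]" "[S 0, S 1, S 0, Xi 1]"]
  by (simp add: FB_rels_def rels3_def mult.assoc)

lemma rel_xi_s_far: "i < n \<Longrightarrow> j < n \<Longrightarrow> Suc i < j \<or> Suc j < i \<Longrightarrow> xi i * s j = s j * xi i"
  using rel[of "[Xi i, S j]" "[S j, Xi i]"]
  by (fastforce simp: FB_rels_def rels3_def)

lemma rel_xi_xi_far: "i < n \<Longrightarrow> j < n \<Longrightarrow> Suc i < j \<Longrightarrow> xi i * xi j = xi j * xi i"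
  using rel[of "[Xi i, Xi j]" "[Xi j, Xi i]"]
  by (fastforce simp: FB_rels_def rels4_def)

lemma rel_xi_xi_next: "Suc i < n \<Longrightarrow> xi i * xi (Suc i) = xi (Suc i) * xi i"
  using rel[of "[Xi i, Xi (Suc i)]" "[Xi (Suc i), Xi i]"]
  by (simp add: FB_rels_def rels6_def)

lemma rel_xi_s: "i < n \<Longrightarrow> xi i * s i = xi i" "i < n \<Longrightarrow> s i * xi i = xi i"
  using rel[of "[Xi i, S i]" "[Xi i]"] rel[of "[Xi i, S i]" "[S i, Xi i]"]
  by (simp_all add: FB_rels_def rels5_def rels6_def)

lemma rel_xi_idem: "i < n \<Longrightarrow> xi i * xi i = xi i"
  using rel[of "[Xi i, Xi i]" "[Xi i]"] by (simp add: FB_rels_def rels6_def)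

lemma rel_xi0_xi0: "1 < n \<Longrightarrow> (s 1 * xi 0 * s 1) * xi 0 = xi 0 * (s 1 * xi 0 * s 1)"
  using rel[of "[S 1, Xi 0, S 1, Xi 0]" "[Xi 0, S 1, Xi 0, S 1]"]
  by (simp add: FB_rels_def rels7_def mult.assoc)

lemma rel_xi1_xi1: "1 < n \<Longrightarrow> (s 0 * xi 1 * s 0) * xi 1 = xi 1 * (s 0 * xi 1 * s 0)"
  using rel[of "[S 0, Xi 1, S 0, Xi 1]" "[Xi 1, S 0, Xi 1, S 0]"]
  by (simp add: FB_rels_def rels8_def mult.assoc)

lemma rel_xi0_xi1: "1 < n \<Longrightarrow> xi 0 * xi 1 = (s 0 * xi 1 * s 0) * xi 1"
  using rel[of "[Xi 0, Xi 1]" "[S 0, Xi 1, S 0, Xi 1]"]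
  by (simp add: FB_rels_def rels9_def mult.assoc)

sublocale coxeter_B n s
proof
  fix i assume "i < n"
  then show "s i * s i = 1"
    using rel[of "[S i, S i]" "[]"] by (simp add: FB_rels_def rels6_def)
next
  fix i assume "1 \<le> i" "Suc i < n"
  then show "s i * s (Suc i) * s i = s (Suc i) * s i * s (Suc i)"
    using rel[of "[S i, S (Suc i), S i]" "[S (Suc i), S i, S (Suc i)]"]
    by (simp add: FB_rels_def rels1_def mult.assoc)
next
  assume "1 < n"
  then show "s 0 * s 1 * s 0 * s 1 = s 1 * s 0 * s 1 * s 0"
    using rel[of "[S 0, S 1, S 0, S 1]" "[S 1, S 0, S 1, S 0]"]
    by (simp add: FB_rels_def rels1_def mult.assoc)
next
  fix i j assume "Suc i < j" "j < n"
  then show "s i * s j = s j * s i"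
    using rel[of "[S i, S j]" "[S j, S i]"]
    by (fastforce simp: FB_rels_def rels1_def)
qed

subsection \<open>Conjugation by signed permutations\<close>

abbreviation SP :: "(int \<Rightarrow> int) set" where "SP \<equiv> signed_perms n"

lemma T_cancel [simp]:
  assumes "g \<in> SP"
  shows "T g * (T (inv g) * m) = m" "T (inv g) * (T g * m) = m"
  using T_inv[OF assms] by (simp_all flip: mult.assoc)

lemma T_right_cancel:
  assumes "g \<in> SP" "x * T g = y * T g" shows "x = y"
proof -
  have "x * T g * T (inv g) = y * T g * T (inv g)" using assms(2) by simp
  then show ?thesis by (simp add: mult.assoc T_inv assms(1))
qed

lemma commute_comp:
  assumes "g \<in> SP" "h \<in> SP" "m * T h = T h * m" "m * T (h \<circ> g) = T (h \<circ> g) * m"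
  shows "m * T g = T g * m"
proof -
  have "m * T g * T h = T g * m * T h" using assms by (simp add: T_comp mult.assoc)
  then show ?thesis by (rule T_right_cancel[OF assms(2)])
qed

lemma commute_conj:
  assumes "c \<in> SP" "g \<in> SP" "h \<in> SP" "g \<circ> c = c \<circ> h" "m * T h = T h * m"
  shows "(T (inv c) * m * T c) * T g = T g * (T (inv c) * m * T c)"
proof -
  have cg: "T c * T g = T h * T c" using T_comp[of c g] T_comp[of h c] assms by simp
  have gc: "T (inv c) * T h = T g * T (inv c)"
  proof (rule T_right_cancel[OF assms(1)])
    show "T (inv c) * T h * T c = T g * T (inv c) * T c"
      using assms(1) by (simp add: mult.assoc T_inv flip: cg)
  qed
  have "(T (inv c) * m * T c) * T g = T (inv c) * (m * T h) * T c" by (simp add: mult.assoc cg)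
  also have "\<dots> = (T (inv c) * T h) * m * T c" by (simp only: assms(5) mult.assoc)
  also have "\<dots> = T g * (T (inv c) * m * T c)" by (simp only: gc mult.assoc)
  finally show ?thesis .
qed

lemma commute_conj':
  assumes "c \<in> SP" "g \<in> SP" "h \<in> SP" "g \<circ> c = c \<circ> h"
    and "(T (inv c) * m * T c) * T g = T g * (T (inv c) * m * T c)"
  shows "m * T h = T h * m"
proof -
  have "h \<circ> inv c = inv c \<circ> (g \<circ> c) \<circ> inv c"
    using signed_perms_inv_comp[OF assms(1)] assms(4) by (metis comp_assoc comp_id id_comp)
  also have "\<dots> = inv c \<circ> g"
    using signed_perms_inv_comp[OF assms(1)] by (metis comp_assoc comp_id)
  finally have "h \<circ> inv c = inv c \<circ> g" .
  from commute_conj[OF signed_perms_inv[OF assms(1)] assms(3,2) this assms(5)]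
  show ?thesis using assms(1) signed_permsD(1)[OF assms(1)]
    by (simp add: mult.assoc T_inv inv_inv_eq permutes_bij)
qed

subsection \<open>Stabilizers of the generating idempotents\<close>

text \<open>A signed permutation fixing \<open>1\<close> is conjugate, by the cycle \<open>c\<close>, to one that fixes \<open>n\<close> and
  therefore is a word in all but the last generator. Conjugating these generators back gives
  \<open>s 1 * s 0 * s 1\<close> and the \<open>s j\<close> with \<open>j \<ge> 2\<close>, all of which commute with \<open>xi 0\<close> by assumption.
  The remaining factor is the change of sign \<open>s 0\<close>.\<close>

lemma xi0_commute:
  assumes g: "g \<in> SP" and "\<bar>g 1\<bar> = 1" and n: "1 \<le> n"
  shows "xi 0 * T g = T g * xi 0"
proof -
  have fixing: "xi 0 * T g = T g * xi 0" if g: "g \<in> SP" "g 1 = 1" for g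
  proof -
    define c where "c = sword [1..<n]"
    have c: "c \<in> SP" unfolding c_def by (rule sword_signed_perms) auto
    have cx: "c x = (if x = 1 then int n else x - 1)" if "1 \<le> x" "x \<le> int n" for x
      unfolding c_def using sword_up_cycle that n by simp
    let ?a = "T (inv c) * xi 0 * T c"
    have "?a * s j = s j * ?a" if j: "j < n - 1" for j
    proof (cases "j = 0")
      case True
      have r: "sword [1, 0, 1] = sreflect (- 2) 2"
        using sgen_conj[of 1 0] by (simp add: comp_assoc) (simp add: sgen_def sreflect_def lo_def)
      have r': "T (sreflect (- 2) 2) = s 1 * s 0 * s 1"
        unfolding r[symmetric] using j by (subst T_sword) (auto simp: mult.assoc)
      have "c \<circ> sreflect (- 2) 2 = sgen j \<circ> c"
        unfolding sreflect_conj[OF c] using True j signed_permsD(2)[OF c, of 2] cx[of 2]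
        by (simp add: sgen_def lo_def)
      then have "?a * T (sgen j) = T (sgen j) * ?a"
        using j rel_xi0_s1 r'
        by (intro commute_conj[where h = "sreflect (- 2) 2"] c sgen_signed_perms
            sreflect_signed_perms)
           (auto simp: signed_set_def)
      then show ?thesis using j T_sgen by simp
    next
      case False
      have "c \<circ> sgen (Suc j) = sgen j \<circ> c"
        unfolding perm_sgen[OF c] using False j cx[of "lo (Suc j)"] cx[of "hi (Suc j)"]
        by (simp add: sgen_def lo_def add.commute)
      moreover have "xi 0 * T (sgen (Suc j)) = T (sgen (Suc j)) * xi 0"
        using j False rel_xi_s_far[of 0 "Suc j"] by (subst (1 2) T_sgen) auto
      ultimately have "?a * T (sgen j) = T (sgen j) * ?a"
        using j by (intro commute_conj[where h = "sgen (Suc j)"] c sgen_signed_perms) auto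
      then show ?thesis using j T_sgen by simp
    qed
    note comm = this
    let ?g = "c \<circ> g \<circ> inv c"
    have g': "?g \<in> SP" using c g by (intro signed_perms_comp signed_perms_inv)
    obtain k where k: "n = Suc k" using n by (cases n) auto
    have "inv c (int n) = 1" using cx[of 1] n signed_permsD(7)[OF c, of 1] by simp
    then have "?g (int n) = int n" using g(2) cx[of 1] n by simp
    then have "?g \<in> signed_perms (n - 1)" using g' signed_perms_Suc unfolding k by simp
    then have "?a * T ?g = T ?g * ?a" using comm by (intro T_commute[of "n - 1"]) auto
    moreover have "?g \<circ> c = c \<circ> g" using signed_perms_inv_comp(1)[OF c] by (simp add: comp_assoc)
    ultimately show ?thesis using c g g' by (blast intro: commute_conj'[of c ?g g])
  qed
  show ?thesis
  proof (cases "g 1 = 1")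
    case True then show ?thesis using fixing g by simp
  next
    case False
    then have "g 1 = - 1" using assms(2) by linarith
    then have "xi 0 * T (sgen 0 \<circ> g) = T (sgen 0 \<circ> g) * xi 0"
      using n g by (intro fixing signed_perms_comp sgen_signed_perms) (auto simp: sgen_def
          sreflect_def lo_def)
    then show ?thesis
      using n g rel_xi_s[of 0] T_sgen[of 0] sgen_signed_perms[of 0 n] by (intro commute_comp[of g
          "sgen 0"]) auto
  qed
qed

text \<open>Conjugation by \<open>s (Suc i) * s i\<close> takes \<open>xi i\<close> to \<open>xi (Suc i)\<close>, so all \<open>xi i\<close> with positive
  \<open>i\<close> are conjugates of \<open>xi 1\<close>.\<close>

lemma xi_shift:
  assumes "1 \<le> i" "i < n"
  shows "\<exists>p\<in>SP. p 1 = int i \<and> p 2 = int i + 1 \<and> xi 1 * T p = T p * xi i"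
  using assms
proof (induction i rule: dec_induct)
  case base
  show ?case by (intro bexI[of _ id] conjI signed_perms_id) (simp_all only: T_id, simp_all)
next
  case (step i)
  then obtain p where p: "p \<in> SP" "p 1 = int i" "p 2 = int i + 1" "xi 1 * T p = T p * xi i" by auto
  let ?q = "sgen i \<circ> (sgen (Suc i) \<circ> p)"
  have q: "?q \<in> SP" using step p by (intro signed_perms_comp sgen_signed_perms) auto
  have i: "i < n" "Suc i < n" using step by auto
  have "T ?q = T p * T (sgen (Suc i)) * T (sgen i)"
    by (simp only: T_comp signed_perms_comp sgen_signed_perms i p)
  also have "\<dots> = T p * (s (Suc i) * s i)" by (simp only: T_sgen i mult.assoc)
  finally have Tq: "T ?q = T p * (s (Suc i) * s i)" .
  from Tq have "xi 1 * T ?q = T p * (xi i * s (Suc i) * s i)" by (simp add: p(4) flip: mult.assoc)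
  also have "\<dots> = T ?q * xi (Suc i)"
    using rel_xi_shift[of i] step Tq by (simp add: mult.assoc)
  finally have "xi 1 * T ?q = T ?q * xi (Suc i)" .
  moreover have "?q 1 = int (Suc i)" "?q 2 = int (Suc i) + 1"
    using p step by (auto simp: sgen_def sreflect_def lo_def)
  ultimately show ?case using q by blast
qed

text \<open>The stabilizer of the pair \<open>n - 1\<close>, \<open>n\<close> is generated by the signed permutations of the
  smaller points, the exchange of the two points and their simultaneous change of sign
  \<open>r (n - 1)\<close>. The last one is conjugate to the corresponding change of sign
  \<open>s 0 * s 1 * s 0 * s 1\<close> of \<open>1\<close> and \<open>2\<close>.\<close>

lemma xi_top_commute:
  assumes g: "g \<in> SP" and n: "2 \<le> n" and k: "n = Suc (Suc k)"
    and gp: "same_pair (int n - 1, int n) (g (int n - 1), g (int n))"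
  shows "xi (n - 1) * T g = T g * xi (n - 1)"
proof -
  let ?N = "int n" and ?M = "int n - 1"
  have fixing: "xi (n - 1) * T g = T g * xi (n - 1)"
    if g: "g \<in> SP" "g ?N = ?N" "g ?M = ?M" for g
  proof (rule T_commute)
    have "g \<in> signed_perms (Suc k)" using g k by (auto intro!: signed_perms_Suc[of g "Suc k"])
    then show "g \<in> signed_perms k" using g k by (auto intro!: signed_perms_Suc[of g k])
    show "xi (n - 1) * s i = s i * xi (n - 1)" if "i < k" for i
      using that k by (intro rel_xi_s_far) auto
  qed (use k in simp)
  have swp: "xi (n - 1) * T (sgen (n - 1)) = T (sgen (n - 1)) * xi (n - 1)"
    using n by (simp add: T_sgen rel_xi_s)
  have sw: "sgen (n - 1) \<in> SP" "sgen (n - 1) ?N = ?M" "sgen (n - 1) ?M = ?N"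
    "sgen (n - 1) (- ?N) = - ?M" "sgen (n - 1) (- ?M) = - ?N"
    using n sgen_signed_perms[of "n - 1" n] by (auto simp: sgen_def sreflect_def lo_def of_nat_diff)
  \<comment> \<open>the simultaneous change of sign of \<open>i\<close> and \<open>i + 1\<close>\<close>
  define r where "r i x = (if \<bar>x\<bar> = int i \<or> \<bar>x\<bar> = int i + 1 then - x else x)" for i x
  have r: "r i \<in> SP" if "1 \<le> i" "i < n" for i
    using that by (intro signed_permsI_involution) (auto simp: r_def signed_set_def)
  have n1: "1 \<le> n - 1" "n - 1 < n" using n by auto
  obtain p where p: "p \<in> SP" "p 1 = int (n - 1)" "p 2 = int (n - 1) + 1"
    and xp: "xi 1 * T p = T p * xi (n - 1)" using xi_shift[OF n1] by blast
  have "sword [0, 1, 0, 1] x = r 1 x" for x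
  proof -
    consider "x = 1" | "x = - 1" | "x = 2" | "x = - 2" | "x \<notin> {1, - 1, 2, - 2}" by blast
    then show ?thesis by cases (simp_all add: sgen_def sreflect_def lo_def r_def, arith)
  qed
  then have "sword [0, 1, 0, 1] = r 1" by (rule ext)
  moreover have "T (sword [0, 1, 0, 1]) = s 0 * s 1 * s 0 * s 1"
    using n by (subst T_sword) (auto simp: mult.assoc)
  ultimately have Tr: "T (r 1) = s 0 * s 1 * s 0 * s 1" by simp
  have xr1: "xi 1 * T (r 1) = T (r 1) * xi 1"
  proof -
    have "xi 1 * T (r 1) = (xi 1 * (s 0 * s 1 * s 0)) * s 1" unfolding Tr by (simp only: mult.assoc)
    also have "\<dots> = s 0 * s 1 * s 0 * (xi 1 * s 1)" using rel_xi1_s0 n by (simp add: mult.assoc)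
    also have "\<dots> = T (r 1) * xi 1" using rel_xi_s[of 1] n unfolding Tr by (simp add: mult.assoc)
    finally show ?thesis .
  qed
  have "r (n - 1) \<circ> p = p \<circ> r 1"
  proof
    fix x
    have 1: "p x = int (n - 1) \<longleftrightarrow> x = 1" "p x = int (n - 1) + 1 \<longleftrightarrow> x = 2"
      using p(2,3) signed_permsD(5)[OF p(1), of x 1] signed_permsD(5)[OF p(1), of x 2] by simp_all
    have 2: "p x = - int (n - 1) \<longleftrightarrow> x = - 1" "p x = - (int (n - 1) + 1) \<longleftrightarrow> x = - 2"
      using p(2,3) signed_permsD(5)[OF p(1), of x "- 1"] signed_permsD(5)[OF p(1), of x "- 2"]
        signed_permsD(2)[OF p(1), of 1] signed_permsD(2)[OF p(1), of 2] by simp_all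
    have "(\<bar>p x\<bar> = int (n - 1) \<or> \<bar>p x\<bar> = int (n - 1) + 1) \<longleftrightarrow> (\<bar>x\<bar> = 1 \<or> \<bar>x\<bar> = 2)"
      unfolding abs_eq_iff' 1 2 by auto
    then show "(r (n - 1) \<circ> p) x = (p \<circ> r 1) x" by (auto simp: r_def signed_permsD(2)[OF p(1)])
  qed
  moreover have "T (inv p) * xi 1 * T p = xi (n - 1)"
    using p by (simp add: xp mult.assoc)
  ultimately have xr: "xi (n - 1) * T (r (n - 1)) = T (r (n - 1)) * xi (n - 1)"
    using commute_conj[OF p(1) r[of "n - 1"] r[of 1] _ xr1] n by simp
  have rN: "r (n - 1) \<in> SP" "r (n - 1) (- ?N) = ?N" "r (n - 1) (- ?M) = ?M"
    using n r[of "n - 1"] by (auto simp: r_def of_nat_diff)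
  from gp consider "g ?M = ?M" "g ?N = ?N" | "g ?M = ?N" "g ?N = ?M"
    | "g ?M = - ?M" "g ?N = - ?N" | "g ?M = - ?N" "g ?N = - ?M"
    by (fastforce simp: same_pair_def)
  then show ?thesis
  proof cases
    case 1 then show ?thesis using fixing g by simp
  next
    case 2 then show ?thesis
      using g sw by (intro commute_comp[OF g sw(1) swp] fixing signed_perms_comp) auto
  next
    case 3 then show ?thesis
      using g rN by (intro commute_comp[OF g rN(1) xr] fixing signed_perms_comp) auto
  next
    case 4
    have "xi (n - 1) * T (r (n - 1) \<circ> g) = T (r (n - 1) \<circ> g) * xi (n - 1)"
      using g sw rN 4
      by (intro commute_comp[OF signed_perms_comp[OF g rN(1)] sw(1) swp] fixing signed_perms_comp)
         (auto simp: signed_permsD(2)[OF rN(1)])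
    then show ?thesis by (rule commute_comp[OF g rN(1) xr])
  qed
qed

text \<open>If \<open>i\<close> and \<open>j\<close> are positive, both pairs are moved to the pair \<open>n - 1\<close>, \<open>n\<close>, where \<open>g\<close>
  becomes an element of the stabilizer. This lemma makes the conjugates of the \<open>xi i\<close> independent
  of the conjugating element.\<close>

lemma xi_transport:
  assumes i: "i < n" and j: "j < n" and g: "g \<in> SP"
    and gp: "same_pair (lo j, hi j) (g (lo i), g (hi i))"
  shows "xi i * T g = T g * xi j"
proof (cases "i = 0")
  case True
  have "g (- 1) = - g 1" by (rule signed_permsD(2)[OF g])
  then have "j = 0" "\<bar>g 1\<bar> = 1" using gp True
    by (auto simp: same_pair_def lo_def split: if_splits)
  then show ?thesis using xi0_commute[OF g] True i by simp
next
  case False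
  then have i1: "1 \<le> i" by simp
  have neg: "g (- int i) = - g (int i)" by (rule signed_permsD(2)[OF g])
  have j1: "1 \<le> j"
  proof (rule ccontr)
    assume "\<not> 1 \<le> j"
    then have "g (hi i) = - g (lo i)" using gp by (auto simp: same_pair_def lo_def)
    also have "\<dots> = g (- lo i)" by (simp add: signed_permsD(2)[OF g])
    finally have "hi i = - lo i" using signed_permsD(5)[OF g] by metis
    then show False using i1 by (simp add: lo_def)
  qed
  obtain k where k: "n = Suc (Suc k)" using i1 i by (metis Suc_le_D less_imp_Suc_add One_nat_def
      add_Suc)
  obtain p where p: "p \<in> SP" "p 1 = int i" "p 2 = int i + 1" "xi 1 * T p = T p * xi i"
    using xi_shift i1 i by blast
  obtain q where q: "q \<in> SP" "q 1 = int j" "q 2 = int j + 1" "xi 1 * T q = T q * xi j"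
    using xi_shift j1 j by blast
  obtain t where t: "t \<in> SP" "t 1 = int (n - 1)" "t 2 = int (n - 1) + 1"
    "xi 1 * T t = T t * xi (n - 1)" using xi_shift[of "n - 1"] k by auto
  let ?h = "inv q \<circ> g \<circ> p"
  let ?h' = "t \<circ> ?h \<circ> inv t"
  have h: "?h \<in> SP" and h': "?h' \<in> SP"
    using p q t g by (auto intro!: signed_perms_comp signed_perms_inv)
  have it: "inv t (int (n - 1)) = 1" "inv t (int (n - 1) + 1) = 2"
    using signed_permsD(7)[OF t(1)] t(2,3) by metis+
  have iq: "inv q (int j) = 1" "inv q (int j + 1) = 2"
    using signed_permsD(7)[OF q(1)] q(2,3) by metis+
  have iq': "inv q (- int j) = - 1" "inv q (- int j - 1) = - 2"
    using signed_permsD(2)[OF signed_perms_inv[OF q(1)], of "int j"]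
      signed_permsD(2)[OF signed_perms_inv[OF q(1)], of "int j + 1"] iq by simp_all
  have "same_pair (int n - 1, int n) (?h' (int n - 1), ?h' (int n))"
    using gp i1 j1 it iq iq' p(2,3) t(2,3) k signed_permsD(2)[OF t(1)]
    by (auto simp: same_pair_def lo_def of_nat_diff)
  then have "xi (n - 1) * T ?h' = T ?h' * xi (n - 1)"
    using xi_top_commute[OF h'] k by simp
  moreover have "T (inv t) * xi 1 * T t = xi (n - 1)" using t by (simp add: mult.assoc)
  moreover have "?h' \<circ> t = t \<circ> ?h" using signed_perms_inv_comp(1)[OF t(1)] by (simp add: comp_assoc)
  ultimately have xh: "xi 1 * T ?h = T ?h * xi 1"
    using commute_conj'[OF t(1) h' h] by simp
  have "q \<circ> ?h = g \<circ> p" using signed_perms_inv_comp(2)[OF q(1)] by (simp flip: comp_assoc)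
  then have hq: "T ?h * T q = T p * T g" using T_comp[OF h q(1)] T_comp[OF p(1) g] by simp
  have "T p * (xi i * T g) = xi 1 * (T p * T g)" by (simp only: p(4) mult.assoc[symmetric])
  also have "\<dots> = (xi 1 * T ?h) * T q" by (simp only: hq mult.assoc)
  also have "\<dots> = T ?h * (T q * xi j)" by (simp only: xh q(4) mult.assoc)
  also have "\<dots> = (T p * T g) * xi j" by (simp only: hq mult.assoc[symmetric])
  also have "\<dots> = T p * (T g * xi j)" by (simp only: mult.assoc)
  finally have "T (inv p) * (T p * (xi i * T g)) = T (inv p) * (T p * (T g * xi j))" by simp
  then show ?thesis using p(1) by simp
qed

subsection \<open>Conjugates of the generating idempotents\<close>

text \<open>The idempotent of the invariant equivalence relation joining \<open>x\<close> and \<open>y\<close>, as a conjugate of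
  a generator. With the value \<open>1\<close> for \<open>x = y\<close>, transitivity holds for all triples of points.\<close>

definition atom :: "int \<Rightarrow> int \<Rightarrow> 'm" where
  "atom x y = (if x = y then 1 else
     SOME m. \<exists>i<n. \<exists>g\<in>SP. g (lo i) = x \<and> g (hi i) = y \<and> m = T (inv g) * xi i * T g)"

lemma atom_eq:
  assumes i: "i < n" and g: "g \<in> SP" and x: "g (lo i) = x" and y: "g (hi i) = y"
  shows "atom x y = T (inv g) * xi i * T g"
proof -
  have "lo i \<noteq> hi i" by (simp add: lo_def)
  then have xy: "x \<noteq> y" using x y signed_permsD(5)[OF g] by auto
  have uniq: "T (inv h) * xi j * T h = T (inv g) * xi i * T g"
    if j: "j < n" and h: "h \<in> SP" "h (lo j) = x" "h (hi j) = y" for j h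
  proof -
    let ?k = "inv h \<circ> g"
    have k: "?k \<in> SP" using g h by (intro signed_perms_comp signed_perms_inv)
    have kl: "?k (lo i) = lo j" "?k (hi i) = hi j"
      using signed_permsD(7)[OF h(1), of "lo j"] signed_permsD(7)[OF h(1), of "hi j"] x y h(2,3)
      by simp_all
    have "xi i * T ?k = T ?k * xi j"
      using kl by (intro xi_transport[OF i j k]) (simp add: same_pair_def)
    then have *: "xi i * (T g * T (inv h)) = T g * T (inv h) * xi j"
      using g h by (simp add: T_comp signed_perms_inv)
    have "T (inv g) * xi i * T g = T (inv g) * (xi i * (T g * T (inv h))) * T h"
      using h by (simp add: mult.assoc T_inv)
    also have "\<dots> = T (inv h) * xi j * T h" unfolding * using g by (simp add: mult.assoc)
    finally show ?thesis by simp
  qed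
  have "(SOME m. \<exists>j<n. \<exists>h\<in>SP. h (lo j) = x \<and> h (hi j) = y \<and> m = T (inv h) * xi j * T h) =
      T (inv g) * xi i * T g"
    by (rule some_equality) (use assms uniq in blast)+
  then show ?thesis unfolding atom_def using xy by simp
qed

lemma atom_same [simp]: "atom x x = 1"
  by (simp add: atom_def)

lemma atom_xi: "i < n \<Longrightarrow> atom (lo i) (hi i) = xi i"
  using atom_eq[of i id "lo i" "hi i"] by simp

lemma atom_obtain:
  assumes "x \<in> signed_set n" "y \<in> signed_set n" "x \<noteq> y"
  obtains i g where "i < n" "g \<in> SP" "g (lo i) = x" "g (hi i) = y"
      "atom x y = T (inv g) * xi i * T g"
  using perm_pair[OF assms] atom_eq by blast

lemma atom_conj:
  assumes g: "g \<in> SP" and "x \<in> signed_set n" "y \<in> signed_set n"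
  shows "atom x y * T g = T g * atom (g x) (g y)"
proof (cases "x = y")
  case False
  obtain i h where h: "i < n" "h \<in> SP" "h (lo i) = x" "h (hi i) = y"
    "atom x y = T (inv h) * xi i * T h" by (rule atom_obtain[OF assms(2,3) False])
  have "atom (g x) (g y) = T (inv (g \<circ> h)) * xi i * T (g \<circ> h)"
    using h g by (intro atom_eq signed_perms_comp) auto
  also have "inv (g \<circ> h) = inv h \<circ> inv g"
    by (rule signed_perms_inv_distrib[OF h(2) g])
  also have "T (inv h \<circ> inv g) = T (inv g) * T (inv h)"
    using h g by (intro T_comp signed_perms_inv)
  also have "T (g \<circ> h) = T h * T g" using h g by (intro T_comp)
  finally have "atom (g x) (g y) = T (inv g) * T (inv h) * xi i * (T h * T g)" .
  then show ?thesis using g h by (simp add: mult.assoc)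
qed simp

lemma atom_conj':
  assumes "g \<in> SP" "x \<in> signed_set n" "y \<in> signed_set n"
  shows "atom (g x) (g y) = T (inv g) * atom x y * T g"
  using atom_conj[OF assms] assms(1) by (simp add: mult.assoc)

lemma atom_sym: 
  assumes "x \<in> signed_set n" "y \<in> signed_set n"
  shows "atom x y = atom y x"
proof (cases "x = y")
  case False
  obtain i g where g: "i < n" "g \<in> SP" "g (lo i) = x" "g (hi i) = y"
    "atom x y = T (inv g) * xi i * T g" by (rule atom_obtain[OF assms False])
  have "atom y x = T (inv (g \<circ> sgen i)) * xi i * T (g \<circ> sgen i)"
    using g by (intro atom_eq signed_perms_comp sgen_signed_perms) (auto simp: sgen_def
        sreflect_def)
  also have "inv (g \<circ> sgen i) = sgen i \<circ> inv g"
    using signed_perms_inv_distrib[OF sgen_signed_perms g(2)] g(1) by (simp add: inv_sgen)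
  also have "T (sgen i \<circ> inv g) = T (inv g) * s i"
    using g by (subst T_comp) (simp_all add: signed_perms_inv sgen_signed_perms T_sgen)
  also have "T (g \<circ> sgen i) = s i * T g"
    using g by (subst T_comp) (simp_all add: sgen_signed_perms T_sgen)
  finally have "atom y x = T (inv g) * (s i * xi i * s i) * T g" by (simp only: mult.assoc)
  also have "s i * xi i * s i = xi i" using g rel_xi_s by simp
  finally show ?thesis using g by simp
qed simp

lemma atom_neg:
  assumes "x \<in> signed_set n" "y \<in> signed_set n"
  shows "atom (- x) (- y) = atom x y"
proof (cases "x = y")
  case False
  obtain i g where g: "i < n" "g \<in> SP" "g (lo i) = x" "g (hi i) = y"
    "atom x y = T (inv g) * xi i * T g" by (rule atom_obtain[OF assms False])
  define t where "t x = (if x \<in> signed_set n then - x else x)" for x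
  have t: "t \<in> SP" by (intro signed_permsI_involution) (auto simp: t_def)
  have tg: "inv g \<circ> t \<circ> g \<in> SP" using g t by (intro signed_perms_comp signed_perms_inv)
  have "atom (- x) (- y) = T (inv t) * atom x y * T t"
    using atom_conj'[OF t assms] assms by (simp add: t_def)
  have *: "inv g (- g x) = - x" for x
    using signed_permsD(2,7)[OF g(2)] by metis
  have "xi i * T (inv g \<circ> t \<circ> g) = T (inv g \<circ> t \<circ> g) * xi i"
    using assms by (intro xi_transport[OF g(1) g(1) tg]) (simp add: same_pair_def t_def g(3,4)
        *[of "lo i", unfolded g] *[of "hi i", unfolded g])
  then have **: "xi i * (T g * T t * T (inv g)) = T g * T t * T (inv g) * xi i"
    using g t by (simp add: T_comp signed_perms_inv signed_perms_comp mult.assoc)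
  have "atom x y * T t = T (inv g) * (xi i * (T g * T t * T (inv g))) * T g"
    using g by (simp add: mult.assoc T_inv)
  also have "\<dots> = T t * atom x y" unfolding ** using g by (simp add: mult.assoc)
  finally have "T (inv t) * (atom x y * T t) = T (inv t) * (T t * atom x y)" by simp
  then show ?thesis using t atom_conj'[OF t assms] assms by (simp add: t_def mult.assoc)
qed simp

lemma atom_idem:
  assumes "x \<in> signed_set n" "y \<in> signed_set n"
  shows "atom x y * atom x y = atom x y"
proof (cases "x = y")
  case False
  obtain i g where g: "i < n" "g \<in> SP" "g (lo i) = x" "g (hi i) = y"
    "atom x y = T (inv g) * xi i * T g" by (rule atom_obtain[OF assms False])
  have "atom x y * atom x y = T (inv g) * (xi i * xi i) * T g" using g by (simp add: mult.assoc)
  then show ?thesis using g rel_xi_idem by simp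
qed simp

lemma atom_absorb:
  assumes "x \<in> signed_set n" "y \<in> signed_set n"
  shows "atom x y * T (sreflect x y) = atom x y"
proof (cases "x = y")
  case True
  then have "sreflect x y = id" by (auto simp: sreflect_def)
  then show ?thesis by (simp add: True)
next
  case False
  obtain i g where g: "i < n" "g \<in> SP" "g (lo i) = x" "g (hi i) = y"
    "atom x y = T (inv g) * xi i * T g" by (rule atom_obtain[OF assms False])
  have "sreflect x y \<circ> g = g \<circ> sgen i" using perm_sgen[OF g(2)] g by simp
  then have "T g * T (sreflect x y) = s i * T g"
    using g assms T_comp[of g "sreflect x y"] T_comp[of "sgen i" g]
    by (simp add: sreflect_signed_perms sgen_signed_perms T_sgen)
  then have "atom x y * T (sreflect x y) = T (inv g) * (xi i * s i) * T g"
    using g by (simp add: mult.assoc)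
  then show ?thesis using g rel_xi_s by simp
qed

subsection \<open>Relations between the atoms\<close>

text \<open>Signed permutations act transitively on tuples of points with distinct absolute values.
  Together with \<open>transport_product_eq\<close> this reduces identities between products of two atoms to
  the case of small points.\<close>

lemma standard_position2:
  assumes "x \<in> signed_set n" "y \<in> signed_set n" "\<bar>x\<bar> \<noteq> \<bar>y\<bar>"
  obtains g where "g \<in> SP" "g 1 = x" "g 2 = y"
    "g (- 1) = - x" "g (- 2) = - y" "2 \<le> n"
proof -
  have xs: "set [x, y] \<subseteq> signed_set n" "distinct (map abs [x, y])" using assms by auto
  obtain g where g: "g \<in> SP" "\<forall>k<length [x, y]. g (int k + 1) = [x, y] ! k"
    using signed_perm_extend[OF xs] by blast
  have v: "g 1 = x" "g 2 = y"
    using g(2)[rule_format, of 0] g(2)[rule_format, of 1] by simp_all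
  have "2 \<le> n" using length_le_of_distinct_abs[OF xs] by simp
  with g(1) v show ?thesis
    using signed_permsD(2)[OF g(1), of 1] signed_permsD(2)[OF g(1), of 2]
    by (intro that[of g]) simp_all
qed

lemma standard_position3:
  assumes "x \<in> signed_set n" "y \<in> signed_set n" "z \<in> signed_set n" "\<bar>x\<bar> \<noteq> \<bar>y\<bar>" "\<bar>x\<bar> \<noteq> \<bar>z\<bar>"
      "\<bar>y\<bar> \<noteq> \<bar>z\<bar>"
  obtains g where "g \<in> SP" "g 1 = x" "g 2 = y" "g 3 = z"
    "g (- 1) = - x" "g (- 2) = - y" "g (- 3) = - z" "3 \<le> n"
proof -
  have xs: "set [x, y, z] \<subseteq> signed_set n" "distinct (map abs [x, y, z])" using assms by auto
  obtain g where g: "g \<in> SP" "\<forall>k<length [x, y, z]. g (int k + 1) = [x, y, z] ! k"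
    using signed_perm_extend[OF xs] by blast
  have v: "g 1 = x" "g 2 = y" "g 3 = z"
    using g(2)[rule_format, of 0] g(2)[rule_format, of 1] g(2)[rule_format, of 2] by simp_all
  have "3 \<le> n" using length_le_of_distinct_abs[OF xs] by simp
  with g(1) v show ?thesis
    using signed_permsD(2)[OF g(1), of 1] signed_permsD(2)[OF g(1), of 2] signed_permsD(2)[OF
        g(1), of 3]
    by (intro that[of g]) simp_all
qed

lemma standard_position4:
  assumes "x \<in> signed_set n" "y \<in> signed_set n" "z \<in> signed_set n" "w \<in> signed_set n" "\<bar>x\<bar> \<noteq> \<bar>y\<bar>"
      "\<bar>x\<bar> \<noteq> \<bar>z\<bar>" "\<bar>x\<bar> \<noteq> \<bar>w\<bar>" "\<bar>y\<bar> \<noteq> \<bar>z\<bar>" "\<bar>y\<bar> \<noteq> \<bar>w\<bar>" "\<bar>z\<bar> \<noteq> \<bar>w\<bar>"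
  obtains g where "g \<in> SP" "g 1 = x" "g 2 = y" "g 3 = z" "g 4 = w"
    "g (- 1) = - x" "g (- 2) = - y" "g (- 3) = - z" "g (- 4) = - w" "4 \<le> n"
proof -
  have xs: "set [x, y, z, w] \<subseteq> signed_set n" "distinct (map abs [x, y, z, w])" using assms by auto
  obtain g where g: "g \<in> SP" "\<forall>k<length [x, y, z, w]. g (int k + 1) = [x, y, z, w] ! k"
    using signed_perm_extend[OF xs] by blast
  have v: "g 1 = x" "g 2 = y" "g 3 = z" "g 4 = w"
    using g(2)[rule_format, of 0] g(2)[rule_format, of 1] g(2)[rule_format, of 2]
        g(2)[rule_format, of 3] by simp_all
  have "4 \<le> n" using length_le_of_distinct_abs[OF xs] by simp
  with g(1) v show ?thesis
    using signed_permsD(2)[OF g(1), of 1] signed_permsD(2)[OF g(1), of 2] signed_permsD(2)[OF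
        g(1), of 3] signed_permsD(2)[OF g(1), of 4]
    by (intro that[of g]) simp_all
qed

lemma transport_product_eq:
  assumes g: "g \<in> SP"
    and "x \<in> signed_set n" "y \<in> signed_set n" "z \<in> signed_set n" "w \<in> signed_set n"
    and "x' \<in> signed_set n" "y' \<in> signed_set n" "z' \<in> signed_set n" "w' \<in> signed_set n"
    and eq: "atom x y * atom z w = atom x' y' * atom z' w'"
  shows "atom (g x) (g y) * atom (g z) (g w) = atom (g x') (g y') * atom (g z') (g w')"
proof -
  have "atom (g x) (g y) * atom (g z) (g w) = T (inv g) * (atom x y * atom z w) * T g"
    using assms(1-9) by (simp add: atom_conj' mult.assoc)
  also have "\<dots> = T (inv g) * (atom x' y' * atom z' w') * T g" by (simp only: eq)
  also have "\<dots> = atom (g x') (g y') * atom (g z') (g w')"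
    using assms(1-9) by (simp add: atom_conj' mult.assoc)
  finally show ?thesis .
qed

lemma atom_sgen:
  assumes "i < n" "x \<in> signed_set n" "y \<in> signed_set n"
  shows "atom (sgen i x) (sgen i y) = s i * atom x y * s i"
proof -
  show ?thesis using atom_conj'[OF sgen_signed_perms[OF assms(1)] assms(2,3)] assms(1)
    by (simp add: T_sgen inv_sgen)
qed

lemma base_values:
  shows "0 < n \<Longrightarrow> atom 1 (- 1) = xi 0" "0 < n \<Longrightarrow> atom (- 1) 1 = xi 0"
    and "1 < n \<Longrightarrow> atom 2 (- 2) = s 1 * xi 0 * s 1"
    and "1 < n \<Longrightarrow> atom 1 2 = xi 1"
    and "1 < n \<Longrightarrow> atom (- 1) 2 = s 0 * xi 1 * s 0" "1 < n \<Longrightarrow> atom 1 (- 2) = s 0 * xi 1 * s 0"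
    and "2 < n \<Longrightarrow> atom 2 3 = xi 2" and "3 < n \<Longrightarrow> atom 3 4 = xi 3"
proof -
  have in1: "0 < n \<Longrightarrow> 1 \<in> signed_set n" and in2: "1 < n \<Longrightarrow> 2 \<in> signed_set n"
    by (auto simp: signed_set_def)
  show 1: "0 < n \<Longrightarrow> atom (- 1) 1 = xi 0" using atom_xi[of 0] by (simp add: lo_def)
  then show 2: "0 < n \<Longrightarrow> atom 1 (- 1) = xi 0" using atom_sym[of 1 "- 1"] in1 by simp
  show "1 < n \<Longrightarrow> atom 2 (- 2) = s 1 * xi 0 * s 1"
    using atom_sgen[of 1 1 "- 1"] in1 2 by (simp add: sgen_def sreflect_def lo_def)
  show 3: "1 < n \<Longrightarrow> atom 1 2 = xi 1" using atom_xi[of 1] by (simp add: lo_def)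
  show 4: "1 < n \<Longrightarrow> atom (- 1) 2 = s 0 * xi 1 * s 0"
    using atom_sgen[of 0 1 2] in1 in2 3 by (simp add: sgen_def sreflect_def lo_def)
  then show "1 < n \<Longrightarrow> atom 1 (- 2) = s 0 * xi 1 * s 0"
    using atom_neg[of 1 "- 2"] in1 in2 by simp
  show "2 < n \<Longrightarrow> atom 2 3 = xi 2" using atom_xi[of 2] by (simp add: lo_def)
  show "3 < n \<Longrightarrow> atom 3 4 = xi 3" using atom_xi[of 3] by (simp add: lo_def)
qed

text \<open>In standard position this is the relation between \<open>xi 0\<close> and its conjugate under \<open>s 1\<close>.\<close>

lemma atom_flip_flip:
  assumes "x \<in> signed_set n" "z \<in> signed_set n"
  shows "atom x (- x) * atom z (- z) = atom z (- z) * atom x (- x)"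
proof (cases "\<bar>x\<bar> = \<bar>z\<bar>")
  case True
  then have "z = x \<or> z = - x" by linarith
  then show ?thesis using atom_sym[of x "- x"] assms by auto
next
  case False
  then obtain g where g: "g \<in> SP" and gv: "g 1 = x" "g 2 = z" "g (- 1) = - x" "g (- 2) = - z" and
      n: "2 \<le> n"
        using standard_position2[of x z] assms by metis
  have "atom 1 (- 1) * atom 2 (- 2) = atom 2 (- 2) * atom 1 (- 1)"
    using n rel_xi0_xi0 by (simp add: base_values)
  from transport_product_eq[OF g _ _ _ _ _ _ _ _ this] n
  show ?thesis by (simp add: gv signed_set_def)
qed

text \<open>The generators in standard position are \<open>xi 0\<close> and \<open>xi 1\<close> if the two pairs meet, and \<open>xi 0\<close>
  and \<open>xi 2\<close> otherwise.\<close>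

lemma atom_flip_link:
  assumes "x \<in> signed_set n" "z \<in> signed_set n" "w \<in> signed_set n" "\<bar>z\<bar> \<noteq> \<bar>w\<bar>"
  shows "atom x (- x) * atom z w = atom z w * atom x (- x)"
proof -
  have adj: "atom z (- z) * atom z w = atom z w * atom z (- z)"
    if zw: "z \<in> signed_set n" "w \<in> signed_set n" "\<bar>z\<bar> \<noteq> \<bar>w\<bar>" for z w
  proof -
    obtain g where g: "g \<in> SP" and gv: "g 1 = z" "g 2 = w" "g (- 1) = - z" "g (- 2) = - w" and n:
        "2 \<le> n"
        using standard_position2[of z w] zw by metis
    have "atom 1 (- 1) * atom 1 2 = atom 1 2 * atom 1 (- 1)"
      using n rel_xi_xi_next[of 0] by (simp add: base_values One_nat_def)
    from transport_product_eq[OF g _ _ _ _ _ _ _ _ this] n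
    show ?thesis by (simp add: gv signed_set_def)
  qed
  consider "\<bar>x\<bar> = \<bar>z\<bar>" | "\<bar>x\<bar> = \<bar>w\<bar>" | "\<bar>x\<bar> \<noteq> \<bar>z\<bar>" "\<bar>x\<bar> \<noteq> \<bar>w\<bar>" by blast
  then show ?thesis
  proof cases
    case 1
    then have "atom x (- x) = atom z (- z)" using atom_sym[of x "- x"] assms by (auto simp:
        abs_eq_iff)
    then show ?thesis using adj assms by simp
  next
    case 2
    then have "atom x (- x) = atom w (- w)" using atom_sym[of x "- x"] assms by (auto simp:
        abs_eq_iff)
    then show ?thesis using adj[of w z] assms atom_sym[of z w] by simp
  next
    case 3
    then obtain g where g: "g \<in> SP" and gv: "g 1 = x" "g 2 = z" "g 3 = w" "g (- 1) = - x"
        "g (- 2) = - z" "g (- 3) = - w" and n: "3 \<le> n"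
        using standard_position3[of x z w] assms by metis
    have "atom 1 (- 1) * atom 2 3 = atom 2 3 * atom 1 (- 1)"
      using n rel_xi_xi_far[of 0 2] by (simp add: base_values)
    from transport_product_eq[OF g _ _ _ _ _ _ _ _ this] n
    show ?thesis by (simp add: gv signed_set_def)
  qed
qed

text \<open>Two pairs on the same absolute values lead to \<open>xi 1\<close> and its conjugate under \<open>s 0\<close>, two
  pairs that share one absolute value to \<open>xi 1\<close> and \<open>xi 2\<close>.\<close>

lemma atom_link_link_adjacent:
  assumes "x \<in> signed_set n" "y \<in> signed_set n" "w \<in> signed_set n" "\<bar>x\<bar> \<noteq> \<bar>y\<bar>" "\<bar>y\<bar> \<noteq> \<bar>w\<bar>"
  shows "atom x y * atom y w = atom y w * atom x y"
proof -
  consider "w = x" | "w = - x" | "\<bar>x\<bar> \<noteq> \<bar>w\<bar>" by linarith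
  then show ?thesis
  proof cases
    case 1 then show ?thesis using atom_sym assms by simp
  next
    case 2
    obtain g where g: "g \<in> SP" and gv: "g 1 = x" "g 2 = y" "g (- 1) = - x" "g (- 2) = - y" and n:
        "2 \<le> n"
        using standard_position2[of x y] assms by metis
    have "atom (- 1) 2 * atom 1 2 = atom 1 2 * atom (- 1) 2"
      using n rel_xi1_xi1 by (simp add: base_values)
    from transport_product_eq[OF g _ _ _ _ _ _ _ _ this] n
    show ?thesis using 2 atom_sym[of "- x" y] assms by (simp add: gv signed_set_def)
  next
    case 3
    then obtain g where g: "g \<in> SP" and gv: "g 1 = x" "g 2 = y" "g 3 = w" "g (- 1) = - x"
        "g (- 2) = - y" "g (- 3) = - w" and n: "3 \<le> n"
        using standard_position3[of x y w] assms by metis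
    have "atom 1 2 * atom 2 3 = atom 2 3 * atom 1 2"
      using n rel_xi_xi_next[of 1] by (simp add: base_values numeral_2_eq_2 One_nat_def)
    from transport_product_eq[OF g _ _ _ _ _ _ _ _ this] n
    show ?thesis by (simp add: gv signed_set_def)
  qed
qed

lemma atom_link_link:
  assumes x: "x \<in> signed_set n" and y: "y \<in> signed_set n"
    and z: "z \<in> signed_set n" and w: "w \<in> signed_set n" and xy: "\<bar>x\<bar> \<noteq> \<bar>y\<bar>" and zw: "\<bar>z\<bar> \<noteq> \<bar>w\<bar>"
  shows "atom x y * atom z w = atom z w * atom x y"
proof -
  have meet: "atom x y * atom z w = atom z w * atom x y"
    if h: "x \<in> signed_set n" "y \<in> signed_set n" "z \<in> signed_set n" "w \<in> signed_set n"
      "\<bar>x\<bar> \<noteq> \<bar>y\<bar>" "\<bar>z\<bar> \<noteq> \<bar>w\<bar>" "\<bar>y\<bar> = \<bar>z\<bar>" for x y z w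
  proof -
    consider "z = y" | "z = - y" using h(7) by linarith
    then show ?thesis
    proof cases
      case 1
      have "\<bar>y\<bar> \<noteq> \<bar>w\<bar>" using h(6) unfolding 1 .
      then show ?thesis unfolding 1 by (intro atom_link_link_adjacent h)
    next
      case 2
      have yw: "\<bar>y\<bar> \<noteq> \<bar>- w\<bar>" using h(6) unfolding 2 by simp
      have "atom z w = atom y (- w)" unfolding 2 using atom_neg[of y "- w"] h(2,4) by simp
      then show ?thesis using atom_link_link_adjacent[OF h(1,2) _ h(5) yw] h(4) by simp
    qed
  qed
  consider "\<bar>y\<bar> = \<bar>z\<bar>" | "\<bar>y\<bar> = \<bar>w\<bar>" | "\<bar>x\<bar> = \<bar>z\<bar>" | "\<bar>x\<bar> = \<bar>w\<bar>"
    | "\<bar>x\<bar> \<noteq> \<bar>z\<bar>" "\<bar>x\<bar> \<noteq> \<bar>w\<bar>" "\<bar>y\<bar> \<noteq> \<bar>z\<bar>" "\<bar>y\<bar> \<noteq> \<bar>w\<bar>" by blast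
  then show ?thesis
  proof cases
    case 1 then show ?thesis by (intro meet assms)
  next
    case 2
    then show ?thesis unfolding atom_sym[OF z w] by (intro meet assms zw[symmetric])
  next
    case 3
    then show ?thesis unfolding atom_sym[OF x y] by (intro meet assms xy[symmetric])
  next
    case 4
    then show ?thesis unfolding atom_sym[OF x y] atom_sym[OF z w]
      by (intro meet assms xy[symmetric] zw[symmetric])
  next
    case 5
    obtain g where g: "g \<in> SP" and gv: "g 1 = x" "g 2 = y" "g 3 = z" "g 4 = w" "g (- 1) = - x"
        "g (- 2) = - y" "g (- 3) = - z" "g (- 4) = - w" and n: "4 \<le> n"
        by (rule standard_position4[OF x y z w xy 5 zw])
    have "atom 1 2 * atom 3 4 = atom 3 4 * atom 1 2"
      using n rel_xi_xi_far[of 1 3] by (simp add: base_values)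
    from transport_product_eq[OF g _ _ _ _ _ _ _ _ this] n
    show ?thesis by (simp add: gv signed_set_def)
  qed
qed

lemma atom_commute:
  assumes "x \<in> signed_set n" "y \<in> signed_set n" "z \<in> signed_set n" "w \<in> signed_set n"
  shows "atom x y * atom z w = atom z w * atom x y"
proof -
  consider "x = y \<or> z = w" | "y = - x" "w = - z" | "y = - x" "\<bar>z\<bar> \<noteq> \<bar>w\<bar>"
    | "w = - z" "\<bar>x\<bar> \<noteq> \<bar>y\<bar>" | "\<bar>x\<bar> \<noteq> \<bar>y\<bar>" "\<bar>z\<bar> \<noteq> \<bar>w\<bar>"
    using abs_eq_iff[of y x] abs_eq_iff[of w z] by metis
  then show ?thesis
  proof cases
    case 1 then show ?thesis by auto
  next
    case 2 then show ?thesis using assms(1,3) by (simp only: atom_flip_flip)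
  next
    case 3 then show ?thesis using atom_flip_link[of x z w] assms by simp
  next
    case 4 then show ?thesis using atom_flip_link[of z x y] assms by simp
  next
    case 5 then show ?thesis using assms by (intro atom_link_link)
  qed
qed

text \<open>Merging \<open>x\<close>, \<open>- x\<close> and \<open>y\<close> can be done in two ways; this is the transported form of
  \<open>xi 0 * xi 1 = s 0 * xi 1 * s 0 * xi 1\<close>.\<close>

lemma atom_flip_link_product:
  assumes "x \<in> signed_set n" "y \<in> signed_set n" "\<bar>x\<bar> \<noteq> \<bar>y\<bar>"
  shows "atom x (- x) * atom x y = atom (- x) y * atom x y"
proof -
  obtain g where g: "g \<in> SP" and gv: "g 1 = x" "g 2 = y" "g (- 1) = - x" "g (- 2) = - y" and n:
      "2 \<le> n"
        using standard_position2[of x y] assms by metis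
  have "atom 1 (- 1) * atom 1 2 = atom (- 1) 2 * atom 1 2"
    using n rel_xi0_xi1 by (simp add: base_values)
  from transport_product_eq[OF g _ _ _ _ _ _ _ _ this] n
  show ?thesis by (simp add: gv signed_set_def)
qed

text \<open>If the absolute values are distinct, let \<open>t\<close> be the reflection exchanging \<open>x\<close> and \<open>y\<close>. It is
  absorbed by \<open>atom x y\<close>, hence by the product \<open>atom x y * atom y z\<close> from the right, because the
  factors commute. Moving \<open>t\<close> from the middle to the right turns \<open>atom y z\<close> into \<open>atom x z\<close>. The
  degenerate cases follow from \<open>atom_flip_link_product\<close>.\<close>

lemma atom_trans:
  assumes x: "x \<in> signed_set n" and y: "y \<in> signed_set n" and z: "z \<in> signed_set n"
  shows "atom x y * atom y z * atom x z = atom x y * atom y z"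
proof -
  note nz = signed_set_nonzero[OF x] signed_set_nonzero[OF y] signed_set_nonzero[OF z]
  have flip: "atom x (- x) * atom x y * atom (- x) y = atom x (- x) * atom x y"
    if "x \<in> signed_set n" "y \<in> signed_set n" "\<bar>x\<bar> \<noteq> \<bar>y\<bar>" for x y
  proof -
    have "atom x (- x) * atom x y * atom (- x) y = atom (- x) y * atom x y * atom (- x) y"
      using atom_flip_link_product that by simp
    also have "\<dots> = atom (- x) y * atom (- x) y * atom x y"
      using that atom_commute[of x y "- x" y] by (simp add: mult.assoc)
    finally show ?thesis using that by (simp add: atom_idem atom_flip_link_product)
  qed
  consider "x = y" | "y = z" | "x = z" | "z = - x" "\<bar>x\<bar> \<noteq> \<bar>y\<bar>" | "z = - y" "\<bar>x\<bar> \<noteq> \<bar>y\<bar>"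
    | "y = - x" "\<bar>x\<bar> \<noteq> \<bar>z\<bar>" | "\<bar>x\<bar> \<noteq> \<bar>y\<bar>" "\<bar>x\<bar> \<noteq> \<bar>z\<bar>" "\<bar>y\<bar> \<noteq> \<bar>z\<bar>"
    using abs_eq_iff[of y x] abs_eq_iff[of z x] abs_eq_iff[of z y] by metis
  then show ?thesis
  proof cases
    case 1 then show ?thesis using y z by (simp add: atom_idem)
  next
    case 2 then show ?thesis using x y by (simp add: atom_idem)
  next
    case 3 then show ?thesis by simp
  next
    case 4
    have "atom x y * atom y (- x) = atom (- x) y * atom x y"
      using atom_commute[of x y "- x" y] atom_sym[of y "- x"] x y by simp
    also have "\<dots> = atom x (- x) * atom x y" using atom_flip_link_product x y 4 by simp
    finally have *: "atom x y * atom y z = atom x (- x) * atom x y" using 4 by simp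
    have "atom x (- x) * atom x y * atom x (- x) = atom x (- x) * atom x (- x) * atom x y"
      using atom_commute[of x y x "- x"] x y by (simp add: mult.assoc)
    then show ?thesis unfolding * using 4 x by (simp add: atom_idem)
  next
    case 5
    have "atom x y * atom y (- y) = atom y (- y) * atom y x"
      using atom_commute[of x y y "- y"] atom_sym[of x y] x y by simp
    moreover have "atom x (- y) = atom (- y) x" using atom_sym x y by simp
    ultimately show ?thesis using flip[of y x] 5 x y by simp
  next
    case 6
    have "atom x (- x) = atom (- x) x" using atom_sym x by simp
    then show ?thesis using flip[of "- x" z] 6 x z by simp
  next
    case 7
    let ?t = "sreflect x y"
    have t: "?t \<in> SP" using x y by (rule sreflect_signed_perms)
    have tx: "?t x = y" "?t z = z" using 7 nz by (auto simp: sreflect_def)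
    have tt: "T ?t * T ?t = 1" using T_comp[OF t t] nz by simp
    have "atom x y * atom y z = atom x y * T ?t * atom y z" using atom_absorb x y by simp
    also have "\<dots> = atom x y * (atom x z * T ?t)"
      using atom_conj[OF t x z] tx by (simp add: mult.assoc)
    finally have *: "atom x y * atom y z = atom x y * atom x z * T ?t" by (simp add: mult.assoc)
    have "atom x y * atom y z = atom y z * (atom x y * T ?t)"
      using atom_commute[of x y y z] atom_absorb x y z by simp
    also have "\<dots> = atom x y * atom y z * T ?t" using atom_commute[of x y y z] x y z by (simp add:
        mult.assoc)
    also have "\<dots> = atom x y * atom x z" unfolding * by (simp add: mult.assoc tt)
    finally have **: "atom x y * atom y z = atom x y * atom x z" .
    show ?thesis unfolding ** using x z by (simp add: mult.assoc atom_idem)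
  qed
qed

subsection \<open>Products of atoms\<close>

definition atoms :: "(int \<times> int) list \<Rightarrow> 'm" where
  "atoms ps = prod_list (map (\<lambda>(x, y). atom x y) ps)"

lemma atoms_simps [simp]: "atoms [] = 1" "atoms ((x, y) # ps) = atom x y * atoms ps"
  by (simp_all add: atoms_def)

abbreviation pairs :: "(int \<times> int) set" where "pairs \<equiv> signed_set n \<times> signed_set n"

lemma atoms_atom_commute:
  assumes "set ps \<subseteq> pairs" "x \<in> signed_set n" "y \<in> signed_set n"
  shows "atoms ps * atom x y = atom x y * atoms ps"
  using assms(1)
proof (induction ps)
  case (Cons p ps)
  obtain z w where p: "p = (z, w)" by (cases p)
  have "atoms (p # ps) * atom x y = atom z w * (atoms ps * atom x y)" by (simp add: p mult.assoc)
  also have "\<dots> = (atom z w * atom x y) * atoms ps" using Cons by (simp add: mult.assoc)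
  also have "\<dots> = atom x y * atoms (p # ps)"
    using Cons.prems assms(2,3) atom_commute[of z w x y] by (simp add: p mult.assoc)
  finally show ?case .
qed simp

lemma atoms_atoms_commute: "set ps \<subseteq> pairs \<Longrightarrow> set qs \<subseteq> pairs \<Longrightarrow> atoms ps * atoms qs = atoms qs *
    atoms ps"
proof (induction qs)
  case (Cons q qs)
  obtain z w where q: "q = (z, w)" by (cases q)
  have "atoms ps * atoms (q # qs) = (atoms ps * atom z w) * atoms qs" by (simp add: q mult.assoc)
  also have "\<dots> = atom z w * (atoms ps * atoms qs)"
    using Cons.prems atoms_atom_commute[of ps z w] by (simp add: q mult.assoc)
  also have "\<dots> = atoms (q # qs) * atoms ps" using Cons by (simp add: q mult.assoc)
  finally show ?case .
qed simp

lemma atoms_absorb_member: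
  assumes "set ps \<subseteq> pairs" "(x, y) \<in> set ps"
  shows "atoms ps * atom x y = atoms ps"
  using assms
proof (induction ps)
  case (Cons p ps)
  show ?case
  proof (cases "p = (x, y)")
    case True
    then have "atoms (p # ps) * atom x y = (atom x y * atom x y) * atoms ps"
      using Cons.prems atoms_atom_commute[of ps x y] by (simp add: mult.assoc)
    then show ?thesis using Cons.prems True by (simp add: atom_idem)
  next
    case False
    then show ?thesis using Cons by (cases p) (auto simp: mult.assoc)
  qed
qed simp

text \<open>The pairs whose atom is absorbed form an invariant equivalence relation, transitivity being
  \<open>atom_trans\<close>.\<close>

lemma atoms_absorb_equiv:
  assumes ps: "set ps \<subseteq> pairs" and "(x, y) \<in> inv_equiv n (set ps)"
  shows "atoms ps * atom x y = atoms ps"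
  using assms(2)
proof (induction rule: inv_equiv.induct)
  case (base x y)
  then show ?case using atoms_absorb_member ps by blast
next
  case (neg x y)
  then show ?case using inv_equiv_in[OF neg(1)] by (simp add: atom_neg)
next
  case (refl x)
  then show ?case by simp
next
  case (sym x y)
  then show ?case using inv_equiv_in[OF sym(1)] atom_sym[of x y] by simp
next
  case (trans x y z)
  then have "atoms ps = atoms ps * (atom x y * atom y z)" by (simp flip: mult.assoc)
  also have "\<dots> = atoms ps * (atom x y * atom y z) * atom x z"
    using atom_trans[of x y z] inv_equiv_in[OF trans(1)] inv_equiv_in[OF trans(2)] by (simp add:
        mult.assoc)
  also have "\<dots> = atoms ps * atom x z" using trans by (simp flip: mult.assoc)
  finally show ?case by simp
qed

lemma atoms_absorb_atoms:
  assumes "set ps \<subseteq> pairs" "set qs \<subseteq> inv_equiv n (set ps)"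
  shows "atoms ps * atoms qs = atoms ps"
  using assms(2)
proof (induction qs)
  case (Cons q qs)
  then show ?case using atoms_absorb_equiv[OF assms(1)]
    by (cases q) (simp flip: mult.assoc)
qed simp

text \<open>Each of the two products absorbs the other, and they commute.\<close>

lemma atoms_cong:
  assumes "set ps \<subseteq> pairs" "set qs \<subseteq> pairs" "inv_equiv n (set ps) = inv_equiv n (set qs)"
  shows "atoms ps = atoms qs"
proof -
  have "set qs \<subseteq> inv_equiv n (set ps)" "set ps \<subseteq> inv_equiv n (set qs)"
    using assms by (auto intro: inv_equiv.base simp flip: assms(3)) (auto intro: inv_equiv.base
        simp: assms(3))
  then show ?thesis using atoms_absorb_atoms atoms_atoms_commute assms by metis
qed

lemma atoms_absorb_reflection:
  assumes "set ps \<subseteq> pairs" "(x, y) \<in> inv_equiv n (set ps)"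
  shows "atoms ps * T (sreflect x y) = atoms ps"
proof -
  have "atoms ps * T (sreflect x y) = atoms ps * (atom x y * T (sreflect x y))"
    using atoms_absorb_equiv[OF assms] by (simp flip: mult.assoc)
  then show ?thesis
    using atom_absorb inv_equiv_in[OF assms(2)] atoms_absorb_equiv[OF assms] by simp
qed

text \<open>Induction on the number of moved points. If \<open>g\<close> moves \<open>x\<close>, then composing it with the
  reflection that exchanges \<open>x\<close> and \<open>g x\<close> fixes \<open>x\<close> and all points fixed by \<open>g\<close>, and it still
  preserves the classes; the reflection is absorbed because \<open>x\<close> and \<open>g x\<close> are equivalent.\<close>

lemma atoms_absorb_T:
  assumes ps: "set ps \<subseteq> pairs" and "g \<in> SP"
    and "\<And>x. x \<in> signed_set n \<Longrightarrow> (x, g x) \<in> inv_equiv n (set ps)"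
  shows "atoms ps * T g = atoms ps"
  using assms(2,3)
proof (induction "card {x \<in> signed_set n. g x \<noteq> x}" arbitrary: g rule: less_induct)
  case less
  note g = less.prems(1)
  show ?case
  proof (cases "\<exists>x\<in>signed_set n. g x \<noteq> x")
    case False
    then have "g x = x" for x using signed_perms_outside[OF g] by metis
    then have "g = id" by auto
    then show ?thesis by simp
  next
    case True
    then obtain x where x: "x \<in> signed_set n" "g x \<noteq> x" by blast
    let ?t = "sreflect x (g x)"
    have gx: "g x \<in> signed_set n" using signed_permsD(3)[OF g] x by simp
    have t: "?t \<in> SP" using x gx by (intro sreflect_signed_perms)
    have tt: "?t (?t z) = z" for z using x gx signed_set_nonzero by simp
    have t_equiv: "(z, ?t z) \<in> inv_equiv n (set ps)" if "z \<in> signed_set n" for z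
    proof -
      have "(x, g x) \<in> inv_equiv n (set ps)" using less.prems(2) x by simp
      moreover from this have "(- x, - g x) \<in> inv_equiv n (set ps)" by (rule inv_equiv.neg)
      ultimately show ?thesis
        using that by (auto simp: sreflect_def intro: inv_equiv.sym inv_equiv.refl)
    qed
    let ?h = "?t \<circ> g"
    have h: "?h \<in> SP" using g t by (rule signed_perms_comp)
    have fixed: "?h z = z" if "g z = z" for z
    proof -
      have "z \<noteq> x" "z \<noteq> - x" using x(2) that signed_permsD(2)[OF g, of x] by auto
      moreover have "z \<noteq> g x" using that x(2) signed_permsD(5)[OF g, of z x] by auto
      moreover have "z \<noteq> - g x"
        using that x(2) signed_permsD(5)[OF g, of z "- x"] signed_permsD(2)[OF g, of x] by auto
      ultimately show ?thesis using that by (simp add: sreflect_def)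
    qed
    have hx: "?h x = x" by (simp add: sreflect_def)
    have "{z \<in> signed_set n. ?h z \<noteq> z} \<subset> {z \<in> signed_set n. g z \<noteq> z}"
      using fixed hx x by blast
    then have "card {z \<in> signed_set n. ?h z \<noteq> z} < card {z \<in> signed_set n. g z \<noteq> z}"
      by (intro psubset_card_mono) auto
    moreover have "(z, ?h z) \<in> inv_equiv n (set ps)" if "z \<in> signed_set n" for z
      using less.prems(2)[OF that] t_equiv[of "g z"] signed_permsD(3)[OF g] that
      by (auto intro: inv_equiv.trans)
    ultimately have "atoms ps * T ?h = atoms ps" using less.hyps h by blast
    moreover have "g = ?t \<circ> ?h" using tt by auto
    ultimately have "atoms ps * T g = atoms ps * T ?t"
      using T_comp[OF h t] by (simp flip: mult.assoc)
    then show ?thesis using atoms_absorb_reflection[OF ps] less.prems(2) x by simp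
  qed
qed

lemma normal_form_eq:
  assumes ps: "set ps \<subseteq> pairs" and qs: "set qs \<subseteq> pairs" and g: "g \<in> SP" and h: "h \<in> SP"
    and eq: "inv_equiv n (set ps) = inv_equiv n (set qs)"
    and rel: "\<And>x. x \<in> signed_set n \<Longrightarrow> (x, inv g (h x)) \<in> inv_equiv n (set ps)"
  shows "atoms ps * T g = atoms qs * T h"
proof -
  let ?k = "inv g \<circ> h"
  have k: "?k \<in> SP" using g h by (intro signed_perms_comp signed_perms_inv)
  have "h = g \<circ> ?k" using signed_perms_inv_comp(2)[OF g] by (simp flip: comp_assoc)
  then have "T h = T ?k * T g" using T_comp[OF k g] by simp
  moreover have "atoms qs * T ?k = atoms qs"
    using rel eq by (intro atoms_absorb_T[OF qs k]) simp
  ultimately have "atoms qs * T h = atoms qs * T g" by (simp flip: mult.assoc)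
  then show ?thesis using atoms_cong[OF ps qs eq] by simp
qed

end

section \<open>Normal forms of words\<close>

text \<open>A pair \<open>(ps, g)\<close> stands for the product of the atoms of \<open>ps\<close> and \<open>g\<close>. An idempotent
  multiplied from the right is moved in front of \<open>g\<close>, which applies the inverse of \<open>g\<close> to its
  pair. The same computation is valid in every model and in \<open>FB n\<close> (\<open>eval_nf\<close>, \<open>FB_eval_nf\<close>).\<close>

fun nf_step :: "(int \<times> int) list \<times> (int \<Rightarrow> int) \<Rightarrow> letter \<Rightarrow> (int \<times> int) list \<times> (int \<Rightarrow> int)" where
  "nf_step (ps, g) (S i) = (ps, sgen i \<circ> g)"
| "nf_step (ps, g) (Xi i) = ((inv g (lo i), inv g (hi i)) # ps, g)"

definition nf :: "letter list \<Rightarrow> (int \<times> int) list \<times> (int \<Rightarrow> int)" where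
  "nf u = foldl nf_step ([], id) u"

lemma nf_Nil [simp]: "nf [] = ([], id)" and nf_snoc: "nf (u @ [l]) = nf_step (nf u) l"
  by (simp_all add: nf_def)

lemma nf_in:
  assumes "u \<in> lists (alphabet n)" "nf u = (ps, g)"
  shows "set ps \<subseteq> signed_set n \<times> signed_set n \<and> g \<in> signed_perms n"
  using assms
proof (induction u arbitrary: ps g rule: rev_induct)
  case (snoc l u)
  obtain qs h where u: "nf u = (qs, h)" by fastforce
  with snoc have IH: "set qs \<subseteq> signed_set n \<times> signed_set n" "h \<in> signed_perms n" by auto
  have "l \<in> alphabet n" using snoc.prems by simp
  then consider i where "l = S i" "i < n" | i where "l = Xi i" "i < n" by (auto simp: alphabet_def)
  then show ?case
  proof cases
    case 1
    then show ?thesis using snoc.prems(2) IH u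
      by (auto simp: nf_snoc intro: signed_perms_comp sgen_signed_perms)
  next
    case 2
    then show ?thesis using snoc.prems(2) IH u signed_permsD(3)[OF signed_perms_inv[OF IH(2)]]
      by (auto simp: nf_snoc lo_in hi_in)
  qed
qed simp

lemma (in FB_model) eval_nf:
  assumes "u \<in> lists (alphabet n)" "nf u = (ps, g)"
  shows "prod_list (map f u) = atoms ps * T g"
  using assms
proof (induction u arbitrary: ps g rule: rev_induct)
  case (snoc l u)
  obtain qs h where u: "nf u = (qs, h)" by fastforce
  have IH: "prod_list (map f u) = atoms qs * T h" using snoc u by simp
  have qs: "set qs \<subseteq> pairs" and h: "h \<in> SP" using nf_in[of u n] snoc.prems u by auto
  have "l \<in> alphabet n" using snoc.prems by simp
  then consider i where "l = S i" "i < n" | i where "l = Xi i" "i < n" by (auto simp: alphabet_def)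
  then show ?case
  proof cases
    case 1
    then have "T (sgen i \<circ> h) = T h * s i"
      using h by (simp add: T_comp sgen_signed_perms T_sgen)
    then show ?thesis using snoc.prems(2) IH u 1 by (auto simp: nf_snoc mult.assoc)
  next
    case 2
    let ?x = "inv h (lo i)" and ?y = "inv h (hi i)"
    have xy: "?x \<in> signed_set n" "?y \<in> signed_set n"
      using signed_permsD(3)[OF signed_perms_inv[OF h]] 2 lo_in hi_in by auto
    have "atom ?x ?y * T h = T h * xi i"
      using atom_conj[OF h xy] signed_permsD(6)[OF h] atom_xi 2 by simp
    then have "prod_list (map f (u @ [l])) = (atoms qs * atom ?x ?y) * T h"
      using IH 2 by (simp add: mult.assoc)
    also have "\<dots> = atoms ((?x, ?y) # qs) * T h" using atoms_atom_commute[OF qs xy] by simp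
    finally show ?thesis using snoc.prems(2) u 2 by (auto simp: nf_snoc)
  qed
qed simp

section \<open>Completion of relations\<close>

text \<open>Relations equal to their completion: every connected component of the bipartite graph is
  complete.\<close>

definition difunctional :: "('a \<times> 'a) set \<Rightarrow> bool" where
  "difunctional D \<longleftrightarrow> (\<forall>x y x' y'. (x, y) \<in> D \<longrightarrow> (x', y) \<in> D \<longrightarrow> (x', y') \<in> D \<longrightarrow> (x, y') \<in> D)"

lemma difunctionalD:
  "difunctional D \<Longrightarrow> (x, y) \<in> D \<Longrightarrow> (x', y) \<in> D \<Longrightarrow> (x', y') \<in> D \<Longrightarrow> (x, y') \<in> D"
  unfolding difunctional_def by blast

lemma completion_incl: "\<rho> \<subseteq> bip_completion \<rho>"
  by (auto simp: bip_completion_def bip_graph_def intro!: r_into_rtrancl)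

lemma completion_difunctional: "difunctional (bip_completion \<rho>)"
proof -
  have "sym (bip_graph \<rho>)" unfolding bip_graph_def sym_def by auto
  then have sym: "sym ((bip_graph \<rho>)\<^sup>*)" by (rule sym_rtrancl)
  show ?thesis
    unfolding difunctional_def bip_completion_def mem_Collect_eq case_prod_conv
    by (meson symD[OF sym] rtrancl_trans)
qed

text \<open>Induction along a path from \<open>i\<close>: at each right vertex \<open>j\<close> the pair \<open>(i, j)\<close> belongs to \<open>D\<close>,
  and at each left vertex \<open>k\<close> so does \<open>(i, j)\<close> for all neighbours \<open>j\<close> of \<open>k\<close>.\<close>

lemma completion_least:
  assumes "\<rho> \<subseteq> D" "difunctional D"
  shows "bip_completion \<rho> \<subseteq> D"
proof -
  have "case v of Inr j \<Rightarrow> (i, j) \<in> D | Inl k \<Rightarrow> \<forall>j. (k, j) \<in> \<rho> \<longrightarrow> (i, j) \<in> D"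
    if "(Inl i, v) \<in> (bip_graph \<rho>)\<^sup>*" for i v
    using that
  proof (induction rule: rtrancl_induct)
    case base
    then show ?case using assms(1) by auto
  next
    case (step v w)
    from step.hyps(2) consider k j where "v = Inl k" "w = Inr j" "(k, j) \<in> \<rho>"
      | k j where "v = Inr j" "w = Inl k" "(k, j) \<in> \<rho>"
      unfolding bip_graph_def by blast
    then show ?case
    proof cases
      case 1
      then show ?thesis using step.IH by simp
    next
      case 2
      then have "(i, j) \<in> D" using step.IH by simp
      then have "(i, j') \<in> D" if "(k, j') \<in> \<rho>" for j'
        using 2(3) that assms(1) difunctionalD[OF assms(2), of i j k j'] by blast
      then show ?thesis using 2 by simp
    qed
  qed
  then show ?thesis unfolding bip_completion_def by fastforce
qed

lemma completion_of_difunctional: "difunctional D \<Longrightarrow> bip_completion D = D"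
  using completion_incl completion_least by blast

lemma completion_mono: "\<rho> \<subseteq> \<tau> \<Longrightarrow> bip_completion \<rho> \<subseteq> bip_completion \<tau>"
  by (intro completion_least completion_difunctional) (use completion_incl in blast)

definition ess :: "nat \<Rightarrow> (int \<times> int) set set" where
  "ess n = carrier (BinB_ess n)"

lemma ess_iff:
  "\<rho> \<in> ess n \<longleftrightarrow> \<rho> \<subseteq> signed_set n \<times> signed_set n \<and> (\<forall>x y. (x, y) \<in> \<rho> \<longrightarrow> (- x, - y) \<in> \<rho>) \<and>
     Domain \<rho> = signed_set n \<and> Range \<rho> = signed_set n"
proof -
  have "\<rho> O nabla n = nabla n O \<rho> \<longleftrightarrow> (\<forall>x y. (x, y) \<in> \<rho> \<longrightarrow> (- x, - y) \<in> \<rho>)"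
    if \<rho>: "\<rho> \<subseteq> signed_set n \<times> signed_set n"
  proof -
    have 1: "(x, z) \<in> \<rho> O nabla n \<longleftrightarrow> (x, - z) \<in> \<rho>" for x z
    proof
      assume "(x, z) \<in> \<rho> O nabla n"
      then show "(x, - z) \<in> \<rho>" by (auto simp: nabla_def)
    next
      assume *: "(x, - z) \<in> \<rho>"
      then have "(- z, z) \<in> nabla n" using \<rho> by (auto simp: nabla_def)
      with * show "(x, z) \<in> \<rho> O nabla n" by blast
    qed
    have 2: "(x, z) \<in> nabla n O \<rho> \<longleftrightarrow> (- x, z) \<in> \<rho>" for x z
    proof
      assume *: "(- x, z) \<in> \<rho>"
      then have "(x, - x) \<in> nabla n" using \<rho> by (auto simp: nabla_def)
      with * show "(x, z) \<in> nabla n O \<rho>" by blast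
    qed (auto simp: nabla_def)
    have "\<rho> O nabla n = nabla n O \<rho> \<longleftrightarrow> (\<forall>x z. (x, - z) \<in> \<rho> \<longleftrightarrow> (- x, z) \<in> \<rho>)"
      unfolding set_eq_iff split_paired_All 1 2 ..
    also have "\<dots> \<longleftrightarrow> (\<forall>x y. (x, y) \<in> \<rho> \<longrightarrow> (- x, - y) \<in> \<rho>)"
    proof
      assume *: "\<forall>x z. (x, - z) \<in> \<rho> \<longleftrightarrow> (- x, z) \<in> \<rho>"
      have "(- x, - y) \<in> \<rho>" if "(x, y) \<in> \<rho>" for x y
        using that *[rule_format, of x "- y"] by simp
      then show "\<forall>x y. (x, y) \<in> \<rho> \<longrightarrow> (- x, - y) \<in> \<rho>" by blast
    next
      assume *: "\<forall>x y. (x, y) \<in> \<rho> \<longrightarrow> (- x, - y) \<in> \<rho>"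
      have "(x, - z) \<in> \<rho> \<longleftrightarrow> (- x, z) \<in> \<rho>" for x z
        using *[rule_format, of x "- z"] *[rule_format, of "- x" z] by auto
      then show "\<forall>x z. (x, - z) \<in> \<rho> \<longleftrightarrow> (- x, z) \<in> \<rho>" by blast
    qed
    finally show ?thesis .
  qed
  then show ?thesis unfolding ess_def BinB_ess_def BinB_def Bin2_def by auto
qed

lemma essD:
  assumes "\<rho> \<in> ess n"
  shows "(x, y) \<in> \<rho> \<Longrightarrow> x \<in> signed_set n" "(x, y) \<in> \<rho> \<Longrightarrow> y \<in> signed_set n"
    "(x, y) \<in> \<rho> \<Longrightarrow> (- x, - y) \<in> \<rho>"
    "x \<in> signed_set n \<Longrightarrow> \<exists>y. (x, y) \<in> \<rho>" "y \<in> signed_set n \<Longrightarrow> \<exists>x. (x, y) \<in> \<rho>"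
  using assms unfolding ess_iff by blast+

lemma essI:
  assumes "\<And>x y. (x, y) \<in> \<rho> \<Longrightarrow> x \<in> signed_set n \<and> y \<in> signed_set n \<and> (- x, - y) \<in> \<rho>"
    "\<And>x. x \<in> signed_set n \<Longrightarrow> \<exists>y. (x, y) \<in> \<rho>" "\<And>y. y \<in> signed_set n \<Longrightarrow> \<exists>x. (x, y) \<in> \<rho>"
  shows "\<rho> \<in> ess n"
  using assms unfolding ess_iff by (auto simp: Domain_iff Range_iff)

lemma ess_comp:
  assumes \<rho>: "\<rho> \<in> ess n" and \<tau>: "\<tau> \<in> ess n"
  shows "\<rho> O \<tau> \<in> ess n"
proof (rule essI)
  show "x \<in> signed_set n \<and> y \<in> signed_set n \<and> (- x, - y) \<in> \<rho> O \<tau>" if "(x, y) \<in> \<rho> O \<tau>" for x y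
    using that essD(1,3)[OF \<rho>] essD(2,3)[OF \<tau>] by blast
  show "\<exists>y. (x, y) \<in> \<rho> O \<tau>" if "x \<in> signed_set n" for x
    using that essD(2,4)[OF \<rho>] essD(4)[OF \<tau>] by blast
  show "\<exists>x. (x, y) \<in> \<rho> O \<tau>" if "y \<in> signed_set n" for y
    using that essD(5)[OF \<rho>] essD(1,5)[OF \<tau>] by blast
qed

lemma ess_completion:
  assumes \<rho>: "\<rho> \<in> ess n"
  shows "bip_completion \<rho> \<in> ess n"
proof (rule essI)
  let ?K = "bip_completion \<rho>" and ?X = "signed_set n"
  have "difunctional (?X \<times> ?X)" unfolding difunctional_def by auto
  then have X: "?K \<subseteq> ?X \<times> ?X"
    by (intro completion_least) (use essD(1,2)[OF \<rho>] in auto)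
  have "difunctional {(x, y). (- x, - y) \<in> ?K}"
    unfolding difunctional_def mem_Collect_eq case_prod_conv
    using difunctionalD[OF completion_difunctional[of \<rho>]] by blast
  then have neg: "?K \<subseteq> {(x, y). (- x, - y) \<in> ?K}"
    by (intro completion_least) (use essD(3)[OF \<rho>] completion_incl in blast)
  show "x \<in> ?X \<and> y \<in> ?X \<and> (- x, - y) \<in> ?K" if "(x, y) \<in> ?K" for x y
    using that X neg by blast
  show "\<exists>y. (x, y) \<in> ?K" if "x \<in> ?X" for x
    using completion_incl essD(4)[OF \<rho> that] by blast
  show "\<exists>x. (x, y) \<in> ?K" if "y \<in> ?X" for y
    using completion_incl essD(5)[OF \<rho> that] by blast
qed

text \<open>The factors can be completed one after the other: the pairs \<open>(x, y)\<close> such that \<open>(x, z)\<close>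
  belongs to the completion \<open>?D\<close> of the product for every \<open>\<tau>\<close>-successor \<open>z\<close> of \<open>y\<close> form a
  difunctional relation, because \<open>y\<close> has such a successor, and similarly on the other side.\<close>

lemma completion_comp:
  assumes \<rho>: "\<rho> \<in> ess n" and \<tau>: "\<tau> \<in> ess n"
  shows "bip_completion (\<rho> O \<tau>) = bip_completion (bip_completion \<rho> O bip_completion \<tau>)"
proof
  show "bip_completion (\<rho> O \<tau>) \<subseteq> bip_completion (bip_completion \<rho> O bip_completion \<tau>)"
    using completion_incl by (intro completion_mono relcomp_mono)
  let ?D = "bip_completion (\<rho> O \<tau>)"
  note D = difunctionalD[OF completion_difunctional[of "\<rho> O \<tau>"]]
  have 1: "bip_completion \<rho> \<subseteq> {(x, y). y \<in> signed_set n \<and> (\<forall>z. (y, z) \<in> \<tau> \<longrightarrow> (x, z) \<in> ?D)}"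
  proof (rule completion_least)
    show "\<rho> \<subseteq> {(x, y). y \<in> signed_set n \<and> (\<forall>z. (y, z) \<in> \<tau> \<longrightarrow> (x, z) \<in> ?D)}"
      using completion_incl[of "\<rho> O \<tau>"] essD(2)[OF \<rho>] by blast
    show "difunctional {(x, y). y \<in> signed_set n \<and> (\<forall>z. (y, z) \<in> \<tau> \<longrightarrow> (x, z) \<in> ?D)}"
      unfolding difunctional_def using essD(4)[OF \<tau>] D by (clarsimp, metis)
  qed
  have 2: "bip_completion \<tau> \<subseteq> {(y, z). y \<in> signed_set n \<and> (\<forall>x. (x, y) \<in> bip_completion \<rho> \<longrightarrow> (x, z)
      \<in> ?D)}"
  proof (rule completion_least)
    show "\<tau> \<subseteq> {(y, z). y \<in> signed_set n \<and> (\<forall>x. (x, y) \<in> bip_completion \<rho> \<longrightarrow> (x, z) \<in> ?D)}"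
      using 1 essD(1)[OF \<tau>] by blast
    show "difunctional {(y, z). y \<in> signed_set n \<and> (\<forall>x. (x, y) \<in> bip_completion \<rho> \<longrightarrow> (x, z) \<in> ?D)}"
      unfolding difunctional_def using essD(5)[OF ess_completion[OF \<rho>]] D by (clarsimp, metis)
  qed
  show "bip_completion (bip_completion \<rho> O bip_completion \<tau>) \<subseteq> ?D"
    using 2 by (intro completion_least completion_difunctional) blast
qed

section \<open>The type B dual symmetric inverse monoid\<close>

lemma IB_class_conv: "\<rho> \<in> ess n \<Longrightarrow> IB_class n \<rho> = {\<tau> \<in> ess n. bip_completion \<tau> = bip_completion \<rho>}"
  unfolding IB_class_def completion_eq_def ess_def by auto

lemma IB_class_eq_iff:
  assumes "\<rho> \<in> ess n" "\<tau> \<in> ess n"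
  shows "IB_class n \<rho> = IB_class n \<tau> \<longleftrightarrow> bip_completion \<rho> = bip_completion \<tau>"
proof
  assume "IB_class n \<rho> = IB_class n \<tau>"
  moreover have "\<rho> \<in> IB_class n \<rho>" using assms by (simp add: IB_class_conv)
  ultimately have "\<rho> \<in> IB_class n \<tau>" by (rule subst)
  then show "bip_completion \<rho> = bip_completion \<tau>" using assms by (simp add: IB_class_conv)
qed (use assms in \<open>simp add: IB_class_conv\<close>)

lemma IB_carrier: "carrier (IB n) = IB_class n ` ess n"
  by (auto simp: IB_def quotient_def IB_class_def ess_def)

lemma IB_class_in [simp]: "\<rho> \<in> ess n \<Longrightarrow> IB_class n \<rho> \<in> carrier (IB n)"
  by (simp add: IB_carrier)

lemma IB_mult:
  assumes \<rho>: "\<rho> \<in> ess n" and \<tau>: "\<tau> \<in> ess n"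
  shows "IB_class n \<rho> \<otimes>\<^bsub>IB n\<^esub> IB_class n \<tau> = IB_class n (\<rho> O \<tau>)"
proof -
  have mult: "a \<otimes>\<^bsub>BinB_ess n\<^esub> c = a O c" for a c
    by (simp add: BinB_ess_def BinB_def Bin2_def)
  have "IB_class n (a O c) = IB_class n (\<rho> O \<tau>)"
    if "a \<in> IB_class n \<rho>" "c \<in> IB_class n \<tau>" for a c
  proof -
    have a: "a \<in> ess n" "bip_completion a = bip_completion \<rho>" and
      c: "c \<in> ess n" "bip_completion c = bip_completion \<tau>" using that assms by (simp_all add:
          IB_class_conv)
    then have "bip_completion (a O c) = bip_completion (\<rho> O \<tau>)"
      using completion_comp[OF a(1) c(1)] completion_comp[OF assms] by simp
    then show ?thesis using a c assms by (simp add: IB_class_eq_iff ess_comp)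
  qed
  then have "(\<Union>a\<in>IB_class n \<rho>. \<Union>c\<in>IB_class n \<tau>. IB_class n (a O c)) =
      (\<Union>a\<in>IB_class n \<rho>. \<Union>c\<in>IB_class n \<tau>. IB_class n (\<rho> O \<tau>))"
    by (intro SUP_cong HOL.refl)
  also have "\<dots> = IB_class n (\<rho> O \<tau>)"
    using assms by (auto simp: IB_class_conv)
  finally show ?thesis by (simp add: IB_def mult)
qed

lemma ess_Id: "Id_on (signed_set n) \<in> ess n"
  by (rule essI) auto

lemma IB_one: "\<one>\<^bsub>IB n\<^esub> = IB_class n (Id_on (signed_set n))"
  by (simp add: IB_def BinB_ess_def BinB_def Bin2_def)

lemma ess_Id_O: "\<rho> \<in> ess n \<Longrightarrow> Id_on (signed_set n) O \<rho> = \<rho>"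
    "\<rho> \<in> ess n \<Longrightarrow> \<rho> O Id_on (signed_set n) = \<rho>"
  by (auto dest: essD(1,2))

lemma IB_monoid: "monoid (IB n)"
proof (rule monoidI)
  show "\<one>\<^bsub>IB n\<^esub> \<in> carrier (IB n)" by (simp add: IB_one ess_Id)
qed (auto simp: IB_carrier IB_mult ess_comp O_assoc IB_one ess_Id ess_Id_O)

lemma perm_rel_in_ess:
  assumes g: "g \<in> signed_perms n"
  shows "{(x, g x) |x. x \<in> signed_set n} \<in> ess n"
proof (rule essI)
  show "\<exists>x. (x, y) \<in> {(x, g x) |x. x \<in> signed_set n}" if "y \<in> signed_set n" for y
    using that signed_permsD(3)[OF signed_perms_inv[OF g]] signed_permsD(6)[OF g, symmetric] by
        blast
qed (use signed_permsD(2,3)[OF g] in auto)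

lemma perm_elt_in: "g \<in> signed_perms n \<Longrightarrow> perm_elt n g \<in> carrier (IB n)"
  by (simp add: perm_elt_def perm_rel_in_ess)

lemma perm_elt_id: "perm_elt n id = \<one>\<^bsub>IB n\<^esub>"
  unfolding perm_elt_def IB_one by (rule arg_cong[where f = "IB_class n"]) auto

lemma perm_elt_mult:
  assumes g: "g \<in> signed_perms n" and h: "h \<in> signed_perms n"
  shows "perm_elt n g \<otimes>\<^bsub>IB n\<^esub> perm_elt n h = perm_elt n (h \<circ> g)"
proof -
  have "{(x, g x) |x. x \<in> signed_set n} O {(x, h x) |x. x \<in> signed_set n} =
      {(x, (h \<circ> g) x) |x. x \<in> signed_set n}"
    using signed_permsD(3)[OF g] by auto
  then show ?thesis unfolding perm_elt_def using g h by (simp add: IB_mult perm_rel_in_ess)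
qed

definition inv_equiv_elt :: "nat \<Rightarrow> (int \<times> int) set \<Rightarrow> (int \<times> int) set set" where
  "inv_equiv_elt n P = IB_class n (inv_equiv n P)"

lemma inv_equiv_in_ess: "inv_equiv n P \<in> ess n"
  by (rule essI) (auto dest: inv_equiv_in intro: inv_equiv.neg inv_equiv.refl)

lemma inv_equiv_elt_in: "inv_equiv_elt n P \<in> carrier (IB n)"
  by (simp add: inv_equiv_elt_def inv_equiv_in_ess)

lemma inv_equiv_difunctional: "difunctional (inv_equiv n P)"
  unfolding difunctional_def by (blast intro: inv_equiv.sym inv_equiv.trans)

lemma inv_equiv_elt_empty: "inv_equiv_elt n {} = \<one>\<^bsub>IB n\<^esub>"
  by (simp add: inv_equiv_elt_def inv_equiv_empty IB_one)

text \<open>The completion of a product of two equivalence relations is difunctional and reflexive,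
  hence an equivalence relation, namely the join.\<close>

lemma inv_equiv_elt_mult: "inv_equiv_elt n P \<otimes>\<^bsub>IB n\<^esub> inv_equiv_elt n Q = inv_equiv_elt n (P \<union> Q)"
proof -
  let ?D = "bip_completion (inv_equiv n P O inv_equiv n Q)"
  note D = difunctionalD[OF completion_difunctional[of "inv_equiv n P O inv_equiv n Q"]]
  have in_ess: "inv_equiv n P O inv_equiv n Q \<in> ess n"
    by (intro ess_comp inv_equiv_in_ess)
  have "inv_equiv n P \<subseteq> inv_equiv n P O inv_equiv n Q"
    by (auto dest: inv_equiv_in intro!: relcompI inv_equiv.refl)
  then have P: "inv_equiv n P \<subseteq> ?D" using completion_incl by (rule order_trans)
  have "inv_equiv n Q \<subseteq> inv_equiv n P O inv_equiv n Q"
    by (auto dest: inv_equiv_in intro!: relcompI inv_equiv.refl)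
  then have Q: "inv_equiv n Q \<subseteq> ?D" using completion_incl by (rule order_trans)
  have "inv_equiv n (P \<union> Q) \<subseteq> ?D"
  proof (rule subrelI)
    fix x y assume "(x, y) \<in> inv_equiv n (P \<union> Q)"
    then show "(x, y) \<in> ?D"
    proof induction
      case (base x y)
      then show ?case using P Q by (blast intro: inv_equiv.base)
    next
      case (neg x y)
      then show ?case using essD(3)[OF ess_completion[OF in_ess]] by blast
    next
      case (refl x)
      then show ?case using P by (blast intro: inv_equiv.refl)
    next
      case (sym x y)
      then have "(x, x) \<in> ?D" "(y, y) \<in> ?D"
        using P inv_equiv_in[OF sym(1)] by (blast intro: inv_equiv.refl)+
      then show ?case using D sym by blast
    next
      case (trans x y z)
      then have "(y, y) \<in> ?D"
        using P inv_equiv_in[OF trans(1)] by (blast intro: inv_equiv.refl)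
      then show ?case using D trans by blast
    qed
  qed
  moreover have "?D \<subseteq> inv_equiv n (P \<union> Q)"
    using inv_equiv_mono[of P "P \<union> Q" n] inv_equiv_mono[of Q "P \<union> Q" n]
    by (intro completion_least inv_equiv_difunctional) (blast intro: inv_equiv.trans)
  ultimately have "?D = inv_equiv n (P \<union> Q)" by blast
  also have "\<dots> = bip_completion (inv_equiv n (P \<union> Q))"
    by (rule completion_of_difunctional[OF inv_equiv_difunctional, symmetric])
  finally have "?D = bip_completion (inv_equiv n (P \<union> Q))" .
  then show ?thesis
    using in_ess by (simp add: inv_equiv_elt_def IB_mult inv_equiv_in_ess IB_class_eq_iff)
qed

lemma perm_elt_inv_equiv_elt:
  assumes g: "g \<in> signed_perms n"
  shows "perm_elt n g \<otimes>\<^bsub>IB n\<^esub> inv_equiv_elt n P =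
    inv_equiv_elt n (map_prod (inv g) (inv g) ` P) \<otimes>\<^bsub>IB n\<^esub> perm_elt n g"
proof -
  let ?g = "{(x, g x) |x. x \<in> signed_set n}" and ?Q = "map_prod (inv g) (inv g) ` P"
  have Q: "(x, y) \<in> inv_equiv n ?Q \<longleftrightarrow> (g x, g y) \<in> inv_equiv n P" for x y
    using inv_equiv_image_iff[OF signed_perms_inv[OF g], of x y P] signed_permsD(1)[OF g]
    by (simp add: inv_inv_eq permutes_bij)
  have "?g O inv_equiv n P = inv_equiv n ?Q O ?g"
  proof (rule Set.set_eqI)
    fix p
    obtain x z :: int where p: "p = (x, z)" by fastforce
    have "(x, z) \<in> ?g O inv_equiv n P \<longleftrightarrow> (g x, z) \<in> inv_equiv n P"
      using inv_equiv_in signed_permsD(3)[OF g] by blast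
    moreover have "(x, z) \<in> inv_equiv n ?Q O ?g \<longleftrightarrow> (x, inv g z) \<in> inv_equiv n ?Q"
    proof
      assume "(x, z) \<in> inv_equiv n ?Q O ?g"
      then show "(x, inv g z) \<in> inv_equiv n ?Q" using signed_permsD(7)[OF g] by auto
    next
      assume *: "(x, inv g z) \<in> inv_equiv n ?Q"
      then have "(inv g z, g (inv g z)) \<in> ?g" using inv_equiv_in by blast
      with * show "(x, z) \<in> inv_equiv n ?Q O ?g" using signed_permsD(6)[OF g] by auto
    qed
    ultimately show "p \<in> ?g O inv_equiv n P \<longleftrightarrow> p \<in> inv_equiv n ?Q O ?g"
      using Q signed_permsD(6)[OF g] by (simp add: p)
  qed
  then show ?thesis
    unfolding perm_elt_def inv_equiv_elt_def
    using perm_rel_in_ess[OF g] by (simp add: IB_mult inv_equiv_in_ess)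
qed

section \<open>Units and idempotents\<close>

text \<open>If both products of \<open>\<rho>\<close> and \<open>\<tau>\<close> are contained in the identity, then \<open>\<rho>\<close> is the graph of a
  bijection, as all points occur on both sides of \<open>\<tau>\<close>.\<close>

lemma IB_Units: "Units (IB n) = perm_elt n ` signed_perms n"
proof (intro subset_antisym subsetI)
  fix U assume "U \<in> perm_elt n ` signed_perms n"
  then obtain g where g: "g \<in> signed_perms n" "U = perm_elt n g" by blast
  then have "perm_elt n (inv g) \<otimes>\<^bsub>IB n\<^esub> U = \<one>\<^bsub>IB n\<^esub>" "U \<otimes>\<^bsub>IB n\<^esub> perm_elt n (inv g) = \<one>\<^bsub>IB n\<^esub>"
    by (simp_all add: perm_elt_mult signed_perms_inv signed_perms_inv_comp perm_elt_id)
  then show "U \<in> Units (IB n)"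
    using g perm_elt_in[OF g(1)] perm_elt_in[OF signed_perms_inv[OF g(1)]] unfolding Units_def by
        blast
next
  fix U assume "U \<in> Units (IB n)"
  then obtain V where UV: "U \<in> carrier (IB n)" "V \<in> carrier (IB n)"
      "V \<otimes>\<^bsub>IB n\<^esub> U = \<one>\<^bsub>IB n\<^esub>" "U \<otimes>\<^bsub>IB n\<^esub> V = \<one>\<^bsub>IB n\<^esub>"
    unfolding Units_def by blast
  then obtain \<rho> \<tau> where \<rho>: "\<rho> \<in> ess n" "U = IB_class n \<rho>" and \<tau>: "\<tau> \<in> ess n" "V = IB_class n \<tau>"
    unfolding IB_carrier by blast
  have "difunctional (Id_on (signed_set n))" unfolding difunctional_def by auto
  then have "bip_completion (\<tau> O \<rho>) = Id_on (signed_set n)"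
      "bip_completion (\<rho> O \<tau>) = Id_on (signed_set n)"
    using UV(3,4) \<rho> \<tau> by (simp_all add: IB_mult IB_one IB_class_eq_iff ess_comp ess_Id
        completion_of_difunctional)
  then have Id: "\<tau> O \<rho> \<subseteq> Id" "\<rho> O \<tau> \<subseteq> Id"
    using completion_incl[of "\<tau> O \<rho>"] completion_incl[of "\<rho> O \<tau>"] by auto
  have func: "y = y'" if xy: "(x, y) \<in> \<rho>" "(x, y') \<in> \<rho>" for x y y'
  proof -
    obtain z where "(z, x) \<in> \<tau>" using essD(5)[OF \<tau>(1)] essD(1)[OF \<rho>(1) xy(1)] by blast
    then show ?thesis using Id(1) xy by blast
  qed
  have inj: "x = x'" if xy: "(x, y) \<in> \<rho>" "(x', y) \<in> \<rho>" for x x' y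
  proof -
    obtain z where "(y, z) \<in> \<tau>" using essD(4)[OF \<tau>(1)] essD(2)[OF \<rho>(1) xy(1)] by blast
    then show ?thesis using Id(2) xy by blast
  qed
  define g where "g x = (if x \<in> signed_set n then THE y. (x, y) \<in> \<rho> else x)" for x
  have g: "(x, y) \<in> \<rho> \<longleftrightarrow> y = g x" if x: "x \<in> signed_set n" for x y
  proof -
    obtain z where z: "(x, z) \<in> \<rho>" using essD(4)[OF \<rho>(1) x] by blast
    have "(THE y. (x, y) \<in> \<rho>) = z" using z by (rule the_equality) (rule func[OF z, symmetric])
    then have "g x = z" using x by (simp add: g_def)
    then show ?thesis using z func[OF z, of y] by blast
  qed
  have "(x, y) \<in> \<rho> \<longleftrightarrow> x \<in> signed_set n \<and> y = g x" for x y
    using g[of x y] essD(1)[OF \<rho>(1), of x y] by blast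
  then have "\<rho> = {(x, g x) |x. x \<in> signed_set n}" by auto
  then have U: "U = perm_elt n g" using \<rho>(2) by (simp add: perm_elt_def)
  have "bij_betw g (signed_set n) (signed_set n)"
  proof (rule bij_betw_imageI)
    show "inj_on g (signed_set n)"
    proof (rule inj_onI)
      fix x y assume xy: "x \<in> signed_set n" "y \<in> signed_set n" "g x = g y"
      then have "(x, g x) \<in> \<rho>" "(y, g x) \<in> \<rho>" using g[of x] g[of y] by simp_all
      then show "x = y" by (rule inj)
    qed
    show "g ` signed_set n = signed_set n"
    proof (intro subset_antisym subsetI)
      fix y assume "y \<in> g ` signed_set n"
      then obtain x where "x \<in> signed_set n" "y = g x" by blast
      then have "(x, y) \<in> \<rho>" using g[of x] by simp
      then show "y \<in> signed_set n" by (rule essD(2)[OF \<rho>(1)])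
    next
      fix y assume "y \<in> signed_set n"
      then obtain x where x: "(x, y) \<in> \<rho>" using essD(5)[OF \<rho>(1)] by blast
      have "x \<in> signed_set n" by (rule essD(1)[OF \<rho>(1) x])
      then show "y \<in> g ` signed_set n" using g[of x y] x by blast
    qed
  qed
  then have "g permutes signed_set n" by (rule bij_imp_permutes) (simp add: g_def)
  moreover have "g (- x) = - g x" for x
  proof (cases "x \<in> signed_set n")
    case True
    then have "(x, g x) \<in> \<rho>" using g[of x "g x"] by simp
    then have "(- x, - g x) \<in> \<rho>" by (rule essD(3)[OF \<rho>(1)])
    then show ?thesis using g[of "- x"] True by simp
  next
    case False then show ?thesis by (simp add: g_def)
  qed
  ultimately show "U \<in> perm_elt n ` signed_perms n" using U by (simp add: signed_perms_def)
qed

text \<open>The completion of an idempotent is transitive. Together with difunctionality, and since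
  every point occurs on both sides, this makes it reflexive and symmetric.\<close>

lemma IB_idempotents:
  "{\<xi> \<in> carrier (IB n). \<xi> \<otimes>\<^bsub>IB n\<^esub> \<xi> = \<xi>} = range (inv_equiv_elt n)"
proof (intro subset_antisym subsetI)
  fix \<xi> assume "\<xi> \<in> range (inv_equiv_elt n)"
  then show "\<xi> \<in> {\<xi> \<in> carrier (IB n). \<xi> \<otimes>\<^bsub>IB n\<^esub> \<xi> = \<xi>}"
    by (auto simp: inv_equiv_elt_mult inv_equiv_elt_in)
next
  fix \<xi> assume "\<xi> \<in> {\<xi> \<in> carrier (IB n). \<xi> \<otimes>\<^bsub>IB n\<^esub> \<xi> = \<xi>}"
  then obtain \<rho> where \<rho>: "\<rho> \<in> ess n" "\<xi> = IB_class n \<rho>" and idem: "\<xi> \<otimes>\<^bsub>IB n\<^esub> \<xi> = \<xi>"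
    by (auto simp: IB_carrier)
  let ?K = "bip_completion \<rho>"
  note D = difunctionalD[OF completion_difunctional[of \<rho>]]
  note K = essD[OF ess_completion[OF \<rho>(1)]]
  have "bip_completion (\<rho> O \<rho>) = ?K"
    using idem \<rho> by (simp add: IB_mult IB_class_eq_iff ess_comp)
  then have trans: "(x, z) \<in> ?K" if "(x, y) \<in> ?K" "(y, z) \<in> ?K" for x y z
    using completion_comp[OF \<rho>(1) \<rho>(1)] completion_incl[of "?K O ?K"] that by blast
  have refl: "(x, x) \<in> ?K" if x: "x \<in> signed_set n" for x
  proof -
    obtain y w where "(x, y) \<in> ?K" "(w, x) \<in> ?K" using K(4,5) x by blast
    then show ?thesis using trans D by blast
  qed
  have sym: "(y, x) \<in> ?K" if "(x, y) \<in> ?K" for x y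
    using D[of y y x x] refl K(1,2) that by blast
  have "inv_equiv n ?K \<subseteq> ?K"
  proof (rule subrelI)
    fix x y assume "(x, y) \<in> inv_equiv n ?K"
    then show "(x, y) \<in> ?K" by induction (use refl sym trans K(3) in blast)+
  qed
  moreover have "?K \<subseteq> inv_equiv n ?K" using K(1,2) by (auto intro: inv_equiv.base)
  ultimately have "inv_equiv n ?K = ?K" by blast
  then have "\<xi> = inv_equiv_elt n ?K"
    using \<rho> by (simp add: inv_equiv_elt_def IB_class_eq_iff ess_completion
        completion_of_difunctional completion_difunctional)
  then show "\<xi> \<in> range (inv_equiv_elt n)" by blast
qed

section \<open>Normal forms in the factorizable part\<close>

lemma FB_carrier:
  "carrier (FB n) = {inv_equiv_elt n P \<otimes>\<^bsub>IB n\<^esub> perm_elt n g | P g. g \<in> signed_perms n}"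
proof -
  have "carrier (FB n) = {\<sigma> \<otimes>\<^bsub>IB n\<^esub> \<xi> | \<sigma> \<xi>. \<sigma> \<in> Units (IB n) \<and>
      \<xi> \<in> {\<xi> \<in> carrier (IB n). \<xi> \<otimes>\<^bsub>IB n\<^esub> \<xi> = \<xi>}}"
    by (simp add: FB_def)
  also have "\<dots> = {perm_elt n g \<otimes>\<^bsub>IB n\<^esub> inv_equiv_elt n P | g P. g \<in> signed_perms n}"
    unfolding IB_Units IB_idempotents by blast
  also have "\<dots> = {inv_equiv_elt n P \<otimes>\<^bsub>IB n\<^esub> perm_elt n g | P g. g \<in> signed_perms n}"
  proof (intro subset_antisym subsetI)
    fix a assume "a \<in> {perm_elt n g \<otimes>\<^bsub>IB n\<^esub> inv_equiv_elt n P | g P. g \<in> signed_perms n}"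
    then show "a \<in> {inv_equiv_elt n P \<otimes>\<^bsub>IB n\<^esub> perm_elt n g | P g. g \<in> signed_perms n}"
      using perm_elt_inv_equiv_elt by blast
  next
    fix a assume "a \<in> {inv_equiv_elt n P \<otimes>\<^bsub>IB n\<^esub> perm_elt n g | P g. g \<in> signed_perms n}"
    then obtain P g where g: "g \<in> signed_perms n" and a:
        "a = inv_equiv_elt n P \<otimes>\<^bsub>IB n\<^esub> perm_elt n g"
      by blast
    have "map_prod (inv g) (inv g) ` (map_prod g g ` P) = P"
      by (simp add: image_image map_prod_def case_prod_unfold signed_permsD(7)[OF g])
    then have "a = perm_elt n g \<otimes>\<^bsub>IB n\<^esub> inv_equiv_elt n (map_prod g g ` P)"
      using perm_elt_inv_equiv_elt[OF g, of "map_prod g g ` P"] a by simp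
    then show "a \<in> {perm_elt n g \<otimes>\<^bsub>IB n\<^esub> inv_equiv_elt n P | g P. g \<in> signed_perms n}"
      using g by blast
  qed
  finally show ?thesis .
qed

lemma normal_form_mult:
  assumes g: "g \<in> signed_perms n" and h: "h \<in> signed_perms n"
  shows "(inv_equiv_elt n P \<otimes>\<^bsub>IB n\<^esub> perm_elt n g) \<otimes>\<^bsub>IB n\<^esub> (inv_equiv_elt n Q \<otimes>\<^bsub>IB n\<^esub> perm_elt n h) =
    inv_equiv_elt n (P \<union> map_prod (inv g) (inv g) ` Q) \<otimes>\<^bsub>IB n\<^esub> perm_elt n (h \<circ> g)"
proof -
  interpret IB: monoid "IB n" by (rule IB_monoid)
  let ?Q = "map_prod (inv g) (inv g) ` Q"
  note closed = inv_equiv_elt_in perm_elt_in[OF g] perm_elt_in[OF h]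
  have "(inv_equiv_elt n P \<otimes>\<^bsub>IB n\<^esub> perm_elt n g) \<otimes>\<^bsub>IB n\<^esub> (inv_equiv_elt n Q \<otimes>\<^bsub>IB n\<^esub> perm_elt n h) =
      inv_equiv_elt n P \<otimes>\<^bsub>IB n\<^esub> (perm_elt n g \<otimes>\<^bsub>IB n\<^esub> inv_equiv_elt n Q) \<otimes>\<^bsub>IB n\<^esub> perm_elt n h"
    using closed by (simp add: IB.m_assoc)
  also have "\<dots> = (inv_equiv_elt n P \<otimes>\<^bsub>IB n\<^esub> inv_equiv_elt n ?Q) \<otimes>\<^bsub>IB n\<^esub> (perm_elt n g \<otimes>\<^bsub>IB n\<^esub>
      perm_elt n h)"
    unfolding perm_elt_inv_equiv_elt[OF g] using closed by (simp add: IB.m_assoc)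
  finally show ?thesis by (simp add: inv_equiv_elt_mult perm_elt_mult g h)
qed

text \<open>Both sides are represented by difunctional relations, which therefore coincide. A relation
  \<open>R\<close> obtained from an equivalence relation by applying a bijection on the right gives the
  equivalence relation back as \<open>R O R\<inverse>\<close>.\<close>

lemma normal_form_eq_iff:
  assumes g: "g \<in> signed_perms n" and h: "h \<in> signed_perms n"
  shows "inv_equiv_elt n P \<otimes>\<^bsub>IB n\<^esub> perm_elt n g = inv_equiv_elt n Q \<otimes>\<^bsub>IB n\<^esub> perm_elt n h \<longleftrightarrow>
    inv_equiv n P = inv_equiv n Q \<and> (\<forall>x\<in>signed_set n. (x, inv g (h x)) \<in> inv_equiv n P)"
proof -
  define R :: "(int \<times> int) set \<Rightarrow> (int \<Rightarrow> int) \<Rightarrow> (int \<times> int) set" where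
      "R P g = inv_equiv n P O {(x, g x) |x. x \<in> signed_set n}" for P g
  have R: "(x, z) \<in> R P g \<longleftrightarrow> (x, inv g z) \<in> inv_equiv n P" if "g \<in> signed_perms n" for x z P g
  proof
    assume "(x, z) \<in> R P g"
    then show "(x, inv g z) \<in> inv_equiv n P" using signed_permsD(7)[OF that] by (auto simp: R_def)
  next
    assume *: "(x, inv g z) \<in> inv_equiv n P"
    then have "(inv g z, g (inv g z)) \<in> {(x, g x) |x. x \<in> signed_set n}" using inv_equiv_in by blast
    with * show "(x, z) \<in> R P g" using signed_permsD(6)[OF that] by (auto simp: R_def)
  qed
  have difun: "difunctional (R P g)" if "g \<in> signed_perms n" for P g
    using difunctionalD[OF inv_equiv_difunctional[of n P]] R[OF that]
    unfolding difunctional_def by blast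
  have R_ess: "R P g \<in> ess n" if "g \<in> signed_perms n" for P g
    unfolding R_def using that by (intro ess_comp inv_equiv_in_ess perm_rel_in_ess)
  have elt: "inv_equiv_elt n P \<otimes>\<^bsub>IB n\<^esub> perm_elt n g = IB_class n (R P g)" if "g \<in> signed_perms n"
      for P g
    using that by (simp add: inv_equiv_elt_def perm_elt_def IB_mult inv_equiv_in_ess
        perm_rel_in_ess R_def)
  have "inv_equiv_elt n P \<otimes>\<^bsub>IB n\<^esub> perm_elt n g = inv_equiv_elt n Q \<otimes>\<^bsub>IB n\<^esub> perm_elt n h \<longleftrightarrow> R P g =
      R Q h"
    using g h by (simp add: elt IB_class_eq_iff R_ess completion_of_difunctional difun)
  also have "\<dots> \<longleftrightarrow> inv_equiv n P = inv_equiv n Q \<and> (\<forall>x\<in>signed_set n. (x, inv g (h x)) \<in> inv_equiv n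
      P)"
  proof (intro iffI conjI ballI; (elim conjE)?)
    assume eq: "R P g = R Q h"
    have kernel: "inv_equiv n P = R P g O (R P g)\<inverse>" if "g \<in> signed_perms n" for P g
    proof (rule Set.set_eqI)
      fix p :: "int \<times> int"
      obtain x y where p: "p = (x, y)" by fastforce
      have "(x, y) \<in> inv_equiv n P \<longleftrightarrow> (\<exists>z. (x, inv g z) \<in> inv_equiv n P \<and> (y, inv g z) \<in> inv_equiv
          n P)"
      proof
        assume xy: "(x, y) \<in> inv_equiv n P"
        then have "(y, y) \<in> inv_equiv n P" using inv_equiv_in[OF xy] by (blast intro:
            inv_equiv.refl)
        with xy show "\<exists>z. (x, inv g z) \<in> inv_equiv n P \<and> (y, inv g z) \<in> inv_equiv n P"
          using signed_permsD(7)[OF that, of y] by (intro exI[of _ "g y"]) simp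
      qed (blast intro: inv_equiv.sym inv_equiv.trans)
      then show "p \<in> inv_equiv n P \<longleftrightarrow> p \<in> R P g O (R P g)\<inverse>"
        unfolding p relcomp_unfold converse_iff mem_Collect_eq case_prod_conv R[OF that] by simp
    qed
    show "inv_equiv n P = inv_equiv n Q" using kernel[OF g] kernel[OF h] eq by simp
    fix x assume x: "x \<in> signed_set n"
    then have "(x, h x) \<in> R Q h" using R[OF h] signed_permsD(7)[OF h] by (simp add: inv_equiv.refl)
    then have "(x, h x) \<in> R P g" by (simp only: eq)
    then show "(x, inv g (h x)) \<in> inv_equiv n P" by (simp only: R[OF g])
  next
    assume PQ: "inv_equiv n P = inv_equiv n Q" and rel:
        "\<forall>x\<in>signed_set n. (x, inv g (h x)) \<in> inv_equiv n P"
    show "R P g = R Q h"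
    proof (rule Set.set_eqI)
      fix p :: "int \<times> int"
      obtain x z where p: "p = (x, z)" by fastforce
      have hg: "(inv h z, inv g z) \<in> inv_equiv n P" if "z \<in> signed_set n"
        using bspec[OF rel, of "inv h z"] signed_permsD(3)[OF signed_perms_inv[OF h]]
            signed_permsD(6)[OF h] that
        by simp
      have "(x, inv g z) \<in> inv_equiv n P \<longleftrightarrow> (x, inv h z) \<in> inv_equiv n P"
      proof (cases "z \<in> signed_set n")
        case True
        then show ?thesis using hg by (blast intro: inv_equiv.sym inv_equiv.trans)
      next
        case False
        then have "inv g z \<notin> signed_set n" "inv h z \<notin> signed_set n"
          using signed_permsD(3)[OF signed_perms_inv[OF g]] signed_permsD(3)[OF
              signed_perms_inv[OF h]] by simp_all
        then show ?thesis using inv_equiv_in by blast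
      qed
      then show "p \<in> R P g \<longleftrightarrow> p \<in> R Q h" using R[OF g] R[OF h] PQ by (simp add: p)
    qed
  qed
  finally show ?thesis .
qed

lemma FB_mult [simp]: "x \<otimes>\<^bsub>FB n\<^esub> y = x \<otimes>\<^bsub>IB n\<^esub> y" and FB_one [simp]: "\<one>\<^bsub>FB n\<^esub> = \<one>\<^bsub>IB n\<^esub>"
  by (simp_all add: FB_def)

lemma FB_subset: "carrier (FB n) \<subseteq> carrier (IB n)"
proof -
  interpret IB: monoid "IB n" by (rule IB_monoid)
  show ?thesis by (auto simp: FB_carrier intro!: IB.m_closed inv_equiv_elt_in perm_elt_in)
qed

lemma perm_elt_in_FB: "g \<in> signed_perms n \<Longrightarrow> perm_elt n g \<in> carrier (FB n)"
proof -
  assume g: "g \<in> signed_perms n"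
  interpret IB: monoid "IB n" by (rule IB_monoid)
  have "perm_elt n g = inv_equiv_elt n {} \<otimes>\<^bsub>IB n\<^esub> perm_elt n g"
    using g by (simp add: inv_equiv_elt_empty perm_elt_in)
  then show ?thesis using g by (auto simp: FB_carrier)
qed

lemma inv_equiv_elt_in_FB: "inv_equiv_elt n P \<in> carrier (FB n)"
proof -
  interpret IB: monoid "IB n" by (rule IB_monoid)
  have "inv_equiv_elt n P = inv_equiv_elt n P \<otimes>\<^bsub>IB n\<^esub> perm_elt n id"
    by (simp add: perm_elt_id inv_equiv_elt_in)
  then show ?thesis unfolding FB_carrier using signed_perms_id by blast
qed

lemma FB_monoid: "monoid (FB n)"
proof -
  interpret IB: monoid "IB n" by (rule IB_monoid)
  show ?thesis
  proof (rule monoidI)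
    fix x y assume "x \<in> carrier (FB n)" "y \<in> carrier (FB n)"
    then obtain P g Q h where g: "g \<in> signed_perms n" and h: "h \<in> signed_perms n"
      and "x = inv_equiv_elt n P \<otimes>\<^bsub>IB n\<^esub> perm_elt n g" "y = inv_equiv_elt n Q \<otimes>\<^bsub>IB n\<^esub> perm_elt n h"
      unfolding FB_carrier by blast
    then have "x \<otimes>\<^bsub>FB n\<^esub> y =
        inv_equiv_elt n (P \<union> map_prod (inv g) (inv g) ` Q) \<otimes>\<^bsub>IB n\<^esub> perm_elt n (h \<circ> g)"
      by (simp only: FB_mult normal_form_mult)
    then show "x \<otimes>\<^bsub>FB n\<^esub> y \<in> carrier (FB n)"
      unfolding FB_carrier using signed_perms_comp[OF g h] by blast
  next
    show "\<one>\<^bsub>FB n\<^esub> \<in> carrier (FB n)"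
      using perm_elt_in_FB[OF signed_perms_id] by (simp only: perm_elt_id FB_one)
  next
    fix x y z assume "x \<in> carrier (FB n)" "y \<in> carrier (FB n)" "z \<in> carrier (FB n)"
    then have "x \<in> carrier (IB n)" "y \<in> carrier (IB n)" "z \<in> carrier (IB n)" using FB_subset by
        blast+
    then show "x \<otimes>\<^bsub>FB n\<^esub> y \<otimes>\<^bsub>FB n\<^esub> z = x \<otimes>\<^bsub>FB n\<^esub> (y \<otimes>\<^bsub>FB n\<^esub> z)"
      by (simp add: IB.m_assoc)
  next
    fix x assume "x \<in> carrier (FB n)"
    then have "x \<in> carrier (IB n)" using FB_subset by blast
    then show "\<one>\<^bsub>FB n\<^esub> \<otimes>\<^bsub>FB n\<^esub> x = x" "x \<otimes>\<^bsub>FB n\<^esub> \<one>\<^bsub>FB n\<^esub> = x" by simp_all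
  qed
qed

section \<open>Values of words\<close>

lemma s_elt_eq: "i < n \<Longrightarrow> s_elt n i = perm_elt n (sgen i)"
proof -
  have "(if i = 0 then transpose 1 (- 1)
      else transpose (int i) (int i + 1) \<circ> transpose (- int i) (- (int i + 1))) = sgen i"
    by (rule ext) (simp add: transpose_def sgen_def sreflect_def lo_def)
  then show ?thesis by (simp add: s_elt_def)
qed

text \<open>The classes of the pair and of its negative coincide for \<open>i = 0\<close> and are disjoint otherwise,
  so their union with the identity is already transitive.\<close>

lemma xi_elt_eq:
  assumes i: "i < n"
  shows "xi_elt n i = inv_equiv_elt n {(lo i, hi i)}"
proof -
  define \<C> :: "int set set" where
    "\<C> = (if i = 0 then {{1, - 1}} else {{int i, int i + 1}, {- int i, - (int i + 1)}})"
  have \<C>: "(x, y) \<in> (\<Union>C\<in>\<C>. C \<times> C) \<longleftrightarrow> {x, y} \<subseteq> {lo i, hi i} \<or> {x, y} \<subseteq> {- lo i, - hi i}" for x y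
    by (auto simp: \<C>_def lo_def)
  have lohi: "lo i \<in> signed_set n" "hi i \<in> signed_set n" using i by (rule lo_in, rule hi_in)
  have blocks: "{lo i, hi i} = {- lo i, - hi i} \<or> {lo i, hi i} \<inter> {- lo i, - hi i} = {}"
    by (cases "i = 0") (auto simp: lo_def)
  let ?P = "{(lo i, hi i)}"
  have lh: "(lo i, hi i) \<in> inv_equiv n ?P" using lohi by (intro inv_equiv.base) auto
  have "Id_on (signed_set n) \<union> (\<Union>C\<in>\<C>. C \<times> C) = inv_equiv n ?P"
  proof (intro subset_antisym subrelI)
    fix x y assume "(x, y) \<in> Id_on (signed_set n) \<union> (\<Union>C\<in>\<C>. C \<times> C)"
    then have "x = y \<and> x \<in> signed_set n \<or> {x, y} \<subseteq> {lo i, hi i} \<or> {x, y} \<subseteq> {- lo i, - hi i}"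
      using \<C> by blast
    then show "(x, y) \<in> inv_equiv n ?P"
    proof (elim disjE conjE)
      assume "{x, y} \<subseteq> {lo i, hi i}"
      then show ?thesis using lh lohi by (auto intro: inv_equiv.refl inv_equiv.sym)
    next
      assume "{x, y} \<subseteq> {- lo i, - hi i}"
      moreover have "- lo i \<in> signed_set n" "- hi i \<in> signed_set n" using lohi by (simp_all only:
          uminus_signed_set)
      ultimately show ?thesis
        using inv_equiv.neg[OF lh] inv_equiv.sym[OF inv_equiv.neg[OF lh]] inv_equiv.refl[of _ n ?P]
        by (simp only: insert_subset insert_iff empty_iff) blast
    qed (auto intro: inv_equiv.refl)
  next
    fix x y assume "(x, y) \<in> inv_equiv n ?P"
    then have "x \<in> signed_set n \<and> (x = y \<or> {x, y} \<subseteq> {lo i, hi i} \<or> {x, y} \<subseteq> {- lo i, - hi i})"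
    proof induction
      case (trans x y z)
      let ?A = "{lo i, hi i}" and ?B = "{- lo i, - hi i}"
      from trans.IH consider "x = y \<or> y = z" | "{x, y} \<subseteq> ?A" "{y, z} \<subseteq> ?A"
        | "{x, y} \<subseteq> ?B" "{y, z} \<subseteq> ?B" | "y \<in> ?A \<inter> ?B" "{x, y, z} \<subseteq> ?A \<union> ?B" by blast
      then show ?case
      proof cases
        case 4
        then have "?A = ?B" using blocks by blast
        then have "{x, z} \<subseteq> ?A" using 4(2) by blast
        then show ?thesis using trans.IH by blast
      qed (use trans.IH in auto)
    qed (use lohi in \<open>auto simp: signed_set_def\<close>)
    then show "(x, y) \<in> Id_on (signed_set n) \<union> (\<Union>C\<in>\<C>. C \<times> C)"
      using \<C> by (auto simp: Id_on_iff)
  qed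
  then show ?thesis by (simp add: xi_elt_def equiv_elt_def inv_equiv_elt_def \<C>_def)
qed

lemma letter_elt_in_FB: "l \<in> alphabet n \<Longrightarrow> letter_elt n l \<in> carrier (FB n)"
  by (auto simp: alphabet_def s_elt_eq xi_elt_eq perm_elt_in_FB sgen_signed_perms
      inv_equiv_elt_in_FB)

abbreviation FB_eval :: "nat \<Rightarrow> letter list \<Rightarrow> (int \<times> int) set set" where
  "FB_eval n \<equiv> word_eval (FB n) (letter_elt n)"

lemma FB_eval_in: "u \<in> lists (alphabet n) \<Longrightarrow> FB_eval n u \<in> carrier (FB n)"
proof -
  interpret FB: monoid "FB n" by (rule FB_monoid)
  show "u \<in> lists (alphabet n) \<Longrightarrow> FB_eval n u \<in> carrier (FB n)"
    by (induction u) (use FB.m_closed letter_elt_in_FB in \<open>auto simp: word_eval_def simp del: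
        FB_mult FB_one\<close>)
qed

lemma FB_eval_append:
  assumes "u \<in> lists (alphabet n)" "v \<in> lists (alphabet n)"
  shows "FB_eval n (u @ v) = FB_eval n u \<otimes>\<^bsub>FB n\<^esub> FB_eval n v"
proof -
  interpret FB: monoid "FB n" by (rule FB_monoid)
  show ?thesis
    using assms(1)
  proof (induction u)
    case Nil
    then show ?case using FB_eval_in[OF assms(2)] FB.l_one by (simp add: word_eval_def del:
        FB_mult FB_one)
  next
    case (Cons l u)
    then show ?case
      using FB.m_assoc[OF letter_elt_in_FB[of l] FB_eval_in[of u] FB_eval_in[OF assms(2)]]
      by (simp add: word_eval_def del: FB_mult FB_one)
  qed
qed

lemma FB_eval_nf:
  assumes "u \<in> lists (alphabet n)" "nf u = (ps, g)"
  shows "FB_eval n u = inv_equiv_elt n (set ps) \<otimes>\<^bsub>IB n\<^esub> perm_elt n g"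
  using assms
proof (induction u arbitrary: ps g rule: rev_induct)
  case Nil
  interpret IB: monoid "IB n" by (rule IB_monoid)
  have ps: "ps = []" and g: "g = id" using Nil by simp_all
  have "FB_eval n [] = \<one>\<^bsub>IB n\<^esub>" by (simp add: word_eval_def)
  moreover have "inv_equiv_elt n {} \<otimes>\<^bsub>IB n\<^esub> perm_elt n id = \<one>\<^bsub>IB n\<^esub>"
    by (simp only: inv_equiv_elt_empty perm_elt_id IB.l_one IB.one_closed)
  ultimately show ?case by (simp only: ps g list.set)
next
  case (snoc l u)
  interpret IB: monoid "IB n" by (rule IB_monoid)
  obtain qs h where u: "nf u = (qs, h)" by fastforce
  have uA: "u \<in> lists (alphabet n)" and lA: "l \<in> alphabet n" using snoc.prems by auto
  have h: "h \<in> signed_perms n" using nf_in[OF uA u] by simp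
  have "FB_eval n [l] = letter_elt n l"
    using letter_elt_in_FB[OF lA] FB_subset[of n] by (auto simp: word_eval_def)
  then have step: "FB_eval n (u @ [l]) =
      (inv_equiv_elt n (set qs) \<otimes>\<^bsub>IB n\<^esub> perm_elt n h) \<otimes>\<^bsub>IB n\<^esub> letter_elt n l"
    using FB_eval_append[of u n "[l]"] uA lA snoc.IH[OF uA u] by simp
  from lA consider i where "l = S i" "i < n" | i where "l = Xi i" "i < n" by (auto simp:
      alphabet_def)
  then show ?case
  proof cases
    case 1
    have "letter_elt n l = inv_equiv_elt n {} \<otimes>\<^bsub>IB n\<^esub> perm_elt n (sgen i)"
      using 1 by (simp add: s_elt_eq inv_equiv_elt_empty perm_elt_in sgen_signed_perms)
    then show ?thesis
      using step normal_form_mult[OF h sgen_signed_perms[OF 1(2)], of "set qs" "{}"] snoc.prems(2)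
          u 1
      by (auto simp: nf_snoc)
  next
    case 2
    have "letter_elt n l = inv_equiv_elt n {(lo i, hi i)} \<otimes>\<^bsub>IB n\<^esub> perm_elt n id"
      using 2 by (simp add: xi_elt_eq inv_equiv_elt_in perm_elt_id)
    then show ?thesis
      using step normal_form_mult[OF h signed_perms_id, of "set qs" "{(lo i, hi i)}"]
          snoc.prems(2) u 2
      by (auto simp: nf_snoc)
  qed
qed

subsection \<open>Generation\<close>

lemma map_S_in: "w \<in> lists {..<n} \<Longrightarrow> map S w \<in> lists (alphabet n)"
  by (auto simp: alphabet_def)

lemma Xi_in: "i < n \<Longrightarrow> [Xi i] \<in> lists (alphabet n)"
  by (auto simp: alphabet_def)

lemma FB_eval_map_S: 
  assumes "w \<in> lists {..<n}"
  shows "FB_eval n (map S w) = perm_elt n (sword w)"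
  using assms
proof (induction w)
  case Nil
  have "FB_eval n [] = \<one>\<^bsub>IB n\<^esub>" by (simp add: word_eval_def)
  then show ?case by (simp only: list.map sword.simps perm_elt_id)
next
  case (Cons i w)
  then have i: "i < n" and w: "w \<in> lists {..<n}" by auto
  have "FB_eval n (map S (i # w)) = s_elt n i \<otimes>\<^bsub>IB n\<^esub> FB_eval n (map S w)"
    by (simp add: word_eval_def)
  also have "\<dots> = perm_elt n (sgen i) \<otimes>\<^bsub>IB n\<^esub> perm_elt n (sword w)"
    by (simp only: s_elt_eq[OF i] Cons.IH)
  also have "\<dots> = perm_elt n (sword (i # w))"
    unfolding sword.simps by (intro perm_elt_mult sgen_signed_perms sword_signed_perms i w)
  finally show ?case .
qed

lemma FB_eval_Xi: "i < n \<Longrightarrow> FB_eval n [Xi i] = inv_equiv_elt n {(lo i, hi i)}"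
proof -
  interpret IB: monoid "IB n" by (rule IB_monoid)
  show "i < n \<Longrightarrow> FB_eval n [Xi i] = inv_equiv_elt n {(lo i, hi i)}"
    by (simp add: word_eval_def xi_elt_eq inv_equiv_elt_in)
qed

lemma perm_elt_generated:
  assumes "g \<in> signed_perms n"
  shows "perm_elt n g \<in> FB_eval n ` lists (alphabet n)"
proof -
  obtain w where w: "w \<in> lists {..<n}" "sword w = g" using signed_perm_word[OF assms] by blast
  then have "perm_elt n g = FB_eval n (map S w)" using FB_eval_map_S by simp
  then show ?thesis using map_S_in[OF w(1)] by (rule image_eqI)
qed

lemma generated_mult:
  assumes "x \<in> FB_eval n ` lists (alphabet n)" "y \<in> FB_eval n ` lists (alphabet n)"
  shows "x \<otimes>\<^bsub>IB n\<^esub> y \<in> FB_eval n ` lists (alphabet n)"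
proof -
  obtain u v where "u \<in> lists (alphabet n)" "v \<in> lists (alphabet n)" "x = FB_eval n u"
      "y = FB_eval n v"
    using assms by blast
  then show ?thesis using FB_eval_append[of u n v] by (intro image_eqI[of _ _ "u @ v"]) auto
qed

lemma inv_equiv_elt_generated:
  assumes "finite P" "P \<subseteq> signed_set n \<times> signed_set n"
  shows "inv_equiv_elt n P \<in> FB_eval n ` lists (alphabet n)"
  using assms
proof (induction P)
  case empty
  have "inv_equiv_elt n {} = FB_eval n []" by (simp add: inv_equiv_elt_empty word_eval_def)
  then show ?case by blast
next
  case (insert p P)
  interpret IB: monoid "IB n" by (rule IB_monoid)
  obtain x y where p: "p = (x, y)" by fastforce
  have "inv_equiv_elt n {(x, y)} \<in> FB_eval n ` lists (alphabet n)"
  proof (cases "x = y")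
    case True
    then have "{(x, y)} \<subseteq> inv_equiv n {}" using insert.prems p by (auto intro: inv_equiv.refl)
    then have "inv_equiv n {(x, y)} = inv_equiv n {}"
      using inv_equiv_subsetI[of "{(x, y)}" n "{}"] inv_equiv_mono[of "{}" "{(x, y)}" n] by simp
    then have "inv_equiv_elt n {(x, y)} = FB_eval n []"
      using inv_equiv_elt_empty[of n] by (simp add: inv_equiv_elt_def word_eval_def)
    then show ?thesis by blast
  next
    case False
    then obtain i g where g: "i < n" "g \<in> signed_perms n" "g (lo i) = x" "g (hi i) = y"
      using perm_pair[of x n y] insert.prems p by auto
    have gi: "inv g \<in> signed_perms n" using g by (simp add: signed_perms_inv)
    have "inv (inv g) = g" using g signed_permsD(1) by (metis inv_inv_eq permutes_bij)
    then have "perm_elt n (inv g) \<otimes>\<^bsub>IB n\<^esub> inv_equiv_elt n {(lo i, hi i)} =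
        inv_equiv_elt n {(x, y)} \<otimes>\<^bsub>IB n\<^esub> perm_elt n (inv g)"
      using perm_elt_inv_equiv_elt[OF gi, of "{(lo i, hi i)}"] g by simp
    then have "perm_elt n (inv g) \<otimes>\<^bsub>IB n\<^esub> inv_equiv_elt n {(lo i, hi i)} \<otimes>\<^bsub>IB n\<^esub> perm_elt n g =
        inv_equiv_elt n {(x, y)} \<otimes>\<^bsub>IB n\<^esub> (perm_elt n (inv g) \<otimes>\<^bsub>IB n\<^esub> perm_elt n g)"
      using g gi by (simp add: IB.m_assoc perm_elt_in inv_equiv_elt_in)
    also have "\<dots> = inv_equiv_elt n {(x, y)}"
      using g gi by (simp add: perm_elt_mult signed_perms_inv_comp perm_elt_id inv_equiv_elt_in)
    finally have eq: "inv_equiv_elt n {(x, y)} =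
      perm_elt n (inv g) \<otimes>\<^bsub>IB n\<^esub> inv_equiv_elt n {(lo i, hi i)} \<otimes>\<^bsub>IB n\<^esub> perm_elt n g" by simp
    have "inv_equiv_elt n {(lo i, hi i)} \<in> FB_eval n ` lists (alphabet n)"
      using FB_eval_Xi[OF g(1)] Xi_in[OF g(1)] by (metis imageI)
    then show ?thesis unfolding eq
      using g gi by (intro generated_mult perm_elt_generated)
  qed
  then have "inv_equiv_elt n {(x, y)} \<otimes>\<^bsub>IB n\<^esub> inv_equiv_elt n P \<in> FB_eval n ` lists (alphabet n)"
    using insert by (intro generated_mult) auto
  then show ?case by (simp add: inv_equiv_elt_mult p)
qed

text \<open>An idempotent is a finite join of idempotents of single pairs, which are conjugates of the
  \<open>xi i\<close> by units.\<close>

lemma FB_generated: "FB_eval n ` lists (alphabet n) = carrier (FB n)"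
proof (intro subset_antisym subsetI)
  fix a assume "a \<in> carrier (FB n)"
  then obtain P g where g: "g \<in> signed_perms n" and a: "a = inv_equiv_elt n P \<otimes>\<^bsub>IB n\<^esub> perm_elt n g"
    by (auto simp: FB_carrier)
  let ?P = "inv_equiv n P"
  have sub: "?P \<subseteq> signed_set n \<times> signed_set n" using inv_equiv_in by auto
  then have "finite ?P" by (rule finite_subset) simp
  moreover have "inv_equiv n ?P = ?P"
    using inv_equiv_subsetI[of ?P n P] sub by (auto intro: inv_equiv.base)
  then have "inv_equiv_elt n P = inv_equiv_elt n ?P" by (simp add: inv_equiv_elt_def)
  ultimately show "a \<in> FB_eval n ` lists (alphabet n)"
    unfolding a using sub g by (auto intro: generated_mult inv_equiv_elt_generated
        perm_elt_generated)
qed (use FB_eval_in in blast)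

section \<open>Validity of the relations\<close>

lemma FB_rels_words: "FB_rels n \<subseteq> lists (alphabet n) \<times> lists (alphabet n)"
  by (auto simp: FB_rels_def rels1_def rels2_def rels3_def rels4_def rels5_def rels6_def rels7_def
      rels8_def rels9_def alphabet_def)

lemma sound_S:
  assumes "u \<in> lists {..<n}" "v \<in> lists {..<n}" "sword u = sword v"
  shows "FB_eval n (map S u) = FB_eval n (map S v)"
  using assms by (simp only: FB_eval_map_S)

text \<open>All relations that move a letter \<open>Xi\<close> through letters \<open>S\<close> say that a signed permutation
  takes one pair to another.\<close>

lemma sound_transport:
  assumes i: "i < n" and j: "j < n" and w: "w \<in> lists {..<n}"
    and pair: "same_pair (lo j, hi j) (sword w (lo i), sword w (hi i))"
  shows "FB_eval n (Xi i # map S w) = FB_eval n (map S w @ [Xi j])"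
proof -
  let ?g = "sword w"
  have g: "?g \<in> signed_perms n" using w by (rule sword_signed_perms)
  have pos: "inv ?g y = x" if "?g x = y" for x y
    using signed_permsD(7)[OF g, of x] that by simp
  have neg: "inv ?g y = - x" if "?g x = - y" for x y
    using signed_permsD(7)[OF g, of "- x"] signed_permsD(2)[OF g, of x] that by simp
  have "?g (lo i) = lo j \<and> ?g (hi i) = hi j \<or> ?g (lo i) = hi j \<and> ?g (hi i) = lo j \<or>
      ?g (lo i) = - lo j \<and> ?g (hi i) = - hi j \<or> ?g (lo i) = - hi j \<and> ?g (hi i) = - lo j"
    using pair unfolding same_pair_def by simp
  then have "same_pair (lo i, hi i) (inv ?g (lo j), inv ?g (hi j))"
  proof (elim disjE conjE)
    assume 1: "?g (lo i) = lo j" "?g (hi i) = hi j"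
    show ?thesis by (simp add: same_pair_def pos[OF 1(1)] pos[OF 1(2)])
  next
    assume 1: "?g (lo i) = hi j" "?g (hi i) = lo j"
    show ?thesis by (simp add: same_pair_def pos[OF 1(1)] pos[OF 1(2)])
  next
    assume 1: "?g (lo i) = - lo j" "?g (hi i) = - hi j"
    show ?thesis by (simp add: same_pair_def neg[OF 1(1)] neg[OF 1(2)])
  next
    assume 1: "?g (lo i) = - hi j" "?g (hi i) = - lo j"
    show ?thesis by (simp add: same_pair_def neg[OF 1(1)] neg[OF 1(2)])
  qed
  then have "inv_equiv_elt n {(lo i, hi i)} = inv_equiv_elt n {(inv ?g (lo j), inv ?g (hi j))}"
    unfolding inv_equiv_elt_def by (simp only: inv_equiv_same_pair)
  then have "inv_equiv_elt n {(lo i, hi i)} \<otimes>\<^bsub>IB n\<^esub> perm_elt n ?g =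
      perm_elt n ?g \<otimes>\<^bsub>IB n\<^esub> inv_equiv_elt n {(lo j, hi j)}"
    using perm_elt_inv_equiv_elt[OF g, of "{(lo j, hi j)}"] by simp
  moreover have "FB_eval n ([Xi i] @ map S w) = inv_equiv_elt n {(lo i, hi i)} \<otimes>\<^bsub>IB n\<^esub> perm_elt n
      ?g"
    by (subst FB_eval_append[OF Xi_in[OF i] map_S_in[OF w]])
       (simp only: FB_mult FB_eval_Xi[OF i] FB_eval_map_S[OF w])
  moreover have "FB_eval n (map S w @ [Xi j]) = perm_elt n ?g \<otimes>\<^bsub>IB n\<^esub> inv_equiv_elt n {(lo j, hi
      j)}"
    by (subst FB_eval_append[OF map_S_in[OF w] Xi_in[OF j]])
       (simp only: FB_mult FB_eval_Xi[OF j] FB_eval_map_S[OF w])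
  ultimately show ?thesis by simp
qed

text \<open>With this value, the relations between an idempotent and a conjugate of an idempotent become
  statements about joins.\<close>

lemma FB_eval_conj_Xi:
  assumes i: "i < n" and j: "j < n"
  shows "FB_eval n [S j, Xi i, S j] = inv_equiv_elt n {(sgen j (lo i), sgen j (hi i))}"
proof -
  interpret IB: monoid "IB n" by (rule IB_monoid)
  note s = sgen_signed_perms[OF j]
  let ?s = "perm_elt n (sgen j)" and ?P = "{(sgen j (lo i), sgen j (hi i))}"
  have "FB_eval n [S j, Xi i, S j] = ?s \<otimes>\<^bsub>IB n\<^esub> (inv_equiv_elt n {(lo i, hi i)} \<otimes>\<^bsub>IB n\<^esub> ?s)"
    using i j by (simp add: word_eval_def xi_elt_eq s_elt_eq perm_elt_in s)
  also have "\<dots> = inv_equiv_elt n ?P \<otimes>\<^bsub>IB n\<^esub> ?s \<otimes>\<^bsub>IB n\<^esub> ?s"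
    using perm_elt_inv_equiv_elt[OF s, of "{(lo i, hi i)}"]
    by (simp add: inv_sgen perm_elt_in s inv_equiv_elt_in flip: IB.m_assoc)
  also have "\<dots> = inv_equiv_elt n ?P \<otimes>\<^bsub>IB n\<^esub> (?s \<otimes>\<^bsub>IB n\<^esub> ?s)"
    by (intro IB.m_assoc perm_elt_in s inv_equiv_elt_in)
  also have "\<dots> = inv_equiv_elt n ?P"
    unfolding perm_elt_mult[OF s s] sgen_comp perm_elt_id by (rule IB.r_one[OF inv_equiv_elt_in])
  finally show ?thesis .
qed

lemma sound_commuting_idempotents:
  assumes "u \<in> lists (alphabet n)" "v \<in> lists (alphabet n)"
    and "FB_eval n u = inv_equiv_elt n P" "FB_eval n v = inv_equiv_elt n Q"
  shows "FB_eval n (u @ v) = FB_eval n (v @ u)"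
  using assms by (simp add: FB_eval_append inv_equiv_elt_mult Un_commute)

lemma rels1_sound: "(u, v) \<in> rels1 n \<Longrightarrow> FB_eval n u = FB_eval n v"
proof -
  interpret coxeter_B n "\<lambda>i. Endo (sgen i)" by (rule coxeter_B_sgen)
  have braid': "sword [i, j, i] = sword [j, i, j]" if "1 \<le> i" "1 \<le> j" "\<bar>int i - int j\<bar> = 1"
      "i < n" "j < n" for i j
  proof -
    have "j = Suc i \<or> i = Suc j" using that by linarith
    then show ?thesis using that braid[of i] braid[of j]
      by (auto simp: times_endo.abs_eq Endo_inject comp_assoc)
  qed
  have far': "sword [i, j] = sword [j, i]" if "\<bar>int i - int j\<bar> > 1" "i < n" "j < n" for i j
  proof -
    have "Suc i < j \<or> Suc j < i" using that by linarith
    then show ?thesis using that far[of i j] far[of j i]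
      by (auto simp: times_endo.abs_eq Endo_inject)
  qed
  have braid0': "sword [0, 1, 0, 1] = sword [1, 0, 1, 0]" if "1 < n"
    using that braid0 by (simp add: times_endo.abs_eq Endo_inject comp_assoc)
  assume "(u, v) \<in> rels1 n"
  then consider "1 < n" "u = map S [0, 1, 0, 1]" "v = map S [1, 0, 1, 0]"
    | i j where "1 \<le> i" "1 \<le> j" "\<bar>int i - int j\<bar> = 1" "i < n" "j < n" "u = map S [i, j, i]"
        "v = map S [j, i, j]"
    | i j where "\<bar>int i - int j\<bar> > 1" "i < n" "j < n" "u = map S [i, j]" "v = map S [j, i]"
    unfolding rels1_def by (auto split: if_splits)
  then show ?thesis
  proof cases
    case 1 then show ?thesis by (simp only:) (intro sound_S braid0'; simp)
  next
    case 2 then show ?thesis by (simp only:) (intro sound_S braid'; simp)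
  next
    case 3 then show ?thesis by (simp only:) (intro sound_S far'; simp)
  qed
qed

lemma rels235_sound: "(u, v) \<in> rels2 n \<union> rels3 n \<union> rels5 n \<Longrightarrow> FB_eval n u = FB_eval n v"
proof -
  assume "(u, v) \<in> rels2 n \<union> rels3 n \<union> rels5 n"
  then obtain i j w where "i < n" "j < n" "w \<in> lists {..<n}"
    "same_pair (lo j, hi j) (sword w (lo i), sword w (hi i))" "u = Xi i # map S w"
        "v = map S w @ [Xi j]"
  proof -
    assume that: "\<And>i j w. i < n \<Longrightarrow> j < n \<Longrightarrow> w \<in> lists {..<n} \<Longrightarrow>
      same_pair (lo j, hi j) (sword w (lo i), sword w (hi i)) \<Longrightarrow>
      u = Xi i # map S w \<Longrightarrow> v = map S w @ [Xi j] \<Longrightarrow> thesis"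
    from \<open>(u, v) \<in> _\<close> consider
      i j where "1 \<le> i" "i < n" "1 \<le> j" "j < n" "\<bar>int i - int j\<bar> = 1" "u = [Xi i, S j, S i]"
          "v = [S j, S i, Xi j]"
      | "1 < n" "u = [Xi 0, S 1, S 0, S 1]" "v = [S 1, S 0, S 1, Xi 0]"
      | "1 < n" "u = [Xi 1, S 0, S 1, S 0]" "v = [S 0, S 1, S 0, Xi 1]"
      | i j where "i < n" "j < n" "\<bar>int i - int j\<bar> > 1" "u = [Xi i, S j]" "v = [S j, Xi i]"
      | i where "i < n" "u = [Xi i, S i]" "v = [S i, Xi i]"
      unfolding rels2_def rels3_def rels5_def by (auto split: if_splits)
    then show thesis
    proof cases
      case (1 i j)
      then have "j = Suc i \<or> i = Suc j" by linarith
      then have "same_pair (lo j, hi j) (sword [j, i] (lo i), sword [j, i] (hi i))"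
        using 1(1,3) by (elim disjE) (simp_all add: same_pair_def sgen_def sreflect_def lo_def)
      then show ?thesis using 1 by (intro that[of i j "[j, i]"]) auto
    next
      case 2
      have "same_pair (lo 0, hi 0) (sword [1, 0, 1] (lo 0), sword [1, 0, 1] (hi 0))"
        by (simp add: same_pair_def sgen_def sreflect_def lo_def)
      then show ?thesis using 2 by (intro that[of 0 0 "[1, 0, 1]"]) auto
    next
      case 3
      have "same_pair (lo 1, hi 1) (sword [0, 1, 0] (lo 1), sword [0, 1, 0] (hi 1))"
        by (simp add: same_pair_def sgen_def sreflect_def lo_def)
      then show ?thesis using 3 by (intro that[of 1 1 "[0, 1, 0]"]) auto
    next
      case (4 i j)
      then have "Suc i < j \<or> Suc j < i" by linarith
      then have "same_pair (lo i, hi i) (sword [j] (lo i), sword [j] (hi i))"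
        by (elim disjE) (simp_all add: same_pair_def sgen_def sreflect_def lo_def)
      then show ?thesis using 4 by (intro that[of i i "[j]"]) auto
    next
      case (5 i)
      have "same_pair (lo i, hi i) (sword [i] (lo i), sword [i] (hi i))"
        by (simp add: same_pair_def sgen_def sreflect_def)
      then show ?thesis using 5 by (intro that[of i i "[i]"]) auto
    qed
  qed
  then show ?thesis using sound_transport by simp
qed

lemma rels4_sound: "(u, v) \<in> rels4 n \<Longrightarrow> FB_eval n u = FB_eval n v"
  using sound_commuting_idempotents[OF Xi_in Xi_in FB_eval_Xi FB_eval_Xi]
  by (fastforce simp: rels4_def)

lemma Xi_absorbs_S:
  assumes i: "i < n"
  shows "FB_eval n [Xi i, S i] = FB_eval n [Xi i]"
proof -
  interpret IB: monoid "IB n" by (rule IB_monoid)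
  let ?\<xi> = "inv_equiv_elt n {(lo i, hi i)}"
  have base: "(lo i, hi i) \<in> inv_equiv n {(lo i, hi i)}"
    using lo_in[OF i] hi_in[OF i] by (intro inv_equiv.base) auto
  have "(x, inv id (sgen i x)) \<in> inv_equiv n {(lo i, hi i)}" if "x \<in> signed_set n" for x
    using that base inv_equiv.neg[OF base]
    by (auto simp: sgen_def sreflect_def intro: inv_equiv.refl inv_equiv.sym)
  then have "?\<xi> \<otimes>\<^bsub>IB n\<^esub> perm_elt n id = ?\<xi> \<otimes>\<^bsub>IB n\<^esub> perm_elt n (sgen i)"
    using normal_form_eq_iff[OF signed_perms_id sgen_signed_perms[OF i]] by blast
  then have "?\<xi> \<otimes>\<^bsub>IB n\<^esub> perm_elt n (sgen i) = ?\<xi>"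
    by (simp only: perm_elt_id IB.r_one[OF inv_equiv_elt_in])
  moreover have "FB_eval n [Xi i, S i] = ?\<xi> \<otimes>\<^bsub>IB n\<^esub> perm_elt n (sgen i)"
    using i by (simp add: word_eval_def xi_elt_eq s_elt_eq perm_elt_in sgen_signed_perms)
  ultimately show ?thesis using i by (simp add: FB_eval_Xi)
qed

lemma rels6_sound: "(u, v) \<in> rels6 n \<Longrightarrow> FB_eval n u = FB_eval n v"
proof -
  assume "(u, v) \<in> rels6 n"
  then consider i where "i < n" "u = map S [i, i]" "v = map S []"
    | i where "i < n" "u = [Xi i] @ [Xi i]" "v = [Xi i]"
    | i where "i < n" "u = [Xi i, S i]" "v = [Xi i]"
    | i where "i + 1 < n" "u = [Xi i] @ [Xi (i + 1)]" "v = [Xi (i + 1)] @ [Xi i]"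
    unfolding rels6_def by auto
  then show ?thesis
  proof cases
    case (1 i)
    have "sword [i, i] = sword []" by simp
    with 1 show ?thesis by (simp only:) (intro sound_S; simp)
  next
    case (2 i)
    have "FB_eval n ([Xi i] @ [Xi i]) = FB_eval n [Xi i]"
      unfolding FB_eval_append[OF Xi_in[OF 2(1)] Xi_in[OF 2(1)]] FB_mult FB_eval_Xi[OF 2(1)]
        inv_equiv_elt_mult by simp
    then show ?thesis unfolding 2 .
  next
    case 3
    then show ?thesis using Xi_absorbs_S by simp
  next
    case (4 i)
    then show ?thesis unfolding 4(2,3)
      by (intro sound_commuting_idempotents[OF _ _ FB_eval_Xi FB_eval_Xi] Xi_in) auto
  qed
qed

lemma rels78_sound: "(u, v) \<in> rels7 n \<union> rels8 n \<Longrightarrow> FB_eval n u = FB_eval n v"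
proof -
  assume "(u, v) \<in> rels7 n \<union> rels8 n"
  then consider "1 < n" "u = [S 1, Xi 0, S 1] @ [Xi 0]" "v = [Xi 0] @ [S 1, Xi 0, S 1]"
    | "1 < n" "u = [S 0, Xi 1, S 0] @ [Xi 1]" "v = [Xi 1] @ [S 0, Xi 1, S 0]"
    unfolding rels7_def rels8_def by (auto split: if_splits)
  then show ?thesis
  proof cases
    case 1
    then show ?thesis unfolding 1(2,3)
      by (intro sound_commuting_idempotents[OF _ _ FB_eval_conj_Xi FB_eval_Xi]) (auto simp:
          alphabet_def)
  next
    case 2
    then show ?thesis unfolding 2(2,3)
      by (intro sound_commuting_idempotents[OF _ _ FB_eval_conj_Xi FB_eval_Xi]) (auto simp:
          alphabet_def)
  qed
qed

text \<open>Joining \<open>1\<close> with \<open>- 1\<close> and \<open>2\<close>, and joining \<open>2\<close> with \<open>1\<close> and \<open>- 1\<close>, produce the same class.\<close>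

lemma rels9_sound: "(u, v) \<in> rels9 n \<Longrightarrow> FB_eval n u = FB_eval n v"
proof -
  assume "(u, v) \<in> rels9 n"
  then have n: "1 < n" and uv: "u = [Xi 0] @ [Xi 1]" "v = [S 0, Xi 1, S 0] @ [Xi 1]"
    unfolding rels9_def by (auto split: if_splits)
  let ?P = "{(- 1, 1), (1, 2)} :: (int \<times> int) set" and ?Q = "{(- 1, 2), (1, 2)} :: (int \<times> int) set"
  have mem: "1 \<in> signed_set n" "2 \<in> signed_set n" "- 1 \<in> signed_set n"
    using n by (auto simp: signed_set_def)
  have P: "(- 1, 1) \<in> inv_equiv n ?P" "(1, 2) \<in> inv_equiv n ?P"
    and Q: "(- 1, 2) \<in> inv_equiv n ?Q" "(1, 2) \<in> inv_equiv n ?Q"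
    using mem by (auto intro: inv_equiv.base)
  have "(- 1, 2) \<in> inv_equiv n ?P" using P by (rule inv_equiv.trans)
  moreover have "(- 1, 1) \<in> inv_equiv n ?Q" using Q(1) inv_equiv.sym[OF Q(2)] by (rule
      inv_equiv.trans)
  ultimately have eq: "inv_equiv n ?P = inv_equiv n ?Q"
    using P Q by (intro subset_antisym inv_equiv_subsetI) auto
  have "FB_eval n u = inv_equiv_elt n ({(lo 0, hi 0)} \<union> {(lo 1, hi 1)})"
    unfolding uv using n
    by (subst FB_eval_append) (simp_all add: FB_eval_Xi inv_equiv_elt_mult alphabet_def del:
        One_nat_def)
  also have "\<dots> = inv_equiv_elt n ?P" by (simp add: lo_def insert_commute)
  also have "\<dots> = inv_equiv_elt n ({(sgen 0 (lo 1), sgen 0 (hi 1))} \<union> {(lo 1, hi 1)})"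
    using eq by (simp add: inv_equiv_elt_def lo_def sgen_def sreflect_def insert_commute)
  also have "\<dots> = FB_eval n v"
    unfolding uv using n
    by (subst FB_eval_append) (simp_all add: FB_eval_Xi FB_eval_conj_Xi inv_equiv_elt_mult
        alphabet_def del: One_nat_def)
  finally show ?thesis .
qed

lemma FB_rels_sound: "(u, v) \<in> FB_rels n \<Longrightarrow> FB_eval n u = FB_eval n v"
  unfolding FB_rels_def
  using rels1_sound rels235_sound rels4_sound rels6_sound rels78_sound rels9_sound by blast

lemma gen_cong_sound:
  assumes "(u, v) \<in> gen_cong (alphabet n) (FB_rels n)"
  shows "FB_eval n u = FB_eval n v"
  using assms
proof induction
  case (step u v a c)
  then have "u \<in> lists (alphabet n)" "v \<in> lists (alphabet n)" using FB_rels_words by blast+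
  then show ?case using step FB_rels_sound by (simp add: FB_eval_append del: FB_mult)
qed auto

section \<open>The regular representation of a presented monoid\<close>

text \<open>Words modulo the congruence generated by \<open>R\<close>, acting on the right on representatives of the
  congruence classes.\<close>

locale word_presentation =
  fixes A :: "'g set" and R :: "('g list \<times> 'g list) set"
  assumes R_words: "R \<subseteq> lists A \<times> lists A"
begin

abbreviation cong :: "('g list \<times> 'g list) set" where "cong \<equiv> gen_cong A R"

lemma cong_in: "(u, v) \<in> cong \<Longrightarrow> u \<in> lists A \<and> v \<in> lists A"
  by (induction rule: gen_cong.induct) (use R_words in auto)

lemma cong_append: "(u, v) \<in> cong \<Longrightarrow> w \<in> lists A \<Longrightarrow> (u @ w, v @ w) \<in> cong"
proof (induction rule: gen_cong.induct)
  case (step u v a c)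
  then show ?case using gen_cong.step[of u v R a A "c @ w"] by simp
next
  case (refl u)
  then show ?case by (intro gen_cong.refl) simp
qed (blast intro: gen_cong.sym gen_cong.trans)+

definition canon :: "'g list \<Rightarrow> 'g list" where
  "canon u = (SOME v. (u, v) \<in> cong)"

lemma canon_cong: "u \<in> lists A \<Longrightarrow> (u, canon u) \<in> cong"
  unfolding canon_def by (rule someI[of _ u]) (rule gen_cong.refl)

lemma canon_in: "u \<in> lists A \<Longrightarrow> canon u \<in> lists A"
  using canon_cong cong_in by blast

lemma canon_eq: "(u, v) \<in> cong \<Longrightarrow> canon u = canon v"
proof -
  assume uv: "(u, v) \<in> cong"
  have "(u, w) \<in> cong \<longleftrightarrow> (v, w) \<in> cong" for w
    using uv gen_cong.sym[OF uv] gen_cong.trans by metis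
  then show ?thesis by (simp add: canon_def)
qed

lemma canon_append: "u \<in> lists A \<Longrightarrow> w \<in> lists A \<Longrightarrow> canon (canon u @ w) = canon (u @ w)"
  using canon_eq[OF gen_cong.sym[OF cong_append[OF canon_cong]]] .

text \<open>Words that are not chosen representatives stay fixed, so that the empty word acts as the
  identity and relations with an empty side are respected.\<close>

definition right_mult :: "'g \<Rightarrow> 'g list endo" where
  "right_mult l = Endo (\<lambda>x. if x \<in> canon ` lists A then canon (x @ [l]) else x)"

lemma act_right_mult:
  assumes "u \<in> lists A"
  shows "act (prod_list (map right_mult u)) x = (if x \<in> canon ` lists A then canon (x @ u) else x)"
  using assms
proof (induction u arbitrary: x)
  case Nil
  have "canon (canon w) = canon w" if "w \<in> lists A" for w
    using canon_append[of w "[]"] that by simp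
  then have "canon x = x" if "x \<in> canon ` lists A" using that by (elim imageE) simp
  then show ?case by (simp add: one_endo.rep_eq)
next
  case (Cons l u)
  then have lu: "[l] \<in> lists A" "u \<in> lists A" by auto
  have first: "act (right_mult l) x = (if x \<in> canon ` lists A then canon (x @ [l]) else x)"
    by (simp only: right_mult_def Endo_inverse UNIV_I)
  have "act (prod_list (map right_mult (l # u))) x = act (prod_list (map right_mult u)) (act
      (right_mult l) x)"
    by (simp add: times_endo.rep_eq)
  also have "\<dots> = (if x \<in> canon ` lists A then canon (x @ l # u) else x)"
  proof (cases "x \<in> canon ` lists A")
    case True
    then obtain w where "w \<in> lists A" "x = canon w" by (rule imageE)
    then have x: "x @ [l] \<in> lists A" using canon_in[of w] lu(1) by simp
    then have "canon (x @ [l]) \<in> canon ` lists A" by (rule imageI)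
    then show ?thesis using True canon_append[OF x lu(2)] Cons.IH by (simp add: first)
  next
    case False
    then show ?thesis using Cons.IH by (simp only: first if_False)
  qed
  finally show ?case .
qed

lemma right_mult_rel:
  assumes "(u, v) \<in> R"
  shows "prod_list (map right_mult u) = prod_list (map right_mult v)"
proof -
  have uv: "u \<in> lists A" "v \<in> lists A" using assms R_words by auto
  have eq: "canon (x @ u) = canon (x @ v)" if "x \<in> lists A" for x
    using canon_eq gen_cong.step[OF assms that, of "[]"] by simp
  have "act (prod_list (map right_mult u)) x = act (prod_list (map right_mult v)) x" for x
  proof (cases "x \<in> canon ` lists A")
    case True
    then obtain w where "w \<in> lists A" "x = canon w" by (rule imageE)
    then have "x \<in> lists A" using canon_in[of w] by simp
    then show ?thesis by (simp only: act_right_mult uv eq)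
  qed (simp only: act_right_mult uv if_False)
  then show ?thesis by (simp add: act_inject[symmetric] fun_eq_iff)
qed

text \<open>The image of the representative of the empty word determines the class.\<close>

lemma right_mult_faithful:
  assumes "u \<in> lists A" "v \<in> lists A" "prod_list (map right_mult u) = prod_list (map right_mult v)"
  shows "(u, v) \<in> cong"
proof -
  have "act (prod_list (map right_mult w)) (canon []) = canon w" if "w \<in> lists A" for w
    using that canon_append[of "[]" w] by (simp add: act_right_mult)
  then have "canon u = canon v" using assms by metis
  then show ?thesis
    using canon_cong[OF assms(1)] canon_cong[OF assms(2)] by (metis gen_cong.sym gen_cong.trans)
qed

end

theorem proposition14:
  fixes n :: nat
  assumes "n \<ge> 1"
  shows "has_presentation (FB n) (alphabet n) (letter_elt n) (FB_rels n)"
proof -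
  interpret W: word_presentation "alphabet n" "FB_rels n"
    by standard (rule FB_rels_words)
  interpret M: FB_model n W.right_mult
    by standard (rule W.right_mult_rel)
  have "(u, v) \<in> gen_cong (alphabet n) (FB_rels n)"
    if u: "u \<in> lists (alphabet n)" and v: "v \<in> lists (alphabet n)" and eq:
        "FB_eval n u = FB_eval n v" for u v
  proof -
    obtain ps g where ps: "nf u = (ps, g)" by fastforce
    obtain qs h where qs: "nf v = (qs, h)" by fastforce
    note in_u = nf_in[OF u ps] and in_v = nf_in[OF v qs]
    have g: "g \<in> signed_perms n" and h: "h \<in> signed_perms n"
      and sets: "set ps \<subseteq> M.pairs" "set qs \<subseteq> M.pairs" using in_u in_v by auto
    have "inv_equiv_elt n (set ps) \<otimes>\<^bsub>IB n\<^esub> perm_elt n g =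
        inv_equiv_elt n (set qs) \<otimes>\<^bsub>IB n\<^esub> perm_elt n h"
      using eq by (simp only: FB_eval_nf[OF u ps] FB_eval_nf[OF v qs])
    from normal_form_eq_iff[OF g h, THEN iffD1, OF this]
    have atoms: "inv_equiv n (set ps) = inv_equiv n (set qs)"
      and rel: "\<forall>x\<in>signed_set n. (x, inv g (h x)) \<in> inv_equiv n (set ps)" by blast+
    have "M.atoms ps * M.T g = M.atoms qs * M.T h"
      by (rule M.normal_form_eq[OF sets g h atoms]) (rule bspec[OF rel])
    then show ?thesis
      by (intro W.right_mult_faithful u v) (simp only: M.eval_nf[OF u ps] M.eval_nf[OF v qs])
  qed
  then have "FB_eval n u = FB_eval n v \<longleftrightarrow> (u, v) \<in> gen_cong (alphabet n) (FB_rels n)"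
    if "u \<in> lists (alphabet n)" "v \<in> lists (alphabet n)" for u v
    using that gen_cong_sound[of u v n] by blast
  then show ?thesis
    unfolding has_presentation_def
    by (intro conjI ballI Pi_I FB_monoid FB_rels_words FB_generated letter_elt_in_FB)
qed

end
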